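(* For every $n\ge0$, the map $f$ defined below is a bijection from the set of $\beta(1,0)$-trees with $n+1$ nodes onto the set of avoiders of length $n$, and for every such tree $t$: $\mathrm{comp}\,f(t)=\mathrm{sub}\,t$, $1+\mathrm{asc}\,f(t)=\mathrm{leaves}\,t$, $\mathrm{lmax}\,f(t)=\mathrm{root}\,t$, $\mathrm{lmin}\,f(t)=\mathrm{lpath}\,t$, $\mathrm{rmax}\,f(t)=\mathrm{rpath}\,t$, $\mathrm{ldr}\,f(t)=\mathrm{lsub}\,t$, $\mathrm{lir}\,f(t)=\mathrm{stem}_{\mathrm{hm}}\,t$.
   Context: Trees. A $\beta(1,0)$-tree is a rooted plane tree whose nodes are labeled by positive integers with leaves labeled 1, root label equal to the sum of its children's labels, and every other node's label at most the sum of its children's labels; in addition the single-node tree $\bullet$ is included, with conventions $\mathrm{leaves}(\bullet)=1$ and $\mathrm{sub}=\mathrm{root}=\mathrm{lpath}=\mathrm{rpath}=\mathrm{lsub}=\mathrm{stem}_{\mathrm{hm}}=0$ on $\bullet$. For trees $u,v\neq\bullet$, $u\oplus v$ has root label $\mathrm{root}(u)+\mathrm{root}(v)$ and root subtrees those of $u$ followed by those of $v$. For a tree $t$ with root label $k$ and $1\le i\le k$, $\lambda(i,t)$ is obtained by joining a new root by an edge to the old root and giving both the label $i$. Every tree with at least one edge is either $u\oplus v$ with $u,v\neq\bullet$ or $\lambda(i,u)$ with $1\le i\le\mathrm{root}(u)$, and not both. Tree statistics: $\mathrm{sub}$ = number of children of the root; $\mathrm{leaves}$ = number of leaves; $\mathrm{root}$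 = root label; $\mathrm{lpath}$, $\mathrm{rpath}$ = number of edges from the root to the leftmost, resp. rightmost, leaf; $\mathrm{lsub}$ = number of nodes labeled 1 on the left path other than the root; $\mathrm{stem}_{\mathrm{hm}}(t)$: with leaves $\ell_1,\dots,\ell_m$ from left to right, starting at $j=1$, if no node on the path from $\ell_j$ to the root other than $\ell_j$ has current label 1, decrease the labels of all nodes on that path by 1, delete $\ell_j$ and go to $j+1$; the first $j$ whose path contains a node other than $\ell_j$ of current label 1 is $\mathrm{stem}_{\mathrm{hm}}(t)$. Permutations. A permutation $a_1\cdots a_n$ of $[n]$ is an avoider if there are no $i<j<k<\ell$ with $a_j<a_\ell<a_i<a_k$ and no $i<j<k$ with $j+1<k$ and $a_{j+1}<a_i<a_k<a_j$ (i.e. it avoids 3-1-4-2 and the dashed pattern 2-41-3); the empty permutation $\epsilon$ is an avoider. $\sigma\oplus\tau$ is $\sigma$ followed by $\tau$ with $|\sigma|$ added to each letter of $\tau$. $\alpha\prec\beta$ means every letter of $\alpha$ is less than every letter of $\beta$ (vacuous if one is empty). Statistics (all $0$ on $\epsilon$): $\mathrm{comp}$ = number of components, a component being a nonempty factor $\tau$ with $\pi=\alpha\tau\beta$, $\alpha\prec\tau\prec\beta$, and such that $\tau=\gamma\delta$ with $\gamma\prec\delta$ forces $\gamma$ or $\delta$ empty; $\mathrm{asc}$ = number of $j$ with $a_j<a_{j+1}$; $\mathrm{lmax}$ ($\mathrm{lmin}$) = number of letters larger (smaller) than all letters to their left; $\mathrm{rmax}$ = number of letters larger than all letters to their right; $\mathrm{ldr}$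 = largest $i$ with $a_1>\dots>a_i$; $\mathrm{lir}$ = largest $i$ with $a_1<\dots<a_i$. For $V=\{v_1<\dots<v_m\}$ and a permutation $\rho$ of $[m]$, $\mathrm{st}_V^{-1}(\rho)$ replaces each letter $j$ by $v_j$; $\mathrm{st}(w)$ is the permutation order-isomorphic to $w$. The map $\psi$ (on avoiders $\pi$ of $[n]$, $n\ge2$, whose first letter is not $n$ and with $n$ left of $n-1$): write $\pi=\sigma n\tau$; let $\sigma_1\prec\dots\prec\sigma_k$ be the subsequences of $\sigma$ formed by the maximal blocks of consecutive integers among its letters, $\sigma_0=\sigma_{k+1}$ empty; $w_i$ ($0\le i\le k$) the subsequence of letters $x$ of $\tau$ with $\sigma_i\prec x\prec\sigma_{i+1}$; for $1\le i\le k$ write $w_i=u_i\hat0_iv_i$ with $\hat0_i=\min w_i$, $m_i=\#\{x\in v_i:x\prec u_i\}$, $L_i=\{x+m_i+1:x\in\sigma_i\}$, $L=\bigcup_iL_i$, $R=[n-1]\setminus L$; $\psi(\pi)=\mathrm{st}_L^{-1}(\mathrm{st}(\sigma))\,n\,\mathrm{st}_R^{-1}(\mathrm{st}(\tau))$. The map $\phi$: for an avoider $\pi$ of $[n-1]$ and $1\le i\le\mathrm{lmax}\,\pi$, let $\hat\pi$ be obtained by inserting $n$ immediately left of the $i$-th left-to-right maximum of $\pi$; $\phi(1,\pi)=\hat\pi$ and $\phi(i,\pi)=\psi(\hat\pi)$ for $i>1$. The map $f$ is defined recursively by $f(\bullet)=\epsilon$, $f(\lambda(i,t))=\phi(i,f(t))$,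 and $f(u\oplus v)=f(u)\oplus f(v)$. *)

theory Defs
  imports "HOL-Combinatorics.Multiset_Permutations"
begin

section \<open>Trees\<close>

datatype tree = Node (label: nat) (children: "tree list")

fun nodes :: "tree \<Rightarrow> nat" where
  "nodes (Node a ts) = 1 + sum_list (map nodes ts)"

fun valid_nonroot :: "tree \<Rightarrow> bool" where
  "valid_nonroot (Node a ts) \<longleftrightarrow>
     (if ts = [] then a = 1 else 1 \<le> a \<and> a \<le> sum_list (map label ts)) \<and>
     (\<forall>s \<in> set ts. valid_nonroot s)"

text \<open>The single node carries label 1, like every leaf; the convention that its root statistic
  is 0 is built into \<open>root_stat\<close> below.\<close>

definition bullet :: tree where
  "bullet = Node 1 []"

definition beta10_tree :: "tree \<Rightarrow> bool" where
  "beta10_tree t \<longleftrightarrow> t = bullet \<or>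
     children t \<noteq> [] \<and> label t = sum_list (map label (children t)) \<and>
     (\<forall>s \<in> set (children t). valid_nonroot s)"

definition tree_oplus :: "tree \<Rightarrow> tree \<Rightarrow> tree" where
  "tree_oplus u v = Node (label u + label v) (children u @ children v)"

text \<open>For \<open>bullet\<close> the range \<open>1 \<le> i \<le> label t\<close> leaves only \<open>lam 1 bullet\<close>, the one-edge tree.\<close>

definition lam :: "nat \<Rightarrow> tree \<Rightarrow> tree" where
  "lam i t = Node i [Node i (children t)]"

definition sub :: "tree \<Rightarrow> nat" where
  "sub t = length (children t)"

fun leaves :: "tree \<Rightarrow> nat" where
  "leaves (Node a ts) = (if ts = [] then 1 else sum_list (map leaves ts))"

definition root_stat :: "tree \<Rightarrow> nat" where
  "root_stat t = (if t = bullet then 0 else label t)"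

fun lpath :: "tree \<Rightarrow> nat" where
  "lpath (Node a []) = 0"
| "lpath (Node a (s # ss)) = Suc (lpath s)"

function rpath :: "tree \<Rightarrow> nat" where
  "rpath (Node a ts) = (if ts = [] then 0 else Suc (rpath (last ts)))"
  by pat_completeness auto
termination
  by (relation "measure size") (auto simp: less_Suc_eq_le intro!: size_list_estimation'[OF last_in_set])

fun lsub :: "tree \<Rightarrow> nat" where
  "lsub (Node a []) = 0"
| "lsub (Node a (s # ss)) = (if label s = 1 then 1 else 0) + lsub s"

text \<open>\<open>blocked t\<close>: some node other than the leaf on the path from the leftmost leaf to the root
  has label 1. \<open>peel t\<close>: decrease the labels along that path by 1 and delete the leaf.\<close>

fun blocked :: "tree \<Rightarrow> bool" where
  "blocked (Node a []) \<longleftrightarrow> False"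
| "blocked (Node a (s # ss)) \<longleftrightarrow> a = 1 \<or> blocked s"

fun peel :: "tree \<Rightarrow> tree" where
  "peel (Node a []) = Node a []"
| "peel (Node a (s # ss)) = Node (a - 1) (if children s = [] then ss else peel s # ss)"

lemma size_peel: "children t \<noteq> [] \<Longrightarrow> size (peel t) < size t"
  by (induction t rule: peel.induct) auto

text \<open>The next leaf of the original tree is always the leftmost leaf of the peeled tree: peeling
  an unblocked tree never turns an inner node into a leaf (lemma \<open>peel_beta10_tree\<close>).\<close>

function stem :: "tree \<Rightarrow> nat" where
  "stem t = (if children t = [] then 0 else if blocked t then 1 else Suc (stem (peel t)))"
  by auto
termination
  by (relation "measure size") (auto simp: size_peel)

declare stem.simps [simp del]

lemma leaves_pos: "leaves t > 0"
proof (induction t)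
  case (Node a ts)
  then show ?case by (cases ts) auto
qed

lemma peel_valid_nonroot:
  assumes "valid_nonroot t" "children t \<noteq> []" "\<not> blocked t"
  shows "valid_nonroot (peel t) \<and> children (peel t) \<noteq> [] \<and> Suc (label (peel t)) = label t \<and>
         Suc (leaves (peel t)) = leaves t"
  using assms
proof (induction t rule: peel.induct)
  case (2 a s ss)
  show ?case
  proof (cases "children s = []")
    case True
    then obtain b where s: "s = Node b []" by (cases s) auto
    with 2 show ?thesis by auto
  next
    case False
    with 2 have IH: "valid_nonroot (peel s)" "children (peel s) \<noteq> []"
      "Suc (label (peel s)) = label s" "Suc (leaves (peel s)) = leaves s"
      by auto
    with False 2 show ?thesis by auto
  qed
qed auto

lemma label_pos: "valid_nonroot t \<Longrightarrow> 1 \<le> label t"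
  by (cases t) (auto split: if_splits)

lemma peel_beta10_tree:
  assumes "beta10_tree t" "t \<noteq> bullet" "\<not> blocked t"
  shows "beta10_tree (peel t)" "peel t \<noteq> bullet" "Suc (leaves (peel t)) = leaves t"
proof -
  have c: "children t \<noteq> []" and l: "label t = sum_list (map label (children t))"
    and ch: "\<forall>s \<in> set (children t). valid_nonroot s"
    using assms by (auto simp: beta10_tree_def)
  obtain a s ss where t: "t = Node a (s # ss)"
    using c by (cases t; cases "children t") auto
  have "1 \<le> label s"
    using ch t label_pos by simp
  then have v: "valid_nonroot t"
    using t l ch by auto
  note p = peel_valid_nonroot[OF v c assms(3)]
  have sum: "label (peel t) = sum_list (map label (children (peel t)))"
  proof (cases "children s = []")
    case True
    then show ?thesis using t l ch by (cases s) auto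
  next
    case False
    then have "Suc (label (peel s)) = label s"
      using peel_valid_nonroot[of s] t ch assms(3) by auto
    then show ?thesis using t l False by auto
  qed
  show "beta10_tree (peel t)"
    using p sum by (cases "peel t") (auto simp: beta10_tree_def)
  show "peel t \<noteq> bullet" using p by (auto simp: bullet_def)
  show "Suc (leaves (peel t)) = leaves t" using p by blast
qed

section \<open>Words and permutations\<close>

text \<open>Words are lists, so the 1-based positions of the usual notation are shifted by one.\<close>

definition prec :: "nat list \<Rightarrow> nat list \<Rightarrow> bool" (infix \<open>\<prec>\<close> 50) where
  "\<alpha> \<prec> \<beta> \<longleftrightarrow> (\<forall>x \<in> set \<alpha>. \<forall>y \<in> set \<beta>. x < y)"

definition contains_3142 :: "nat list \<Rightarrow> bool" where
  "contains_3142 a \<longleftrightarrow> (\<exists>i j k l. i < j \<and> j < k \<and> k < l \<and> l < length a \<and>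
     a ! j < a ! l \<and> a ! l < a ! i \<and> a ! i < a ! k)"

definition contains_2_41_3 :: "nat list \<Rightarrow> bool" where
  "contains_2_41_3 a \<longleftrightarrow> (\<exists>i j k. i < j \<and> j + 1 < k \<and> k < length a \<and>
     a ! (j + 1) < a ! i \<and> a ! i < a ! k \<and> a ! k < a ! j)"

definition avoiders :: "nat \<Rightarrow> nat list set" where
  "avoiders n = {\<pi> \<in> permutations_of_set {1..n}. \<not> contains_3142 \<pi> \<and> \<not> contains_2_41_3 \<pi>}"

definition perm_oplus :: "nat list \<Rightarrow> nat list \<Rightarrow> nat list" where
  "perm_oplus \<sigma> \<tau> = \<sigma> @ map (\<lambda>x. x + length \<sigma>) \<tau>"

definition component :: "nat list \<Rightarrow> nat list \<Rightarrow> bool" where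
  "component \<pi> \<tau> \<longleftrightarrow> \<tau> \<noteq> [] \<and>
     (\<exists>\<alpha> \<beta>. \<pi> = \<alpha> @ \<tau> @ \<beta> \<and> \<alpha> \<prec> \<tau> \<and> \<tau> \<prec> \<beta>) \<and>
     (\<forall>\<gamma> \<delta>. \<tau> = \<gamma> @ \<delta> \<and> \<gamma> \<prec> \<delta> \<longrightarrow> \<gamma> = [] \<or> \<delta> = [])"

text \<open>The letters of a permutation are distinct, so a nonempty factor occurs only once.\<close>

definition comp_stat :: "nat list \<Rightarrow> nat" where
  "comp_stat \<pi> = card {\<tau>. component \<pi> \<tau>}"

definition asc :: "nat list \<Rightarrow> nat" where
  "asc a = card {j. j + 1 < length a \<and> a ! j < a ! (j + 1)}"

definition lmax_positions :: "nat list \<Rightarrow> nat set" where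
  "lmax_positions a = {j. j < length a \<and> (\<forall>i < j. a ! i < a ! j)}"

definition lmax :: "nat list \<Rightarrow> nat" where
  "lmax a = card (lmax_positions a)"

definition lmin :: "nat list \<Rightarrow> nat" where
  "lmin a = card {j. j < length a \<and> (\<forall>i < j. a ! j < a ! i)}"

definition rmax :: "nat list \<Rightarrow> nat" where
  "rmax a = card {j. j < length a \<and> (\<forall>k. j < k \<and> k < length a \<longrightarrow> a ! k < a ! j)}"

text \<open>Admitting \<open>i = 0\<close> only matters for the empty permutation, where it yields the value 0.\<close>

definition ldr :: "nat list \<Rightarrow> nat" where
  "ldr a = Max {i. i \<le> length a \<and> sorted_wrt (>) (take i a)}"

definition lir :: "nat list \<Rightarrow> nat" where
  "lir a = Max {i. i \<le> length a \<and> sorted_wrt (<) (take i a)}"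

definition st :: "nat list \<Rightarrow> nat list" where
  "st w = map (\<lambda>x. card {y \<in> set w. y \<le> x}) w"

definition st_inv :: "nat set \<Rightarrow> nat list \<Rightarrow> nat list" where
  "st_inv V \<rho> = map (\<lambda>j. sorted_list_of_set V ! (j - 1)) \<rho>"

section \<open>The map psi\<close>

text \<open>The words to the left and to the right of the largest letter \<open>n = length \<pi>\<close>.\<close>

definition left_part :: "nat list \<Rightarrow> nat list" where
  "left_part \<pi> = takeWhile (\<lambda>x. x \<noteq> length \<pi>) \<pi>"

definition right_part :: "nat list \<Rightarrow> nat list" where
  "right_part \<pi> = tl (dropWhile (\<lambda>x. x \<noteq> length \<pi>) \<pi>)"

text \<open>Splits a strictly increasing list into its maximal runs of consecutive integers.\<close>

fun runs :: "nat list \<Rightarrow> nat list list" where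
  "runs [] = []"
| "runs [x] = [[x]]"
| "runs (x # y # ys) =
     (if y = Suc x then (x # hd (runs (y # ys))) # tl (runs (y # ys))
      else [x] # runs (y # ys))"

definition num_blocks :: "nat list \<Rightarrow> nat" where
  "num_blocks \<sigma> = length (runs (sorted_list_of_set (set \<sigma>)))"

definition block :: "nat list \<Rightarrow> nat \<Rightarrow> nat list" where
  "block \<sigma> i = (if 1 \<le> i \<and> i \<le> num_blocks \<sigma>
     then filter (\<lambda>x. x \<in> set (runs (sorted_list_of_set (set \<sigma>)) ! (i - 1))) \<sigma>
     else [])"

definition gap_word :: "nat list \<Rightarrow> nat list \<Rightarrow> nat \<Rightarrow> nat list" where
  "gap_word \<sigma> \<tau> i = filter (\<lambda>x. block \<sigma> i \<prec> [x] \<and> [x] \<prec> block \<sigma> (i + 1)) \<tau>"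

definition before_min :: "nat list \<Rightarrow> nat list" where
  "before_min w = takeWhile (\<lambda>x. x \<noteq> Min (set w)) w"

definition after_min :: "nat list \<Rightarrow> nat list" where
  "after_min w = tl (dropWhile (\<lambda>x. x \<noteq> Min (set w)) w)"

definition shift :: "nat list \<Rightarrow> nat" where
  "shift w = card {x \<in> set (after_min w). [x] \<prec> before_min w}"

definition psi_left :: "nat list \<Rightarrow> nat list \<Rightarrow> nat set" where
  "psi_left \<sigma> \<tau> =
     (\<Union>i \<in> {1..num_blocks \<sigma>}. (\<lambda>x. x + shift (gap_word \<sigma> \<tau> i) + 1) ` set (block \<sigma> i))"

definition psi :: "nat list \<Rightarrow> nat list" where
  "psi \<pi> = (let n = length \<pi>; \<sigma> = left_part \<pi>; \<tau> = right_part \<pi>;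
                 L = psi_left \<sigma> \<tau>; R = {1..n - 1} - L
             in st_inv L (st \<sigma>) @ [n] @ st_inv R (st \<tau>))"

section \<open>The maps phi and f\<close>

text \<open>The empty permutation has no left-to-right maximum; inserting 1 into it gives the
  permutation 1, which is the image of the one-edge tree \<open>lam 1 bullet\<close>.\<close>

definition insert_max :: "nat \<Rightarrow> nat list \<Rightarrow> nat list" where
  "insert_max i \<pi> =
     (if \<pi> = [] then [1]
      else let p = sorted_list_of_set (lmax_positions \<pi>) ! (i - 1)
           in take p \<pi> @ [length \<pi> + 1] @ drop p \<pi>)"

definition phi :: "nat \<Rightarrow> nat list \<Rightarrow> nat list" where
  "phi i \<pi> = (if i = 1 then insert_max i \<pi> else psi (insert_max i \<pi>))"

text \<open>The tree with the given root subtrees, its root label being the one forced on a root.\<close>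

definition root_node :: "tree list \<Rightarrow> tree" where
  "root_node ts = (if ts = [] then bullet else Node (sum_list (map label ts)) ts)"

text \<open>A tree whose root has the single child \<open>s\<close> is \<open>lam (label s) u\<close> with
  \<open>u = root_node (children s)\<close>; with more children it is a sum whose first summand carries the
  first root subtree. The recursion in terms of \<open>lam\<close> and \<open>tree_oplus\<close> is given by the lemmas
  \<open>f_map_bullet\<close>, \<open>f_map_lam\<close> and \<open>f_map_oplus\<close>, which by \<open>beta10_tree_cases\<close> cover all trees.\<close>

function f_map :: "tree \<Rightarrow> nat list" where
  "f_map (Node a []) = []"
| "f_map (Node a [s]) = phi (label s) (f_map (root_node (children s)))"
| "f_map (Node a (s # s' # ss)) =
     perm_oplus (f_map (root_node [s])) (f_map (root_node (s' # ss)))"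
  by pat_completeness auto
termination
proof (relation "measure size", goal_cases)
  case (2 a s)
  then show ?case by (cases s) (auto simp: root_node_def bullet_def)
qed (auto simp: root_node_def)

lemma root_node_children: "beta10_tree t \<Longrightarrow> root_node (children t) = t"
  by (cases t) (auto simp: beta10_tree_def root_node_def bullet_def)

lemma beta10_tree_root_node: "\<forall>s \<in> set ts. valid_nonroot s \<Longrightarrow> beta10_tree (root_node ts)"
  by (auto simp: beta10_tree_def root_node_def)

lemma beta10_tree_cases:
  assumes "beta10_tree t"
  obtains "t = bullet"
  | u v where "beta10_tree u" "u \<noteq> bullet" "beta10_tree v" "v \<noteq> bullet" "t = tree_oplus u v"
  | i u where "beta10_tree u" "1 \<le> i" "i \<le> label u" "t = lam i u"
proof (cases "t = bullet")
  case False
  then have c: "children t \<noteq> []" and l: "label t = sum_list (map label (children t))"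
    and ch: "\<forall>s \<in> set (children t). valid_nonroot s"
    using assms by (auto simp: beta10_tree_def)
  obtain a s ss where t: "t = Node a (s # ss)"
    using c by (cases t; cases "children t") auto
  show thesis
  proof (cases "ss = []")
    case True
    obtain b us where s: "s = Node b us" by (cases s)
    have "beta10_tree (root_node us)"
      using ch t s by (auto intro!: beta10_tree_root_node split: if_splits)
    moreover have "1 \<le> b" "b \<le> label (root_node us)"
      using ch t s by (auto simp: root_node_def bullet_def split: if_splits)
    moreover have "t = lam b (root_node us)"
      using t s l True by (auto simp: lam_def root_node_def bullet_def)
    ultimately show thesis using that(3) by blast
  next
    case False
    have "beta10_tree (root_node [s])" "beta10_tree (root_node ss)"
      using ch t by (auto intro!: beta10_tree_root_node)
    moreover have "root_node [s] \<noteq> bullet" "root_node ss \<noteq> bullet"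
      using False by (auto simp: root_node_def bullet_def)
    moreover have "t = tree_oplus (root_node [s]) (root_node ss)"
      using t l False by (auto simp: tree_oplus_def root_node_def)
    ultimately show thesis using that(2) by blast
  qed
qed (use that in blast)

lemma f_map_bullet: "f_map bullet = []"
  by (simp add: bullet_def)

lemma f_map_lam: "beta10_tree t \<Longrightarrow> f_map (lam i t) = phi i (f_map t)"
  by (simp add: lam_def root_node_children)

lemma f_map_label: "f_map (Node a ts) = f_map (Node b ts)"
  by (cases "Node a ts" rule: f_map.cases) auto

lemma f_map_root_node: "f_map (root_node ts) = f_map (Node a ts)"
  unfolding root_node_def bullet_def using f_map_label by auto

lemma perm_oplus_assoc:
  "perm_oplus (perm_oplus \<rho> \<sigma>) \<tau> = perm_oplus \<rho> (perm_oplus \<sigma> \<tau>)"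
  by (auto simp: perm_oplus_def)

lemma f_map_append:
  "ts \<noteq> [] \<Longrightarrow> us \<noteq> [] \<Longrightarrow>
     f_map (Node a (ts @ us)) = perm_oplus (f_map (Node b ts)) (f_map (Node c us))"
proof (induction ts arbitrary: a b rule: list_nonempty_induct)
  case (single s)
  then obtain u us' where "us = u # us'" by (cases us) auto
  then show ?case
    using f_map_root_node[of "[s]" b] f_map_root_node[of us c] by simp
next
  case (cons s ts)
  then obtain s' ss where ts: "ts = s' # ss" by (cases ts) auto
  have "f_map (Node a ((s # ts) @ us)) =
      perm_oplus (f_map (root_node [s])) (f_map (Node 0 (ts @ us)))"
    using ts f_map_root_node[of "ts @ us" 0] by simp
  also have "\<dots> = perm_oplus (f_map (root_node [s]))
      (perm_oplus (f_map (Node 0 ts)) (f_map (Node c us)))"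
    using cons.IH[of 0 0] cons.prems by metis
  also have "\<dots> = perm_oplus (f_map (Node b (s # ts))) (f_map (Node c us))"
    using ts f_map_root_node[of ts 0] by (simp add: perm_oplus_assoc)
  finally show ?case .
qed

lemma f_map_oplus:
  assumes "beta10_tree u" "u \<noteq> bullet" "beta10_tree v" "v \<noteq> bullet"
  shows "f_map (tree_oplus u v) = perm_oplus (f_map u) (f_map v)"
proof -
  have "children u \<noteq> []" "children v \<noteq> []"
    using assms by (auto simp: beta10_tree_def)
  then show ?thesis
    using f_map_append[of "children u" "children v" _ "label u" "label v"]
    by (simp add: tree_oplus_def)
qed

end

theory Submission
  imports Defs
begin

text \<open>Let \<open>\<pi> = s n t\<close> be a permutation with largest letter \<open>n\<close>. It is an avoider iff \<open>s\<close> and \<open>t\<close> avoid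
  the patterns, no letter of \<open>t\<close> lies between the two letters of an inversion of \<open>s\<close>, and every letter of
  \<open>s\<close>, compared with \<open>t\<close> only, lies either above all of \<open>t\<close> or just below a left-to-right minimum
  of \<open>t\<close>. If \<open>n - 1\<close> is in \<open>t\<close>, no letter of \<open>s\<close> lies above all of \<open>t\<close>, and \<open>psi\<close> lifts every letter
  of \<open>s\<close> from just below one left-to-right minimum of \<open>t\<close> to just below the preceding one (above all of
  \<open>t\<close> if there is none), without changing the relative orders within \<open>s\<close> and \<open>t\<close>. This can be undone
  whenever no letter of \<open>s\<close> lies below all of \<open>t\<close>, and for nonempty \<open>s\<close> that condition characterizes the
  indecomposable avoiders. So \<open>phi\<close> maps the pairs \<open>(i, \<pi>)\<close> bijectively to the indecomposable avoiders,
  in the same way as \<open>lam\<close> produces the trees with a single root subtree, and direct sums take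
  care of the rest. The only statistic of \<open>s n t\<close> that depends on how \<open>s\<close> and \<open>t\<close> interleave is
  \<open>lmin\<close>: lifting the least letter of \<open>s\<close> past one left-to-right minimum of \<open>t\<close> increases it by one.\<close>

section \<open>Order isomorphic words\<close>

text \<open>The blocks, gap words and numbers m_i in \<open>psi\<close> are hard to carry through
  later arguments, so they are eliminated once and for all. Let K be the position of the
  left-to-right minimum of t just above a letter x of s. Then m_i + 1 turns out to be the number of
  letters of t that are at least \<open>t ! K\<close> and below all letters of t before position K.
  As s and t together use up {1..<n}, x is the number of letters of s up to x plus the number of
  letters of t below x. So x + m_i + 1 is exactly the rank of the lifted letter. What remains of
  \<open>psi\<close> is the relation \<open>shifted\<close>, stated in terms of positions, which is
  functional and injective up to order isomorphism; order isomorphic words over the same letters are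
  equal. The criterion for avoidance is first proved for a concatenation whose right word starts
  with a letter above the whole left word. This one form serves three times: for s n t, for s t with
  n removed (n was inserted in front of a left-to-right maximum), and for direct sums.\<close>

definition order_iso :: "nat list \<Rightarrow> nat list \<Rightarrow> bool" where
  "order_iso u v \<longleftrightarrow> length u = length v \<and>
     (\<forall>i<length u. \<forall>j<length u. u ! i < u ! j \<longleftrightarrow> v ! i < v ! j)"

lemma order_iso_length: "order_iso u v \<Longrightarrow> length u = length v"
  by (simp add: order_iso_def)

lemma order_iso_nth:
  "order_iso u v \<Longrightarrow> i < length u \<Longrightarrow> j < length u \<Longrightarrow> v ! i < v ! j \<longleftrightarrow> u ! i < u ! j"
  by (simp add: order_iso_def)

lemma order_iso_sym: "order_iso u v \<Longrightarrow> order_iso v u"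
  by (simp add: order_iso_def)

lemma order_iso_trans: "order_iso u v \<Longrightarrow> order_iso v w \<Longrightarrow> order_iso u w"
  by (simp add: order_iso_def)

lemma order_iso_map: "strict_mono_on (set w) g \<Longrightarrow> order_iso w (map g w)"
  unfolding order_iso_def
  by (metis length_map nth_map nth_mem strict_mono_on_less)

lemma order_iso_distinct: "order_iso u v \<Longrightarrow> distinct u \<Longrightarrow> distinct v"
  unfolding order_iso_def distinct_conv_nth by (metis nat_neq_iff)

text \<open>Comparisons from left to right follow from those from right to left, since distinctness
  excludes equality. So \<open>cross\<close> is the only condition left to check when two order
  isomorphic pairs are joined.\<close>

lemma order_iso_append:
  assumes s: "order_iso s s'" and t: "order_iso t t'" and d: "distinct (s @ t)" "distinct (s' @ t')"
    and cross: "\<And>i j. i < length s \<Longrightarrow> j < length t \<Longrightarrow> t ! j < s ! i \<longleftrightarrow> t' ! j < s' ! i"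
  shows "order_iso (s @ t) (s' @ t')"
proof -
  have l: "length s' = length s" "length t' = length t"
    using s t by (simp_all add: order_iso_def)
  have cross': "s ! i < t ! j \<longleftrightarrow> s' ! i < t' ! j" if "i < length s" "j < length t" for i j
  proof -
    have "s ! i \<noteq> t ! j" "s' ! i \<noteq> t' ! j"
      using d that l by (auto simp: disjoint_iff) (metis nth_mem)+
    then show ?thesis using cross[OF that] by linarith
  qed
  show ?thesis
    unfolding order_iso_def
  proof (intro conjI allI impI)
    fix i j assume ij: "i < length (s @ t)" "j < length (s @ t)"
    consider "i < length s" "j < length s" | "i < length s" "length s \<le> j"
      | "length s \<le> i" "j < length s" | "length s \<le> i" "length s \<le> j" by linarith
    then show "(s @ t) ! i < (s @ t) ! j \<longleftrightarrow> (s' @ t') ! i < (s' @ t') ! j"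
    proof cases
      case 1
      then show ?thesis using order_iso_nth[OF s] l by (simp add: nth_append)
    next
      case 2
      then show ?thesis using cross'[of i "j - length s"] ij l by (simp add: nth_append)
    next
      case 3
      then show ?thesis using cross[of j "i - length s"] ij l by (simp add: nth_append)
    next
      case 4
      then show ?thesis using order_iso_nth[OF t, of "i - length s" "j - length s"] ij l
        by (simp add: nth_append)
    qed
  qed (use l in simp)
qed

section \<open>Ranks of letters and standardization\<close>

lemma card_positions:
  "distinct w \<Longrightarrow> card {j. j < length w \<and> P (w ! j)} = card {y \<in> set w. P y}"
proof -
  assume d: "distinct w"
  have "{y \<in> set w. P y} = (!) w ` {j. j < length w \<and> P (w ! j)}"
    by (auto simp: in_set_conv_nth)
  moreover have "inj_on ((!) w) {j. j < length w \<and> P (w ! j)}"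
    using d by (auto simp: inj_on_def nth_eq_iff_index_eq)
  ultimately show ?thesis by (simp add: card_image)
qed

lemma strict_mono_on_card_le:
  fixes V :: "nat set"
  assumes "finite V"
  shows "strict_mono_on V (\<lambda>x. card {y \<in> V. y \<le> x})"
proof (rule strict_mono_onI)
  fix a b assume ab: "a \<in> V" "b \<in> V" "a < b"
  have "b \<notin> {y \<in> V. y \<le> a}" "b \<in> {y \<in> V. y \<le> b}" using ab by auto
  moreover have "{y \<in> V. y \<le> a} \<subseteq> {y \<in> V. y \<le> b}" using ab by auto
  ultimately have "{y \<in> V. y \<le> a} \<subset> {y \<in> V. y \<le> b}" by blast
  then show "card {y \<in> V. y \<le> a} < card {y \<in> V. y \<le> b}"
    using assms by (intro psubset_card_mono) auto
qed

lemma card_le_inj: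
  fixes x y :: nat
  assumes "finite V" "x \<in> V" "y \<in> V" "card {z\<in>V. z \<le> x} = card {z\<in>V. z \<le> y}"
  shows "x = y"
  using strict_mono_on_card_le[OF assms(1)] assms(2-) 
  by (metis (lifting) strict_mono_on_eqD)

lemma order_iso_card_le:
  assumes "order_iso u v" "distinct u" "i < length u"
  shows "card {y\<in>set u. y \<le> u ! i} = card {y\<in>set v. y \<le> v ! i}"
proof -
  have d: "distinct v" using order_iso_distinct assms by blast
  have "{j. j < length u \<and> u ! j \<le> u ! i} = {j. j < length v \<and> v ! j \<le> v ! i}"
    using assms by (auto simp: order_iso_def not_less[symmetric])
  then show ?thesis
    using card_positions[OF assms(2), of "\<lambda>y. y \<le> u ! i"] card_positions[OF d, of "\<lambda>y. y \<le> v ! i"]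
    by simp
qed

text \<open>Letters in equal positions have equal ranks, and within a common letter set the rank
  determines the letter.\<close>

lemma order_iso_eq:
  assumes "order_iso u v" "distinct u" "set u = set v"
  shows "u = v"
proof (rule nth_equalityI)
  show "length u = length v" using assms by (simp add: order_iso_def)
  fix i assume "i < length u"
  then show "u ! i = v ! i"
    using order_iso_card_le[OF assms(1,2), of i] card_le_inj[of "set v" "u ! i" "v ! i"] assms
    by (metis List.finite_set nth_mem order_iso_length)
qed

text \<open>The letters below a are those of lowest rank, so \<open>u ! i < a\<close> holds iff the
  rank of \<open>u ! i\<close> does not exceed their number. This lets a threshold outside the word
  be located by counting alone.\<close>

lemma order_iso_set_card_less:
  assumes "order_iso u v" "distinct u" "i < length u" "card {y\<in>set u. y < a} = card {y\<in>set v. y < b}"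
  shows "u ! i < a \<longleftrightarrow> v ! i < b"
proof -
  have d: "distinct v" and l: "length v = length u"
    using order_iso_distinct order_iso_length assms by auto
  have *: "w ! i < c \<longleftrightarrow> card {y\<in>set w. y \<le> w ! i} \<le> card {y\<in>set w. y < c}"
    if "i < length w" for w :: "nat list" and c
  proof
    assume "w ! i < c"
    then show "card {y\<in>set w. y \<le> w ! i} \<le> card {y\<in>set w. y < c}"
      by (intro card_mono) auto
  next
    assume le: "card {y\<in>set w. y \<le> w ! i} \<le> card {y\<in>set w. y < c}"
    show "w ! i < c"
    proof (rule ccontr)
      assume "\<not> w ! i < c"
      then have "w ! i \<notin> {y\<in>set w. y < c}" "w ! i \<in> {y\<in>set w. y \<le> w ! i}"
        "{y\<in>set w. y < c} \<subseteq> {y\<in>set w. y \<le> w ! i}" using that by auto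
      then have "{y\<in>set w. y < c} \<subset> {y\<in>set w. y \<le> w ! i}" by blast
      then have "card {y\<in>set w. y < c} < card {y\<in>set w. y \<le> w ! i}"
        by (intro psubset_card_mono) auto
      then show False using le by simp
    qed
  qed
  show ?thesis
    using *[of u a] *[of v b] order_iso_card_le[OF assms(1-3)] assms l by simp
qed

lemma order_iso_st: "order_iso w (st w)"
  unfolding st_def by (rule order_iso_map) (simp add: strict_mono_on_card_le)

lemma set_st:
  assumes "distinct w"
  shows "set (st w) = {1..length w}"
proof -
  have "card (set (st w)) = length w"
    using order_iso_distinct[OF order_iso_st assms] by (metis distinct_card length_map st_def)
  moreover have "set (st w) \<subseteq> {1..length w}"
  proof
    fix c assume "c \<in> set (st w)"
    then obtain x where x: "x \<in> set w" "c = card {y \<in> set w. y \<le> x}" by (auto simp: st_def)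
    have "c \<le> card (set w)" unfolding x by (intro card_mono) auto
    moreover have "0 < c" unfolding x using x(1) by (subst card_gt_0_iff) auto
    ultimately show "c \<in> {1..length w}" using assms distinct_card[of w] by auto
  qed
  ultimately show ?thesis by (intro card_subset_eq) auto
qed

lemma
  assumes w: "distinct w" and V: "finite V" "card V = length w"
  shows order_iso_st_inv_st: "order_iso w (st_inv V (st w))"
    and set_st_inv_st: "set (st_inv V (st w)) = V"
proof -
  let ?l = "sorted_list_of_set V"
  have l: "length ?l = length w" using V by simp
  have "strict_mono_on (set (st w)) (\<lambda>j. ?l ! (j - 1))"
  proof (rule strict_mono_onI)
    fix a b assume "a \<in> set (st w)" "b \<in> set (st w)" "a < b"
    then have "a - 1 < b - 1" "b - 1 < length ?l" using l set_st[OF w] by auto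
    then show "?l ! (a - 1) < ?l ! (b - 1)"
      using strict_sorted_list_of_set[of V] by (rule sorted_wrt_nth_less[rotated])
  qed
  then show "order_iso w (st_inv V (st w))"
    unfolding st_inv_def using order_iso_map order_iso_st order_iso_trans by blast
  have "set (st_inv V (st w)) = (\<lambda>j. ?l ! (j - 1)) ` {1..length w}"
    using set_st[OF w] by (simp add: st_inv_def)
  also have "\<dots> = (!) ?l ` (\<lambda>j. j - 1) ` {1..length w}" by (simp add: image_image)
  also have "(\<lambda>j. j - 1) ` {1..length w} = {0..<length w}"
    by (auto simp: image_iff intro!: bexI[of _ "Suc _"])
  also have "(!) ?l ` {0..<length w} = set ?l"
    using l by (metis list.set_map map_nth set_upt)
  finally show "set (st_inv V (st w)) = V" using V by simp
qed

text \<open>Both sides are order isomorphic to w and have the same letters. This evaluates the left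
  half of \<open>psi\<close> as soon as its letter set is known to be an increasing image.\<close>

lemma st_inv_st_image:
  assumes "distinct w" "strict_mono_on (set w) g"
  shows "st_inv (g ` set w) (st w) = map g w"
proof (rule sym, rule order_iso_eq)
  have c: "card (g ` set w) = length w"
    using assms by (simp add: card_image distinct_card strict_mono_on_imp_inj_on)
  show "order_iso (map g w) (st_inv (g ` set w) (st w))"
    using order_iso_map[OF assms(2)] order_iso_st_inv_st[OF assms(1) _ c]
      order_iso_sym order_iso_trans by blast
  show "distinct (map g w)" using assms by (simp add: distinct_map strict_mono_on_imp_inj_on)
  show "set (map g w) = set (st_inv (g ` set w) (st w))"
    using set_st_inv_st[OF assms(1) _ c] by simp
qed

text \<open>Avoidance for words over arbitrary letters, so that it passes to factors and along order
  isomorphisms.\<close>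

definition avoiding :: "nat list \<Rightarrow> bool" where
  "avoiding w \<longleftrightarrow> \<not> contains_3142 w \<and> \<not> contains_2_41_3 w"

lemma avoiding_not_3142:
  "avoiding w \<Longrightarrow> i < j \<Longrightarrow> j < k \<Longrightarrow> k < l \<Longrightarrow> l < length w \<Longrightarrow>
     w ! j < w ! l \<Longrightarrow> w ! l < w ! i \<Longrightarrow> w ! i < w ! k \<Longrightarrow> False"
  unfolding avoiding_def contains_3142_def by blast

lemma avoiding_not_2_41_3:
  "avoiding w \<Longrightarrow> i < j \<Longrightarrow> Suc j < k \<Longrightarrow> k < length w \<Longrightarrow>
     w ! Suc j < w ! i \<Longrightarrow> w ! i < w ! k \<Longrightarrow> w ! k < w ! j \<Longrightarrow> False"
  unfolding avoiding_def contains_2_41_3_def by (metis Suc_eq_plus1)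

lemma avoidingI:
  assumes "\<And>i j k l. i < j \<Longrightarrow> j < k \<Longrightarrow> k < l \<Longrightarrow> l < length w \<Longrightarrow>
     w ! j < w ! l \<Longrightarrow> w ! l < w ! i \<Longrightarrow> w ! i < w ! k \<Longrightarrow> False"
    and "\<And>i j k. i < j \<Longrightarrow> Suc j < k \<Longrightarrow> k < length w \<Longrightarrow>
     w ! Suc j < w ! i \<Longrightarrow> w ! i < w ! k \<Longrightarrow> w ! k < w ! j \<Longrightarrow> False"
  shows "avoiding w"
  unfolding avoiding_def contains_3142_def contains_2_41_3_def Suc_eq_plus1[symmetric]
  using assms by blast

lemma avoiding_order_iso:
  assumes "order_iso u v" "avoiding u"
  shows "avoiding v"
proof (rule avoidingI)
  have l: "length v = length u" using assms(1) by (simp add: order_iso_def)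
  note n = order_iso_nth[OF assms(1)]
  show False if "i < j" "j < k" "k < l" "l < length v" "v ! j < v ! l" "v ! l < v ! i" "v ! i < v ! k"
    for i j k l
    using that n[of j l] n[of l i] n[of i k] avoiding_not_3142[OF assms(2), of i j k l] l by simp
  show False if "i < j" "Suc j < k" "k < length v" "v ! Suc j < v ! i" "v ! i < v ! k" "v ! k < v ! j"
    for i j k
    using that n[of "Suc j" i] n[of i k] n[of k j] avoiding_not_2_41_3[OF assms(2), of i j k] l by simp
qed

lemma avoiders_iff:
  "\<pi> \<in> avoiders n \<longleftrightarrow> distinct \<pi> \<and> set \<pi> = {1..n} \<and> avoiding \<pi>"
  by (auto simp: avoiders_def permutations_of_set_def avoiding_def)

lemma avoiding_appendD:
  assumes "avoiding (u @ v)"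
  shows "avoiding u" "avoiding v"
proof -
  show "avoiding u"
  proof (rule avoidingI)
    show False if "i < j" "j < k" "k < l" "l < length u" "u ! j < u ! l" "u ! l < u ! i" "u ! i < u ! k"
      for i j k l
      using that avoiding_not_3142[OF assms, of i j k l] by (simp add: nth_append)
    show False if "i < j" "Suc j < k" "k < length u" "u ! Suc j < u ! i" "u ! i < u ! k" "u ! k < u ! j"
      for i j k
      using that avoiding_not_2_41_3[OF assms, of i j k] by (simp add: nth_append)
  qed
  let ?a = "length u"
  show "avoiding v"
  proof (rule avoidingI)
    show False if "i < j" "j < k" "k < l" "l < length v" "v ! j < v ! l" "v ! l < v ! i" "v ! i < v ! k"
      for i j k l
      using that avoiding_not_3142[OF assms, of "?a + i" "?a + j" "?a + k" "?a + l"] by simp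
    show False if "i < j" "Suc j < k" "k < length v" "v ! Suc j < v ! i" "v ! i < v ! k" "v ! k < v ! j"
      for i j k
      using that avoiding_not_2_41_3[OF assms, of "?a + i" "?a + j" "?a + k"]
        nth_append_length_plus[of u v "Suc j"] by simp
  qed
qed

text \<open>The first entry of an occurrence of either pattern is exceeded by a later one, so a
  largest letter in front takes part in no occurrence.\<close>

lemma avoiding_Cons_max:
  assumes "\<forall>y\<in>set t. y < m"
  shows "avoiding (m # t) \<longleftrightarrow> avoiding t"
proof
  show "avoiding (m # t) \<Longrightarrow> avoiding t" using avoiding_appendD(2)[of "[m]" t] by simp
  assume av: "avoiding t"
  have m: "\<not> m < (m # t) ! k" if "k < length (m # t)" for k
    using that assms by (cases k) (auto simp: not_less less_imp_le)
  show "avoiding (m # t)"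
  proof (rule avoidingI)
    fix i j k l
    assume h: "i < j" "j < k" "k < l" "l < length (m # t)" "(m # t) ! j < (m # t) ! l"
      "(m # t) ! l < (m # t) ! i" "(m # t) ! i < (m # t) ! k"
    have "i \<noteq> 0" using m[of k] h by (cases i) auto
    then obtain i' j' k' l' where "i = Suc i'" "j = Suc j'" "k = Suc k'" "l = Suc l'"
      using h by (metis not0_implies_Suc not_less_zero)
    then show False using h avoiding_not_3142[OF av, of i' j' k' l'] by simp
  next
    fix i j k
    assume h: "i < j" "Suc j < k" "k < length (m # t)" "(m # t) ! Suc j < (m # t) ! i"
      "(m # t) ! i < (m # t) ! k" "(m # t) ! k < (m # t) ! j"
    have "i \<noteq> 0" using m[of k] h by (cases i) auto
    then obtain i' j' k' where "i = Suc i'" "j = Suc j'" "k = Suc k'"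
      using h by (metis not0_implies_Suc not_less_zero)
    then show False using h avoiding_not_2_41_3[OF av, of i' j' k'] by simp
  qed
qed

section \<open>Words split at their largest letter\<close>

definition unsplit :: "nat list \<Rightarrow> nat list \<Rightarrow> bool" where
  "unsplit s t \<longleftrightarrow> (\<forall>i j. \<forall>z\<in>set t. i < j \<longrightarrow> j < length s \<longrightarrow> s ! j < z \<longrightarrow> \<not> z < s ! i)"

text \<open>The prefix \<open>take k t\<close> treats two kinds of place uniformly: k = 0 puts x
  above all of t, and k > 0 (for nonempty t) puts x just below the least of the first k letters,
  which is a left-to-right minimum of t.\<close>

definition compatible :: "nat list \<Rightarrow> nat list \<Rightarrow> bool" where
  "compatible s t \<longleftrightarrow> unsplit s t \<and>
     (\<forall>x\<in>set s. \<exists>k. \<forall>y\<in>set t. y < x \<longleftrightarrow> (\<forall>z\<in>set (take k t). y < z))"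

text \<open>The head of t plays the 4 of 3-1-4-2: a letter z of t inside an inversion of s would
  complete the pattern. For the cut of x, let q be the position of the first letter of t below x. A
  letter y of t above x but below everything before position q would give the occurrence x,
  \<open>t ! (q - 1)\<close>, \<open>t ! q\<close>, y of 2-41-3; hence the prefix of length q works.
  If no letter of t is below x, the full prefix works.\<close>

lemma avoiding_append_compatible:
  assumes av: "avoiding (s @ t)" and d: "distinct (s @ t)" and t: "t \<noteq> []" "\<forall>x\<in>set s. x < hd t"
  shows "compatible s t"
  unfolding compatible_def unsplit_def
proof (intro conjI ballI allI impI)
  let ?a = "length s"
  have t0: "hd t = t ! 0" using t hd_conv_nth by blast
  show "\<not> z < s ! i" if z: "z \<in> set t" "i < j" "j < length s" "s ! j < z" for i j z
  proof
    assume lt: "z < s ! i"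
    obtain q where q: "q < length t" "z = t ! q" using z(1) by (auto simp: in_set_conv_nth)
    have "s ! i < t ! 0" using t t0 z by simp
    then have "q \<noteq> 0" using lt q by (cases q) auto
    then show False
      using avoiding_not_3142[OF av, of i j ?a "?a + q"] z lt q \<open>s ! i < t ! 0\<close>
        nth_append_length_plus[of s t 0]
      by (simp add: nth_append)
  qed
  fix x assume x: "x \<in> set s"
  then obtain p where p: "p < length s" "x = s ! p" by (auto simp: in_set_conv_nth)
  show "\<exists>k. \<forall>y\<in>set t. y < x \<longleftrightarrow> (\<forall>z\<in>set (take k t). y < z)"
  proof (cases "\<exists>q. q < length t \<and> t ! q < x")
    case False
    then have "\<forall>y\<in>set t. y < x \<longleftrightarrow> (\<forall>z\<in>set (take (length t) t). y < z)"
      by (auto simp: in_set_conv_nth)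
    then show ?thesis by blast
  next
    case True
    define q where "q = (LEAST q. q < length t \<and> t ! q < x)"
    have q: "q < length t" "t ! q < x" using LeastI_ex[OF True] by (auto simp: q_def)
    have less: "\<not> t ! j < x" if "j < q" for j
      using not_less_Least[of j "\<lambda>q. q < length t \<and> t ! q < x"] that q(1) by (simp add: q_def)
    have "q \<noteq> 0" using q t(2) x t0 by (cases q) fastforce+
    have "y < x" if y: "y \<in> set t" "\<forall>z\<in>set (take q t). y < z" for y
    proof (rule ccontr)
      assume n: "\<not> y < x"
      obtain r where r: "r < length t" "y = t ! r" using y(1) by (auto simp: in_set_conv_nth)
      have take: "t ! j \<in> set (take q t)" if "j < q" for j
        using that q(1) by (auto simp: in_set_conv_nth intro!: exI[of _ j])
      have "\<not> r < q" using take[of r] y(2) r by auto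
      moreover have "r \<noteq> q" using n q r by auto
      moreover have "y < t ! (q - 1)" using take[of "q - 1"] y(2) \<open>q \<noteq> 0\<close> by auto
      moreover have "x < y" using n d x y by (metis disjoint_iff distinct_append nat_neq_iff)
      moreover obtain q' where "q = Suc q'" using \<open>q \<noteq> 0\<close> not0_implies_Suc by blast
      ultimately show False
        using avoiding_not_2_41_3[OF av, of p "?a + q'" "?a + r"] p q r
          nth_append_length_plus[of s t q]
        by (simp add: nth_append)
    qed
    moreover have "y < z" if "y < x" "z \<in> set (take q t)" for y z
      using that less by (fastforce simp: in_set_conv_nth)
    ultimately show ?thesis by blast
  qed
qed

text \<open>An occurrence across the border has either both letters of an inversion in s and its
  last letter, of intermediate size, in t, which \<open>unsplit\<close> forbids, or only its first
  letter in s. In the latter case that letter can be exchanged for one of t, giving an occurrence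
  inside t. The remaining possibility, a 41 straddling the border, is excluded by the size of
  \<open>hd t\<close>.\<close>

lemma avoiding_appendI:
  assumes av: "avoiding s" "avoiding t" and c: "compatible s t"
    and d: "distinct (s @ t)" and t: "t \<noteq> []" "\<forall>x\<in>set s. x < hd t"
  shows "avoiding (s @ t)"
proof (rule avoidingI)
  let ?w = "s @ t" and ?a = "length s"
  have t0: "hd t = t ! 0" using t hd_conv_nth by blast
  have us: "\<not> z < s ! i" if "i < j" "j < ?a" "z \<in> set t" "s ! j < z" for i j z
    using c that by (auto simp: compatible_def unsplit_def)
  \<comment> \<open>The letter \<open>t ! m\<close> is the substitute for x: it stands before
    position q, lies below y, and lies above every letter of t that is below x.\<close>
  have cut: "\<exists>m<length t. m < q \<and> t ! m < y \<and> (\<forall>y'\<in>set t. y' < x \<longrightarrow> y' < t ! m)"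
    if h: "x \<in> set s" "y \<in> set t" "x < y" "q < length t" "t ! q < x" "y \<notin> set (take q t)" for x y q
  proof -
    obtain k where k: "\<forall>y\<in>set t. y < x \<longleftrightarrow> (\<forall>z\<in>set (take k t). y < z)"
      using c h(1) unfolding compatible_def by blast
    have "\<not> y < x" using h by simp
    then obtain z where z: "z \<in> set (take k t)" "z \<le> y" using k h(2) by (auto simp: not_less)
    then obtain m where m: "m < k" "m < length t" "z = t ! m" by (auto simp: in_set_conv_nth)
    have "t ! q \<notin> set (take k t)" using k h by (metis nth_mem order.irrefl)
    then have "\<not> q < k" using h(4) by (auto simp: in_set_conv_nth)
    then have mq: "m < q" using m by simp
    then have "z \<in> set (take q t)" using m by (auto simp: in_set_conv_nth)
    then have "z \<noteq> y" using h by auto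
    then show ?thesis using m mq z k by (metis le_neq_implies_less)
  qed
  show False
    if h: "i < j" "j < k" "k < l" "l < length ?w" "?w ! j < ?w ! l" "?w ! l < ?w ! i" "?w ! i < ?w ! k"
    for i j k l
  proof -
    consider "l < ?a" | "?a \<le> i" | "j < ?a" "?a \<le> l" | "i < ?a" "?a \<le> j" using h by linarith
    then show False
    proof cases
      case 1
      then show ?thesis using h avoiding_not_3142[OF av(1), of i j k l] by (simp add: nth_append)
    next
      case 2
      then show ?thesis
        using h avoiding_not_3142[OF av(2), of "i - ?a" "j - ?a" "k - ?a" "l - ?a"]
          diff_less_mono[of l "?a + length t" ?a]
        by (simp add: nth_append diff_less_mono)
    next
      case 3
      then show ?thesis using us[of i j "t ! (l - ?a)"] h by (simp add: nth_append)
    next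
      case 4
      have n: "t ! (k - ?a) \<notin> set (take (j - ?a) t)"
      proof
        assume "t ! (k - ?a) \<in> set (take (j - ?a) t)"
        then obtain r where "r < j - ?a" "t ! r = t ! (k - ?a)" "r < length t"
          by (auto simp: in_set_conv_nth)
        then show False using d h 4 by (simp add: nth_eq_iff_index_eq)
      qed
      have h': "s ! i < t ! (k - ?a)" "t ! (j - ?a) < s ! i" "t ! (j - ?a) < t ! (l - ?a)"
        "t ! (l - ?a) < s ! i" "j - ?a < k - ?a" "k - ?a < l - ?a" "l - ?a < length t"
        using h 4 by (auto simp: nth_append)
      obtain m where m: "m < j - ?a" "t ! m < t ! (k - ?a)"
        "\<forall>y'\<in>set t. y' < s ! i \<longrightarrow> y' < t ! m"
        using cut[of "s ! i" "t ! (k - ?a)" "j - ?a"] h' n 4 by auto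
      then show ?thesis
        using avoiding_not_3142[OF av(2), of m "j - ?a" "k - ?a" "l - ?a"] h' by simp
    qed
  qed
  show False
    if h: "i < j" "Suc j < k" "k < length ?w" "?w ! Suc j < ?w ! i" "?w ! i < ?w ! k" "?w ! k < ?w ! j"
    for i j k
  proof -
    consider "k < ?a" | "?a \<le> i" | "Suc j < ?a" "?a \<le> k" | "Suc j = ?a" | "i < ?a" "?a \<le> j"
      using h by linarith
    then show False
    proof cases
      case 1
      then show ?thesis using h avoiding_not_2_41_3[OF av(1), of i j k] by (simp add: nth_append)
    next
      case 2
      then show ?thesis
        using h avoiding_not_2_41_3[OF av(2), of "i - ?a" "j - ?a" "k - ?a"]
          diff_less_mono[of "Suc j" k ?a] diff_less_mono[of k "?a + length t" ?a]
        by (simp add: nth_append Suc_diff_le diff_less_mono)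
    next
      case 3
      then show ?thesis using us[of j "Suc j" "t ! (k - ?a)"] h by (simp add: nth_append)
    next
      case 4
      \<comment> \<open>Here \<open>hd t\<close> would have to play the 1 and be smaller than a
        letter of s.\<close>
      then have "?w ! Suc j = hd t" "?w ! i \<in> set s" using h t0 by (simp_all add: nth_append)
      then show ?thesis using h t by fastforce
    next
      case 5
      have h': "s ! i < t ! (k - ?a)" "t ! Suc (j - ?a) < s ! i" "t ! (k - ?a) < t ! (j - ?a)"
        "Suc (j - ?a) < k - ?a" "k - ?a < length t"
        using h 5 by (auto simp: nth_append Suc_diff_le)
      have n: "t ! (k - ?a) \<notin> set (take (Suc (j - ?a)) t)"
      proof
        assume "t ! (k - ?a) \<in> set (take (Suc (j - ?a)) t)"
        then obtain r where "r < Suc (j - ?a)" "t ! r = t ! (k - ?a)" "r < length t"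
          by (auto simp: in_set_conv_nth)
        then show False using d h' by (simp add: nth_eq_iff_index_eq)
      qed
      obtain m where m: "m < Suc (j - ?a)" "t ! m < t ! (k - ?a)"
        "\<forall>y'\<in>set t. y' < s ! i \<longrightarrow> y' < t ! m"
        using cut[of "s ! i" "t ! (k - ?a)" "Suc (j - ?a)"] h' n 5 by auto
      moreover have "m \<noteq> j - ?a" using m h' by auto
      ultimately show ?thesis
        using avoiding_not_2_41_3[OF av(2), of m "j - ?a" "k - ?a"] h' by simp
    qed
  qed
qed

text \<open>A prefix of length k of t corresponds to the prefix of length \<open>Suc k\<close> of
  \<open>m # t\<close>. The empty prefix of \<open>m # t\<close> does not occur, because m itself is
  not below x.\<close>

lemma compatible_Cons_max:
  assumes "\<forall>x\<in>set s. x < m" "\<forall>y\<in>set t. y < m"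
  shows "compatible s (m # t) \<longleftrightarrow> compatible s t"
proof -
  have "unsplit s (m # t) \<longleftrightarrow> unsplit s t"
    unfolding unsplit_def using assms(1)
    by (smt (verit) insert_iff list.set(2) nth_mem not_less_iff_gr_or_eq order.strict_trans)
  moreover have "(\<exists>k. \<forall>y\<in>set (m # t). y < x \<longleftrightarrow> (\<forall>z\<in>set (take k (m # t)). y < z)) \<longleftrightarrow>
      (\<exists>k. \<forall>y\<in>set t. y < x \<longleftrightarrow> (\<forall>z\<in>set (take k t). y < z))" (is "(\<exists>k. ?P k) \<longleftrightarrow> (\<exists>k. ?Q k)")
    if x: "x \<in> set s" for x
  proof -
    have "x < m" using x assms by blast
    then have "\<not> ?P 0" "?P (Suc k) \<longleftrightarrow> ?Q k" for k
      using assms(2) by auto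
    then have "?P k \<longleftrightarrow> (\<exists>k'. k = Suc k' \<and> ?Q k')" for k
      by (cases k) simp_all
    then show ?thesis by blast
  qed
  ultimately show ?thesis unfolding compatible_def by simp
qed

text \<open>The criterion for concatenations, with right word \<open>m # t\<close>: its head m
  exceeds all of s.\<close>

lemma avoiding_split_iff:
  assumes d: "distinct (s @ m # t)" and m: "\<forall>x\<in>set (s @ t). x < m"
  shows "avoiding (s @ m # t) \<longleftrightarrow> avoiding s \<and> avoiding t \<and> compatible s t"
proof -
  have "compatible s (m # t) \<longleftrightarrow> compatible s t" using m by (intro compatible_Cons_max) auto
  moreover have "avoiding (m # t) \<longleftrightarrow> avoiding t" using m by (intro avoiding_Cons_max) auto
  ultimately show ?thesis
    using avoiding_append_compatible[of s "m # t"] avoiding_appendI[of s "m # t"] avoiding_appendD d m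
    by (metis UnI1 list.distinct(1) list.sel(1) set_append)
qed

section \<open>Cuts\<close>

text \<open>In both definitions \<open>K\<close> is the position of a left-to-right minimum of \<open>t\<close>. Relative to the letters
  of \<open>t\<close>, the letter \<open>x\<close> lies just below it, respectively just below the preceding one (above all of \<open>t\<close>
  for \<open>K = 0\<close>). The map \<open>psi\<close> turns the first situation into the second.\<close>

definition cut_at :: "nat \<Rightarrow> nat list \<Rightarrow> nat \<Rightarrow> bool" where
  "cut_at x t K \<longleftrightarrow> K < length t \<and> (\<forall>j<K. t ! K < t ! j) \<and> (\<forall>y\<in>set t. y < x \<longleftrightarrow> y < t ! K)"

definition cut_before :: "nat \<Rightarrow> nat list \<Rightarrow> nat \<Rightarrow> bool" where
  "cut_before x t K \<longleftrightarrow>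
     K < length t \<and> (\<forall>j<K. t ! K < t ! j) \<and> (\<forall>y\<in>set t. y < x \<longleftrightarrow> (\<forall>j<K. y < t ! j))"

text \<open>A letter z above all of s rules out the empty prefix. The position K of the least letter
  of a nonempty prefix is a left-to-right minimum, and conversely K corresponds to the prefix of
  length \<open>Suc K\<close>.\<close>

lemma compatible_iff_cut_at:
  assumes d: "distinct (s @ t)" and z: "z \<in> set t" "\<forall>x\<in>set s. x < z"
  shows "compatible s t \<longleftrightarrow> unsplit s t \<and> (\<forall>x\<in>set s. \<exists>K. cut_at x t K)"
proof -
  have "(\<exists>k. \<forall>y\<in>set t. y < x \<longleftrightarrow> (\<forall>z\<in>set (take k t). y < z)) \<longleftrightarrow> (\<exists>K. cut_at x t K)"
    if x: "x \<in> set s" for x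
  proof
    assume "\<exists>k. \<forall>y\<in>set t. y < x \<longleftrightarrow> (\<forall>z\<in>set (take k t). y < z)"
    then obtain k where k: "\<And>y. y \<in> set t \<Longrightarrow> y < x \<longleftrightarrow> (\<forall>z\<in>set (take k t). y < z)" by blast
    have ne: "set (take k t) \<noteq> {}" using k[OF z(1)] z(2) x by (metis empty_iff order.asym)
    then obtain K where K: "K < length (take k t)" "take k t ! K = Min (set (take k t))"
      by (metis Min_in List.finite_set in_set_conv_nth)
    then have K': "K < length t" "t ! K = Min (set (take k t))" by auto
    have "t ! K < t ! j" if "j < K" for j
    proof -
      have "t ! j \<in> set (take k t)"
        using that K by (auto simp: in_set_conv_nth intro!: exI[of _ j])
      then have "t ! K \<le> t ! j" unfolding K' by simp
      moreover have "t ! K \<noteq> t ! j" using d K'(1) that by (simp add: nth_eq_iff_index_eq)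
      ultimately show ?thesis by simp
    qed
    moreover have "y < x \<longleftrightarrow> y < t ! K" if "y \<in> set t" for y
      unfolding k[OF that] K' using ne by simp
    ultimately show "\<exists>K. cut_at x t K" using K' unfolding cut_at_def by blast
  next
    assume "\<exists>K. cut_at x t K"
    then obtain K where K: "K < length t" "\<And>j. j < K \<Longrightarrow> t ! K < t ! j"
      "\<And>y. y \<in> set t \<Longrightarrow> y < x \<longleftrightarrow> y < t ! K" by (auto simp: cut_at_def)
    have "y < t ! K \<longleftrightarrow> (\<forall>z\<in>set (take (Suc K) t). y < z)" for y
      using K(1) order.strict_trans[OF _ K(2), of y] by (auto simp: take_Suc_conv_app_nth in_set_conv_nth)
    then show "\<exists>k. \<forall>y\<in>set t. y < x \<longleftrightarrow> (\<forall>z\<in>set (take k t). y < z)"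
      using K(3) by (intro exI[of _ "Suc K"]) simp
  qed
  then show ?thesis unfolding compatible_def by blast
qed

text \<open>A letter z below all of s guarantees that t has a letter below x. The position of the
  first such letter is K, and everything before it lies above x, so the prefix of length K describes
  the same cut.\<close>

lemma compatible_iff_cut_before:
  assumes d: "distinct (s @ t)" and z: "z \<in> set t" "\<forall>x\<in>set s. z < x"
  shows "compatible s t \<longleftrightarrow> unsplit s t \<and> (\<forall>x\<in>set s. \<exists>K. cut_before x t K)"
proof -
  have take: "(\<forall>z\<in>set (take k t). y < z) \<longleftrightarrow> (\<forall>j<k. j < length t \<longrightarrow> y < t ! j)" for k y
    by (fastforce simp: in_set_conv_nth)
  have "(\<exists>k. \<forall>y\<in>set t. y < x \<longleftrightarrow> (\<forall>z\<in>set (take k t). y < z)) \<longleftrightarrow> (\<exists>K. cut_before x t K)"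
    if x: "x \<in> set s" for x
  proof
    assume "\<exists>k. \<forall>y\<in>set t. y < x \<longleftrightarrow> (\<forall>z\<in>set (take k t). y < z)"
    then obtain k where k: "\<And>y. y \<in> set t \<Longrightarrow> y < x \<longleftrightarrow> (\<forall>j<k. j < length t \<longrightarrow> y < t ! j)"
      unfolding take by blast
    have ex: "\<exists>q. q < length t \<and> t ! q < x" using z x by (metis in_set_conv_nth)
    define K where "K = (LEAST q. q < length t \<and> t ! q < x)"
    have K: "K < length t" "t ! K < x" using LeastI_ex[OF ex] by (auto simp: K_def)
    have less: "x < t ! j" if "j < K" for j
    proof -
      have "\<not> t ! j < x"
        using not_less_Least[of j "\<lambda>q. q < length t \<and> t ! q < x"] that K(1) by (simp add: K_def)
      moreover have "t ! j \<noteq> x" using d x that K by auto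
      ultimately show ?thesis by simp
    qed
    \<comment> \<open>The prefix cannot contain position K, since \<open>t ! K\<close> is below x
      but not below itself.\<close>
    have "k \<le> K" using k[of "t ! K"] K by (metis nth_mem not_less order.irrefl)
    then have "y < x \<longleftrightarrow> (\<forall>j<K. y < t ! j)" if "y \<in> set t" for y
      using k[OF that] less by (meson order.strict_trans order.strict_trans2)
    then show "\<exists>K. cut_before x t K"
      using K less unfolding cut_before_def by (meson order.strict_trans)
  next
    assume "\<exists>K. cut_before x t K"
    then obtain K where K: "K < length t" "\<forall>y\<in>set t. y < x \<longleftrightarrow> (\<forall>j<K. y < t ! j)"
      by (auto simp: cut_before_def)
    then show "\<exists>k. \<forall>y\<in>set t. y < x \<longleftrightarrow> (\<forall>z\<in>set (take k t). y < z)"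
      unfolding take by (intro exI[of _ K]) auto
  qed
  then show ?thesis unfolding compatible_def by blast
qed

text \<open>The action of \<open>psi\<close> up to order isomorphism on each half. The cut is
  recorded by a position K rather than by a letter, so the same K makes sense in t and in
  t'.\<close>

definition shifted :: "nat list \<Rightarrow> nat list \<Rightarrow> nat list \<Rightarrow> nat list \<Rightarrow> bool" where
  "shifted s t s' t' \<longleftrightarrow> order_iso s s' \<and> order_iso t t' \<and>
     (\<forall>i<length s. \<exists>K. cut_at (s ! i) t K \<and> cut_before (s' ! i) t' K)"

lemma shiftedD:
  assumes "shifted s t s' t'" "i < length s"
  obtains K where "cut_at (s ! i) t K" "cut_before (s' ! i) t' K"
  using assms unfolding shifted_def by blast

lemma cut_at_unique:
  assumes "cut_at x t K" "cut_at x t K'" "distinct t"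
  shows "K = K'"
proof -
  have K: "K < length t" "K' < length t" and "y < t ! K \<longleftrightarrow> y < t ! K'" if "y \<in> set t" for y
    using that assms by (auto simp: cut_at_def)
  then have "t ! K = t ! K'"
    using assms(1,2) by (metis cut_at_def nat_neq_iff nth_mem)
  then show ?thesis using assms by (simp add: cut_at_def nth_eq_iff_index_eq)
qed

text \<open>K is the first position at which t has a letter below x.\<close>

lemma cut_before_unique:
  assumes "cut_before x t K" "cut_before x t K'"
  shows "K = K'"
proof -
  have "\<not> k < k'" if "cut_before x t k" "cut_before x t k'" for k k'
    using that by (auto simp: cut_before_def)
  then show ?thesis using assms by (metis nat_neq_iff)
qed

lemma cut_before_nth:
  assumes "cut_before x t' K" "order_iso t t'" "q < length t"
  shows "t' ! q < x \<longleftrightarrow> (\<forall>j<K. t ! q < t ! j)"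
proof -
  have "K < length t'" "t' ! q < x \<longleftrightarrow> (\<forall>j<K. t' ! q < t' ! j)"
    using assms by (auto simp: cut_before_def order_iso_length)
  then show ?thesis using order_iso_nth[OF assms(2)] assms by (auto simp: order_iso_length)
qed

lemma cut_at_nth: "cut_at x t K \<Longrightarrow> q < length t \<Longrightarrow> t ! q < x \<longleftrightarrow> t ! q < t ! K"
  by (simp add: cut_at_def)

text \<open>The source determines K, and \<open>cut_before_nth\<close> reads every comparison
  between the two halves of the image off K and t.\<close>

lemma shifted_functional:
  assumes 1: "shifted s t s1 t1" and 2: "shifted s t s2 t2"
    and d: "distinct t" "distinct (s1 @ t1)" "distinct (s2 @ t2)"
  shows "order_iso (s1 @ t1) (s2 @ t2)"
proof (rule order_iso_append)
  have o: "order_iso s s1" "order_iso s s2" "order_iso t t1" "order_iso t t2"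
    using 1 2 by (auto simp: shifted_def)
  then show "order_iso s1 s2" "order_iso t1 t2"
    using order_iso_sym order_iso_trans by blast+
  fix i j assume ij: "i < length s1" "j < length t1"
  then have i: "i < length s" "j < length t" using o by (simp_all add: order_iso_length)
  obtain K K' where K: "cut_at (s ! i) t K" "cut_before (s1 ! i) t1 K"
    "cut_at (s ! i) t K'" "cut_before (s2 ! i) t2 K'"
    using shiftedD[OF 1 i(1)] shiftedD[OF 2 i(1)] by metis
  have "K' = K" using cut_at_unique K d by blast
  then show "t1 ! j < s1 ! i \<longleftrightarrow> t2 ! j < s2 ! i"
    using K cut_before_nth o i by simp
qed (use d in auto)

text \<open>Now K is determined by the image, and it fixes the comparisons in the source through
  \<open>cut_at\<close>.\<close>

lemma shifted_injective:
  assumes 1: "shifted s1 t1 s t" and 2: "shifted s2 t2 s t"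
    and d: "distinct t" "distinct (s1 @ t1)" "distinct (s2 @ t2)"
  shows "order_iso (s1 @ t1) (s2 @ t2)"
proof (rule order_iso_append)
  have o: "order_iso s1 s" "order_iso s2 s" "order_iso t1 t" "order_iso t2 t"
    using 1 2 by (auto simp: shifted_def)
  then show os: "order_iso s1 s2" and ot: "order_iso t1 t2"
    using order_iso_sym order_iso_trans by blast+
  fix i j assume ij: "i < length s1" "j < length t1"
  then have i: "i < length s2" "j < length t2" using os ot by (simp_all add: order_iso_length)
  obtain K K' where K: "cut_at (s1 ! i) t1 K" "cut_before (s ! i) t K"
    "cut_at (s2 ! i) t2 K'" "cut_before (s ! i) t K'"
    using shiftedD[OF 1 ij(1)] shiftedD[OF 2 i(1)] by metis
  have K': "K' = K" using cut_before_unique K by blast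
  then have "K < length t1" using K by (auto simp: cut_at_def)
  then show "t1 ! j < s1 ! i \<longleftrightarrow> t2 ! j < s2 ! i"
    using cut_at_nth[OF K(1) ij(2)] cut_at_nth[OF K(3) i(2)] K' order_iso_nth[OF ot ij(2), of K] by simp
qed (use d in auto)

text \<open>If a letter of t' separates the inversion \<open>s' ! i\<close>, \<open>s' ! j\<close>,
  then the cuts Ki and Kj differ, and \<open>t ! Kj\<close> separates the inversion
  \<open>s ! i\<close>, \<open>s ! j\<close>.\<close>

lemma shifted_unsplit:
  assumes sh: "shifted s t s' t'" and d: "distinct (s @ t)" and u: "unsplit s t"
  shows "unsplit s' t'"
  unfolding unsplit_def
proof (intro allI ballI impI notI)
  have o: "order_iso s s'" "order_iso t t'" using sh by (auto simp: shifted_def)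
  fix i j z assume h: "z \<in> set t'" "i < j" "j < length s'" "s' ! j < z" "z < s' ! i"
  then obtain q where q: "q < length t" "z = t' ! q"
    using o by (auto simp: in_set_conv_nth order_iso_length)
  have l: "i < length s" "j < length s" using h o by (auto simp: order_iso_length)
  obtain Ki Kj where K: "cut_at (s ! i) t Ki" "cut_before (s' ! i) t' Ki"
    "cut_at (s ! j) t Kj" "cut_before (s' ! j) t' Kj"
    using shiftedD[OF sh l(1)] shiftedD[OF sh l(2)] by metis
  have b: "Ki < length t" "Kj < length t" using K by (auto simp: cut_at_def)
  have "\<forall>m<Ki. t ! q < t ! m" "\<not> (\<forall>m<Kj. t ! q < t ! m)"
    using cut_before_nth[OF K(2) o(2) q(1)] cut_before_nth[OF K(4) o(2) q(1)] h q by auto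
  then have "Ki \<noteq> Kj" by blast
  then have ne: "t ! Ki \<noteq> t ! Kj" using d b by (simp add: nth_eq_iff_index_eq)
  have "s ! j < s ! i" using h l order_iso_nth[OF o(1) l(2) l(1)] by simp
  then have "t ! Kj < t ! Ki"
    using ne cut_at_nth[OF K(1) b(1)] cut_at_nth[OF K(3) b(1)] by linarith
  then have "t ! Kj < s ! i" using cut_at_nth[OF K(1) b(2)] by simp
  moreover have "\<not> t ! Kj < s ! j" using cut_at_nth[OF K(3) b(2)] by simp
  moreover have "t ! Kj \<noteq> s ! j" using d b l by (metis disjoint_iff distinct_append nth_mem)
  ultimately show False
    using u h(2) l b unfolding unsplit_def by (metis nat_neq_iff nth_mem)
qed

text \<open>If a letter of t separates the inversion \<open>s ! i\<close>, \<open>s ! j\<close>,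
  then Ki < Kj, and \<open>t' ! Ki\<close> separates the inversion in the image.\<close>

lemma unsplit_shifted:
  assumes sh: "shifted s t s' t'" and d: "distinct (s' @ t')" and u: "unsplit s' t'"
  shows "unsplit s t"
  unfolding unsplit_def
proof (intro allI ballI impI notI)
  have o: "order_iso s s'" "order_iso t t'" using sh by (auto simp: shifted_def)
  fix i j z assume h: "z \<in> set t" "i < j" "j < length s" "s ! j < z" "z < s ! i"
  then obtain q where q: "q < length t" "z = t ! q" by (auto simp: in_set_conv_nth)
  have l: "i < length s" "j < length s" using h by auto
  obtain Ki Kj where K: "cut_at (s ! i) t Ki" "cut_before (s' ! i) t' Ki"
    "cut_at (s ! j) t Kj" "cut_before (s' ! j) t' Kj"
    using shiftedD[OF sh l(1)] shiftedD[OF sh l(2)] by metis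
  have b: "Ki < length t" "Kj < length t" using K by (auto simp: cut_at_def)
  have "t ! q < t ! Ki" "\<not> t ! q < t ! Kj"
    using cut_at_nth[OF K(1) q(1)] cut_at_nth[OF K(3) q(1)] h q by auto
  then have "t ! Kj < t ! Ki" by simp
  then have "Ki < Kj" using K(1) unfolding cut_at_def by (metis nat_neq_iff order.asym)
  have "t' ! Ki < s' ! i" "\<not> t' ! Ki < s' ! j"
    using cut_before_nth[OF K(2) o(2) b(1)] cut_before_nth[OF K(4) o(2) b(1)] K(1) \<open>Ki < Kj\<close>
    by (auto simp: cut_at_def)
  moreover have "t' ! Ki \<noteq> s' ! j"
    using d b l o by (metis disjoint_iff distinct_append nth_mem order_iso_length)
  ultimately show False
    using u h(2) l b o unfolding unsplit_def by (metis nat_neq_iff nth_mem order_iso_length)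
qed

text \<open>The least letter of t has position q \<ge> K for each cut K, because
  \<open>t ! K\<close> is a left-to-right minimum. It is therefore below all letters before position
  K, so its counterpart in t' lies below each lifted letter.\<close>

lemma shifted_min:
  assumes sh: "shifted s t s' t'" and d: "distinct t" and t: "t \<noteq> []"
  shows "\<exists>z\<in>set t'. \<forall>x\<in>set s'. z < x"
proof -
  have o: "order_iso s s'" "order_iso t t'" using sh by (auto simp: shifted_def)
  obtain q where q: "q < length t" "t ! q = Min (set t)"
    using t by (metis Min_in List.finite_set in_set_conv_nth set_empty)
  have min: "t ! q < t ! j" if "j < length t" "j \<noteq> q" for j
  proof -
    have "t ! q \<le> t ! j" using that by (simp add: q(2))
    then show ?thesis using d that q(1) by (simp add: nth_eq_iff_index_eq order.strict_iff_order)
  qed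
  have "t' ! q < s' ! i" if i: "i < length s'" for i
  proof -
    have "i < length s" using i o by (simp add: order_iso_length)
    then obtain K where K: "cut_at (s ! i) t K" "cut_before (s' ! i) t' K"
      using shiftedD[OF sh] by blast
    then have "\<not> q < K" using min[of K] by (auto simp: cut_at_def)
    then show ?thesis using cut_before_nth[OF K(2) o(2) q(1)] min K by (auto simp: cut_at_def)
  qed
  then show ?thesis using q(1) o by (metis in_set_conv_nth order_iso_length)
qed

text \<open>A letter with \<open>cut_at x t K\<close> satisfies x < \<open>t ! K\<close>, and a
  left-to-right minimum is at most the head.\<close>

lemma shifted_less_hd:
  assumes sh: "shifted s t s' t'" and d: "distinct (s @ t)" and x: "x \<in> set s"
  shows "x < hd t"
proof -
  obtain i where i: "i < length s" "x = s ! i" using x by (auto simp: in_set_conv_nth)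
  obtain K where K: "cut_at x t K" using shiftedD[OF sh i(1)] i(2) by blast
  then have "\<not> t ! K < x" "t ! K \<le> t ! 0" "K < length t"
    by (auto simp: cut_at_def)
  moreover have "hd t = t ! 0" using \<open>K < length t\<close> by (intro hd_conv_nth) auto
  moreover have "x \<noteq> t ! K" using d x \<open>K < length t\<close> by auto
  ultimately show ?thesis by simp
qed

lemma shifted_compatible:
  assumes sh: "shifted s t s' t'" and d: "distinct (s @ t)" "distinct (s' @ t')"
    and c: "compatible s t" and t: "t \<noteq> []"
  shows "compatible s' t'"
proof -
  obtain z where z: "z \<in> set t'" "\<forall>x\<in>set s'. z < x"
    using shifted_min[OF sh _ t] d by auto
  have "\<forall>x\<in>set s'. \<exists>K. cut_before x t' K"
    using sh unfolding shifted_def by (metis in_set_conv_nth order_iso_length)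
  then show ?thesis
    using compatible_iff_cut_before[OF d(2) z] shifted_unsplit[OF sh d(1)] c
    by (simp add: compatible_def)
qed

lemma compatible_shifted:
  assumes sh: "shifted s t s' t'" and d: "distinct (s @ t)" "distinct (s' @ t')"
    and c: "compatible s' t'" and t: "t \<noteq> []"
  shows "compatible s t"
proof -
  have "\<forall>x\<in>set s. \<exists>K. cut_at x t K"
    using sh unfolding shifted_def by (metis in_set_conv_nth)
  then show ?thesis
    using compatible_iff_cut_at[OF d(1), of "hd t"] shifted_less_hd[OF sh d(1)] t
      unsplit_shifted[OF sh d(2)] c
    by (simp add: compatible_def)
qed

lemma order_iso_appendD:
  assumes "order_iso (s @ t) (u @ v)" "length s = length u"
  shows "order_iso s u" "order_iso t v"
    and "i < length s \<Longrightarrow> j < length t \<Longrightarrow> v ! j < u ! i \<longleftrightarrow> t ! j < s ! i"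
proof -
  have l: "length t = length v" using assms by (simp add: order_iso_def)
  note n = order_iso_nth[OF assms(1)]
  show "order_iso s u" unfolding order_iso_def
  proof (intro conjI allI impI)
    fix i j assume "i < length s" "j < length s"
    then show "s ! i < s ! j \<longleftrightarrow> u ! i < u ! j"
      using n[of i j] assms(2) by (simp add: nth_append)
  qed (fact assms(2))
  show "order_iso t v" unfolding order_iso_def
  proof (intro conjI allI impI)
    fix i j assume "i < length t" "j < length t"
    then show "t ! i < t ! j \<longleftrightarrow> v ! i < v ! j"
      using n[of "length s + i" "length s + j"] assms(2) by (simp add: nth_append)
  qed (fact l)
  show "i < length s \<Longrightarrow> j < length t \<Longrightarrow> v ! j < u ! i \<longleftrightarrow> t ! j < s ! i"
    using n[of "length s + j" i] assms(2) by (simp add: nth_append)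
qed

text \<open>Allows a preimage built from arbitrary numbers to be replaced by its
  standardization.\<close>

lemma shifted_order_iso:
  assumes o: "order_iso (s @ t) (u @ v)" "length s = length u" and sh: "shifted s t s' t'"
  shows "shifted u v s' t'"
proof -
  note o' = order_iso_appendD[OF o]
  have "cut_at (u ! i) v K" if "i < length s" "cut_at (s ! i) t K" for i K
    unfolding cut_at_def all_set_conv_all_nth
    using that order_iso_nth[OF o'(2)] o'(3)[OF that(1)] order_iso_length[OF o'(2)]
    by (simp add: cut_at_def)
  moreover have "order_iso u s'" "order_iso v t'"
    using sh o' order_iso_sym order_iso_trans unfolding shifted_def by blast+
  ultimately show ?thesis using sh o unfolding shifted_def by metis
qed

text \<open>Makes the inverse construction order preserving on the left word: larger letters belong
  to left-to-right minima that are at least as large.\<close>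

lemma cut_before_mono:
  assumes "cut_before x t K" "cut_before y t L" "x \<le> y"
  shows "t ! K \<le> t ! L"
proof (rule ccontr)
  assume lt: "\<not> t ! K \<le> t ! L"
  have K: "K < length t" "t ! K < x" and L: "L < length t"
    using assms by (auto simp: cut_before_def)
  then have "t ! K < y" "t ! K \<in> set t" using assms(3) by auto
  then have "\<forall>j<L. t ! K < t ! j" using assms(2) by (simp add: cut_before_def)
  then have "L < K" using lt by (metis linorder_neqE_nat order.refl order.irrefl)
  then show False using assms(1) lt by (auto simp: cut_before_def)
qed

text \<open>To undo the shift, the letters of the right word are spread out and those of the left word
  are placed into the resulting room, each just below the left-to-right minimum it belongs to.\<close>

lemma shifted_surj:
  assumes d: "distinct (s' @ t')" and c: "\<forall>x\<in>set s'. \<exists>K. cut_before x t' K"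
  shows "\<exists>s t. shifted s t s' t' \<and> distinct (s @ t) \<and> set (s @ t) = {1..length (s' @ t')}"
proof -
  \<comment> \<open>The spread letters of t' are multiples of N, and \<open>g x\<close> must fall
    strictly between \<open>N * t' ! K x\<close> and the next multiple, which is
    \<open>h (t' ! K x)\<close>. This needs 0 < \<open>Suc x\<close> < N. For empty s' the value of
    \<open>Max\<close> is unspecified, but then there is no x to place.\<close>
  define N where "N = Suc (Suc (Max (set s')))"
  have N: "Suc x < N" if "x \<in> set s'" for x
    using that by (auto simp: N_def less_Suc_eq_le)
  obtain K where K: "\<And>x. x \<in> set s' \<Longrightarrow> cut_before x t' (K x)" using c by metis
  define g where "g x = N * t' ! K x + Suc x" for x
  define h where "h y = N * Suc y" for y
  have N0: "0 < N" by (simp add: N_def)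
  have cross: "h y < g x \<longleftrightarrow> y < t' ! K x" and neq: "h y \<noteq> g x" if x: "x \<in> set s'" for x y
  proof -
    have "h y < g x" if "y < t' ! K x"
    proof -
      have "N * Suc y \<le> N * t' ! K x" using that by (intro mult_le_mono2) simp
      then show ?thesis unfolding h_def g_def by linarith
    qed
    moreover have "g x < h y" if "\<not> y < t' ! K x"
    proof -
      have "N * t' ! K x \<le> N * y" using that by (intro mult_le_mono2) simp
      then show ?thesis unfolding h_def g_def mult_Suc_right using N[OF x] by linarith
    qed
    ultimately show "h y < g x \<longleftrightarrow> y < t' ! K x" "h y \<noteq> g x" by (metis order.asym order.irrefl)+
  qed
  have g: "strict_mono_on (set s') g"
  proof (rule strict_mono_onI)
    fix x y assume xy: "x \<in> set s'" "y \<in> set s'" "x < y"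
    then have "t' ! K x \<le> t' ! K y" using K cut_before_mono by (meson less_imp_le)
    then have "N * t' ! K x \<le> N * t' ! K y" by (rule mult_le_mono2)
    then show "g x < g y" using xy unfolding g_def by linarith
  qed
  have h: "strict_mono_on (set t') h"
    using N0 by (intro strict_mono_onI) (simp add: h_def)
  have os: "order_iso s' (map g s')" and ot: "order_iso t' (map h t')"
    using order_iso_map g h by auto
  have dist: "distinct (map g s' @ map h t')"
    using d neq order_iso_distinct[OF os] order_iso_distinct[OF ot] by (auto simp: eq_commute)
  have "shifted (map g s') (map h t') s' t'"
    unfolding shifted_def
  proof (intro conjI allI impI)
    fix i assume i: "i < length (map g s')"
    then have x: "s' ! i \<in> set s'" by simp
    note k = K[OF x]
    have "cut_at (g (s' ! i)) (map h t') (K (s' ! i))"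
      unfolding cut_at_def
      using k cross[OF x] N0 by (auto simp: cut_before_def h_def)
    then show "\<exists>K. cut_at (map g s' ! i) (map h t') K \<and> cut_before (s' ! i) t' K"
      using k i by auto
  qed (use os ot order_iso_sym in blast)+
  \<comment> \<open>The spread words have gaps; standardizing their concatenation yields letters
    {1..length} and keeps all comparisons.\<close>
  moreover define w where "w = st (map g s' @ map h t')"
  moreover define s t where "s = take (length s') w" and "t = drop (length s') w"
  moreover have w: "w = s @ t" by (simp add: s_def t_def)
  moreover have "length s = length s'" by (simp add: s_def w_def st_def)
  ultimately have "shifted s t s' t'"
    using order_iso_st[of "map g s' @ map h t'"]
    by (metis length_map shifted_order_iso)
  moreover have "distinct (s @ t)" "set (s @ t) = {1..length (s' @ t')}"
    using order_iso_distinct[OF order_iso_st dist] set_st[OF dist]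
    unfolding w[symmetric] by (simp_all add: w_def del: distinct_append set_append)
  ultimately show ?thesis by blast
qed

section \<open>Blocks of consecutive integers and the evaluation of \<open>psi\<close>\<close>

lemma runs_neq_Nil: "l \<noteq> [] \<Longrightarrow> runs l \<noteq> [] \<and> hd (runs l) \<noteq> [] \<and> hd (hd (runs l)) = hd l"
  by (induction l rule: runs.induct) auto

lemma concat_runs: "concat (runs l) = l"
proof (induction l rule: runs.induct)
  case (3 x y ys)
  then show ?case using runs_neq_Nil[of "y # ys"] by (cases "runs (y # ys)") auto
qed auto

lemma runs_upt: "r \<in> set (runs l) \<Longrightarrow> \<exists>a b. a < b \<and> r = [a..<b]"
proof (induction l arbitrary: r rule: runs.induct)
  case (2 x)
  then show ?case by (intro exI[of _ x] exI[of _ "Suc x"]) simp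
next
  case (3 x y ys)
  obtain r0 R where R: "runs (y # ys) = r0 # R" "r0 \<noteq> []" "hd r0 = y"
    using runs_neq_Nil[of "y # ys"] by (cases "runs (y # ys)") auto
  have x: "[x] = [x..<Suc x]" by simp
  show ?case
  proof (cases "y = Suc x")
    case True
    then obtain a b where ab: "a < b" "r0 = [a..<b]" using 3 R by (metis list.set_intros(1))
    then have "a = y" using R by simp
    then have "x # r0 = [x..<b]" using ab True by (metis Suc_lessD upt_conv_Cons)
    moreover have "x < b" using ab \<open>a = y\<close> True by simp
    ultimately show ?thesis using 3 R True by (auto split: if_splits)
  next
    case False
    then have "r = [x] \<or> r \<in> set (runs (y # ys))" using "3.prems" by auto
    then show ?thesis using "3.IH"(3)[OF False] x by (metis lessI)
  qed
qed auto

text \<open>This is the maximality of the runs. Where a new run starts after x, the missing integer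
  is \<open>Suc x\<close>; when a run is only extended downwards by x, the integer found for the
  tail still works.\<close>

lemma runs_gap:
  assumes "sorted_wrt (<) l" "Suc i < length (runs l)"
  shows "\<exists>e. e \<notin> set l \<and> (\<forall>a\<in>set (runs l ! i). a < e) \<and> (\<forall>b\<in>set (runs l ! Suc i). e < b)"
  using assms
proof (induction l arbitrary: i rule: runs.induct)
  case (3 x y ys)
  let ?R = "runs (y # ys)"
  have ne: "?R \<noteq> []" using runs_neq_Nil[of "y # ys"] by simp
  have mem: "y \<le> b" if "k < length ?R" "b \<in> set (?R ! k)" for k b
  proof -
    have "b \<in> set (concat ?R)" using that nth_mem by fastforce
    then show ?thesis using "3.prems"(1) unfolding concat_runs by (auto simp: less_imp_le)
  qed
  have ex: "\<exists>b. b \<in> set (?R ! k)" if "k < length ?R" for k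
    using runs_upt[of "?R ! k" "y # ys"] that nth_mem by fastforce
  have xy: "x < y" "sorted_wrt (<) (y # ys)" using "3.prems"(1) by auto
  show ?case
  proof (cases "y = Suc x")
    case True
    then have l: "runs (x # y # ys) = (x # hd ?R) # tl ?R" by simp
    then have "Suc i < length ?R" using "3.prems"(2) ne by simp
    then obtain e where e: "e \<notin> set (y # ys)" "\<forall>a\<in>set (?R ! i). a < e"
      "\<forall>b\<in>set (?R ! Suc i). e < b" using "3.IH"(1)[OF True xy(2)] by blast
    obtain b where "b \<in> set (?R ! i)" using ex \<open>Suc i < length ?R\<close> Suc_lessD by blast
    then have "x < e" using e mem[of i b] \<open>Suc i < length ?R\<close> xy(1) by fastforce
    then have "e \<notin> set (x # y # ys)" using e by auto
    moreover have "\<forall>a\<in>set (runs (x # y # ys) ! i). a < e"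
      using e(2) ne \<open>x < e\<close> unfolding l by (cases "?R"; cases i) auto
    moreover have "runs (x # y # ys) ! Suc i = ?R ! Suc i"
      using ne \<open>Suc i < length ?R\<close> unfolding l by (simp add: nth_tl)
    ultimately show ?thesis using e(3) by auto
  next
    case False
    then have l: "runs (x # y # ys) = [x] # ?R" by simp
    show ?thesis
    proof (cases i)
      case 0
      have "Suc x \<notin> set (x # y # ys)" using xy False by auto
      moreover have "Suc x < b" if "b \<in> set (?R ! 0)" for b
        using mem[of 0 b] that ne xy False by simp
      ultimately show ?thesis using 0 l by (intro exI[of _ "Suc x"]) simp
    next
      case (Suc k)
      then have k: "Suc k < length ?R" using "3.prems"(2) l by simp
      then obtain e where e: "e \<notin> set (y # ys)" "\<forall>a\<in>set (?R ! k). a < e"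
        "\<forall>b\<in>set (?R ! Suc k). e < b" using "3.IH"(3)[OF False xy(2)] by blast
      obtain b where "b \<in> set (?R ! k)" using ex k Suc_lessD by blast
      then have "x < e" using e mem[of k b] k xy(1) by fastforce
      then show ?thesis using e Suc l by (intro exI[of _ e]) auto
    qed
  qed
qed auto

text \<open>These facts, together with the inclusion of each block in s, are the interface through
  which \<open>runs\<close> enters the analysis of \<open>psi\<close>.\<close>

lemma
  fixes s :: "nat list"
  shows UN_block: "(\<Union>i\<in>{1..num_blocks s}. set (block s i)) = set s"
    and block_convex: "a \<in> set (block s i) \<Longrightarrow> b \<in> set (block s i) \<Longrightarrow> a \<le> c \<Longrightarrow> c \<le> b \<Longrightarrow>
        c \<in> set (block s i)"
    and block_gap: "\<lbrakk>a \<in> set (block s i); b \<in> set (block s (Suc i))\<rbrakk> \<Longrightarrow>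
        \<exists>e. e \<notin> set s \<and> a < e \<and> e < b"
proof -
  define l where "l = sorted_list_of_set (set s)"
  have l: "set l = set s" "sorted_wrt (<) l" "num_blocks s = length (runs l)"
    by (auto simp: l_def num_blocks_def)
  have run: "set (runs l ! k) \<subseteq> set s" if "k < length (runs l)" for k
    using that l(1) concat_runs[of l] by (metis UN_upper nth_mem set_concat)
  have block: "set (block s i) = (if 1 \<le> i \<and> i \<le> num_blocks s then set (runs l ! (i - 1)) else {})" for i
  proof (cases "1 \<le> i \<and> i \<le> num_blocks s")
    case True
    then have "i - 1 < length (runs l)" using l(3) by auto
    then show ?thesis using run[of "i - 1"] True by (auto simp: block_def l_def)
  qed (auto simp: block_def)
  have "(\<Union>i\<in>{1..num_blocks s}. set (block s i)) = (\<Union>i\<in>{1..length (runs l)}. set (runs l ! (i - 1)))"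
    using block l(3) by simp
  also have "\<dots> = (\<Union>r\<in>set (runs l). set r)"
  proof -
    have "set (runs l) = (\<lambda>i. runs l ! (i - 1)) ` {1..length (runs l)}"
    proof -
      have "{0..<length (runs l)} = (\<lambda>i. i - 1) ` {1..length (runs l)}"
        by (auto simp: image_iff intro!: bexI[of _ "Suc _"])
      moreover have "set (runs l) = (!) (runs l) ` {0..<length (runs l)}"
        by (metis list.set_map map_nth set_upt)
      ultimately show ?thesis by (simp add: image_image)
    qed
    then show ?thesis by simp
  qed
  also have "\<dots> = set s" using concat_runs[of l] l(1) by (metis set_concat)
  finally show "(\<Union>i\<in>{1..num_blocks s}. set (block s i)) = set s" .
  show "a \<in> set (block s i) \<Longrightarrow> b \<in> set (block s i) \<Longrightarrow> a \<le> c \<Longrightarrow> c \<le> b \<Longrightarrow> c \<in> set (block s i)"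
  proof -
    assume h: "a \<in> set (block s i)" "b \<in> set (block s i)" "a \<le> c" "c \<le> b"
    then have i: "1 \<le> i \<and> i \<le> num_blocks s" using block by (auto split: if_splits)
    then have "i - 1 < length (runs l)" using l(3) by auto
    then have "runs l ! (i - 1) \<in> set (runs l)" by (rule nth_mem)
    then obtain m n where "runs l ! (i - 1) = [m..<n]" using runs_upt by blast
    then show "c \<in> set (block s i)" using h block i by auto
  qed
  show "\<exists>e. e \<notin> set s \<and> a < e \<and> e < b" if h: "a \<in> set (block s i)" "b \<in> set (block s (Suc i))"
  proof -
    have i: "1 \<le> i" "Suc i \<le> num_blocks s" using h block by (auto split: if_splits)
    then obtain k where "i = Suc k" by (cases i) auto
    then show ?thesis using runs_gap[OF l(2), of k] i h block l by auto
  qed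
qed

text \<open>Links the definition of \<open>psi\<close> to cuts. The minimum of the gap word above
  the block of x is \<open>t ! K\<close>, and m_i counts the letters after it that are below
  everything before it in the gap word. The point is that these are the same letters as those of t
  above \<open>t ! K\<close> and below all letters of t before position K, although the gap word may
  miss some of the latter. With \<open>t ! K\<close> itself they are the letters of t that the lift
  has to pass.\<close>

lemma gap_word_cut:
  assumes d: "distinct (s @ t)" and st: "set (s @ t) = {1..<n}"
    and cut: "\<forall>x\<in>set s. \<exists>K. cut_at x t K"
    and x: "x \<in> set (block s i)" "cut_at x t K"
  shows "Suc (shift (gap_word s t i)) = card {y \<in> set t. t ! K \<le> y \<and> (\<forall>j<K. y < t ! j)}"
proof -
  define P where "P y \<longleftrightarrow> block s i \<prec> [y] \<and> [y] \<prec> block s (i + 1)" for y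
  have bs: "set (block s k) \<subseteq> set s" for k
    unfolding block_def by auto
  have K: "K < length t" "\<And>j. j < K \<Longrightarrow> t ! K < t ! j" "\<And>y. y \<in> set t \<Longrightarrow> y < x \<longleftrightarrow> y < t ! K"
    using x(2) by (auto simp: cut_at_def)
  have disj: "y \<notin> set s" if "y \<in> set t" for y using d that by auto
  have above: "block s i \<prec> [y] \<longleftrightarrow> x < y" if y: "y \<in> set t" for y
  proof
    show "block s i \<prec> [y] \<Longrightarrow> x < y" using x(1) by (simp add: prec_def)
    assume "x < y"
    \<comment> \<open>Otherwise y lies between x and z, hence in the interval formed by the block,
      although y is a letter of t.\<close>
    then have "z < y" if "z \<in> set (block s i)" for z
      using block_convex[OF x(1) that, of y] bs disj[OF y] by (meson in_mono not_less less_imp_le)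
    then show "block s i \<prec> [y]" by (simp add: prec_def)
  qed
  have tK: "t ! K \<in> set t" "x < t ! K"
    using K(1) K(3)[of "t ! K"] x(1) bs disj[of "t ! K"]
    by (auto simp: not_less order.order_iff_strict)
  \<comment> \<open>The integer e missing between the two blocks is a letter of t, as s and t
    together exhaust {1..<n}. It is above x, and so not below \<open>t ! K\<close>.\<close>
  have "t ! K < z" if z: "z \<in> set (block s (i + 1))" for z
  proof (rule ccontr)
    assume n: "\<not> t ! K < z"
    obtain e where e: "e \<notin> set s" "x < e" "e < z" using block_gap[OF x(1)] z by auto
    have "z \<in> set (s @ t)" "x \<in> set (s @ t)" using z x(1) bs by auto
    then have "z \<in> {1..<n}" "x \<in> {1..<n}" unfolding st by auto
    then have "e \<in> set (s @ t)" unfolding st using e by auto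
    then have "e \<in> set t" using e(1) by simp
    then show False using K(3)[of e] e n by simp
  qed
  then have PK: "P (t ! K)" using above tK by (simp add: P_def prec_def)
  have P_ge: "t ! K \<le> y" if "y \<in> set t" "P y" for y
    using that above[OF that(1)] K(3)[OF that(1)] by (simp add: P_def not_less[symmetric])
  define A where "A = filter P (take K t)"
  define B where "B = filter P (drop (Suc K) t)"
  have w: "gap_word s t i = A @ t ! K # B"
  proof -
    have "gap_word s t i = filter P t" by (simp add: gap_word_def P_def[abs_def])
    also have "\<dots> = filter P (take K t @ t ! K # drop (Suc K) t)"
      using id_take_nth_drop[OF K(1)] by simp
    also have "\<dots> = A @ t ! K # B" using PK by (simp add: A_def B_def)
    finally show ?thesis .
  qed
  have gt: "set (gap_word s t i) = {y \<in> set t. P y}" by (auto simp: gap_word_def P_def)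
  have Min: "Min (set (gap_word s t i)) = t ! K"
    using P_ge PK tK by (intro Min_eqI) (auto simp: gt)
  have A: "t ! K \<notin> set A"
    using d K(1) by (auto simp: A_def in_set_conv_nth nth_eq_iff_index_eq)
  have bm: "before_min (gap_word s t i) = A" "after_min (gap_word s t i) = B"
    unfolding before_min_def after_min_def Min unfolding w using A
    by (auto simp: takeWhile_append dropWhile_append takeWhile_eq_all_conv)
  have "{y \<in> set B. [y] \<prec> A} = {y \<in> set t. t ! K < y \<and> (\<forall>j<K. y < t ! j)}"
  proof (intro equalityI subsetI)
    fix y assume "y \<in> {y \<in> set B. [y] \<prec> A}"
    then have y: "y \<in> set (drop (Suc K) t)" "P y" "\<forall>u\<in>set A. y < u"
      by (auto simp: B_def prec_def)
    have yt: "y \<in> set t" using y(1) by (rule in_set_dropD)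
    obtain r where "y = t ! (Suc K + r)" "Suc K + r < length t"
      using y(1) by (auto simp: in_set_conv_nth)
    then have "y \<noteq> t ! K" using d K(1) by (simp add: nth_eq_iff_index_eq)
    then have "t ! K < y" using P_ge[OF yt y(2)] by simp
    moreover have "y < t ! j" if j: "j < K" for j
    proof (cases "P (t ! j)")
      case True
      then have "t ! j \<in> set A" using j K(1) by (auto simp: A_def in_set_conv_nth intro!: exI[of _ j])
      then show ?thesis using y by blast
    next
      case False
      \<comment> \<open>An earlier letter missing from the gap word fails to be below the next
        block. Since y is below that block, y is below this letter too.\<close>
      have "t ! j \<in> set t" "x < t ! j" using tK(2) K(1) K(2)[OF j] j by auto
      then have "\<not> [t ! j] \<prec> block s (i + 1)" using False above unfolding P_def by blast
      then obtain z where "z \<in> set (block s (i + 1))" "z \<le> t ! j"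
        by (auto simp: prec_def not_less)
      then show ?thesis using y(2) by (auto simp: P_def prec_def)
    qed
    ultimately show "y \<in> {y \<in> set t. t ! K < y \<and> (\<forall>j<K. y < t ! j)}" using yt by blast
  next
    fix y assume "y \<in> {y \<in> set t. t ! K < y \<and> (\<forall>j<K. y < t ! j)}"
    then have y: "y \<in> set t" "t ! K < y" "\<And>j. j < K \<Longrightarrow> y < t ! j" by auto
    have "y < z" if z: "z \<in> set (block s (i + 1))" for z
    proof (rule ccontr)
      assume n: "\<not> y < z"
      \<comment> \<open>The next block is cut at a larger and hence earlier left-to-right minimum; y
        is below it by assumption, and so below z.\<close>
      obtain K2 where K2: "cut_at z t K2" using cut z bs by blast
      have "t ! K < z" using PK z by (simp add: P_def prec_def)
      then have "t ! K < t ! K2" using K2 tK by (simp add: cut_at_def)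
      then have "K2 < K" using K2 unfolding cut_at_def by (metis nat_neq_iff order.asym)
      then have "y < t ! K2" using y by blast
      then have "y < z" using K2 y(1) by (simp add: cut_at_def)
      then show False using n by blast
    qed
    then have "P y" using above y tK(2) by (auto simp: P_def prec_def)
    moreover have "y \<in> set (drop (Suc K) t)"
    proof -
      obtain r where r: "y = t ! r" "r < length t" using y(1) by (auto simp: in_set_conv_nth)
      then have "\<not> r < K" "r \<noteq> K" using y by auto
      then have "Suc K \<le> r" by simp
      then show ?thesis using r by (auto simp: in_set_conv_nth intro!: exI[of _ "r - Suc K"])
    qed
    moreover have "y < u" if "u \<in> set A" for u
      using that y(3) K(1) by (auto simp: A_def in_set_conv_nth)
    ultimately show "y \<in> {y \<in> set B. [y] \<prec> A}" by (auto simp: B_def prec_def)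
  qed
  then have "shift (gap_word s t i) = card {y \<in> set t. t ! K < y \<and> (\<forall>j<K. y < t ! j)}"
    unfolding shift_def bm by simp
  moreover have "{y \<in> set t. t ! K \<le> y \<and> (\<forall>j<K. y < t ! j)} =
      insert (t ! K) {y \<in> set t. t ! K < y \<and> (\<forall>j<K. y < t ! j)}"
    using tK K(2) by auto
  ultimately show ?thesis by simp
qed

lemma left_part_append: "m = length (s @ m # t) \<Longrightarrow> m \<notin> set s \<Longrightarrow> left_part (s @ m # t) = s"
  unfolding left_part_def by (auto simp: takeWhile_append takeWhile_eq_all_conv)

lemma right_part_append: "m = length (s @ m # t) \<Longrightarrow> m \<notin> set s \<Longrightarrow> right_part (s @ m # t) = t"
  unfolding right_part_def by (auto simp: dropWhile_append)

text \<open>Everything is decided by counting. The new value of x is its rank if x is moved up to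
  the cut before K. Conversely, in the image that value has the prescribed number of letters of t'
  below it, which by \<open>order_iso_set_card_less\<close> fixes its place among them.\<close>

lemma psi_shifted:
  assumes d: "distinct (s @ t)" and st: "set (s @ t) = {1..<n}"
    and c: "compatible s t" and z: "z \<in> set t" "\<forall>x\<in>set s. x < z"
  shows "\<exists>s' t'. psi (s @ n # t) = s' @ n # t' \<and> shifted s t s' t' \<and>
    distinct (s' @ t') \<and> set (s' @ t') = {1..<n}"
proof -
  have n: "length s + length t = n - 1" using d st by (metis card_atLeastLessThan distinct_card length_append)
  have "1 \<le> z" "z < n" using z(1) st by auto
  then have "n = Suc (length s + length t)" using n by linarith
  then have n': "n = length (s @ n # t)" by (simp only: length_append list.size add_Suc_right add_0_right)
  have ns: "n \<notin> set s" using st by auto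
  have cut: "\<forall>x\<in>set s. \<exists>K. cut_at x t K"
    using compatible_iff_cut_at[OF d z] c by blast
  then obtain K where K: "\<And>x. x \<in> set s \<Longrightarrow> cut_at x t (K x)" by metis
  define below where "below k = {y \<in> set t. \<forall>j<k. y < t ! j}" for k
  \<comment> \<open>The rank of the lifted letter: the letters of s up to x, and the letters of t
    below its new place.\<close>
  define g where "g x = card {y \<in> set s. y \<le> x} + card (below (K x))" for x
  have shift: "x + shift (gap_word s t i) + 1 = g x" if x: "x \<in> set (block s i)" for x i
  proof -
    have xs: "x \<in> set s" using x by (auto simp: block_def split: if_splits)
    note k = K[OF xs]
    have "{1..x} = {y \<in> set s. y \<le> x} \<union> {y \<in> set t. y < x}" (is "_ = ?S \<union> ?T")
    proof -
      have "y \<le> x \<longleftrightarrow> y < x" if "y \<in> set t" for y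
        using d xs that by (metis disjoint_iff distinct_append le_less)
      moreover have "x < n" using xs st by auto
      then have "{1..x} = {y \<in> set (s @ t). y \<le> x}" unfolding st by auto
      ultimately show ?thesis by auto
    qed
    moreover have "?S \<inter> ?T = {}" using d by auto
    ultimately have "x = card ?S + card ?T"
      using card_Un_disjoint[of ?S ?T] card_atLeastAtMost[of 1 x] by simp
    moreover have "Suc (shift (gap_word s t i)) = card {y \<in> set t. t ! K x \<le> y \<and> (\<forall>j<K x. y < t ! j)}"
      (is "_ = card ?U")
      by (rule gap_word_cut[OF d st cut x k])
    moreover have "card ?T + card ?U = card (below (K x))"
    proof -
      have "?T \<union> ?U = below (K x)" "?T \<inter> ?U = {}"
        using k by (auto simp: below_def cut_at_def)
      then show ?thesis using card_Un_disjoint[of ?T ?U] by simp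
    qed
    ultimately show ?thesis by (simp add: g_def)
  qed
  have L: "psi_left s t = g ` set s"
  proof -
    have "psi_left s t = (\<Union>i \<in> {1..num_blocks s}. g ` set (block s i))"
      unfolding psi_left_def using shift by (intro SUP_cong image_cong) auto
    then show ?thesis using UN_block[of s] by (metis image_UN)
  qed
  have below_mono: "card (below (K x)) \<le> card (below (K y))" if xy: "x \<in> set s" "y \<in> set s" "x < y" for x y
  proof -
    have kx: "K x < length t" "K y < length t" using K xy by (auto simp: cut_at_def)
    have "t ! K x \<le> t ! K y"
    proof (rule ccontr)
      assume "\<not> t ! K x \<le> t ! K y"
      then have "t ! K y < x" using K[OF xy(1)] kx by (simp add: cut_at_def)
      then have "t ! K y < y" using xy(3) by simp
      then show False using K[OF xy(2)] kx by (simp add: cut_at_def)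
    qed
    then have "K y \<le> K x" using K[OF xy(2)] unfolding cut_at_def
      by (metis K cut_at_def leD not_le_imp_less xy(1))
    then have "below (K x) \<subseteq> below (K y)" by (auto simp: below_def)
    then show ?thesis by (intro card_mono) (auto simp: below_def)
  qed
  have g: "strict_mono_on (set s) g"
  proof (rule strict_mono_onI)
    fix x y assume xy: "x \<in> set s" "y \<in> set s" "x < y"
    then show "g x < g y"
      unfolding g_def using below_mono[OF xy] strict_mono_onD[OF strict_mono_on_card_le, of "set s" x y]
      by simp
  qed
  have g_range: "g x \<in> {1..<n}" if x: "x \<in> set s" for x
  proof -
    have "card {y \<in> set s. y \<le> x} \<le> length s" "card (below (K x)) \<le> length t"
      using d distinct_card[of s] distinct_card[of t]
        card_mono[of "set s" "{y \<in> set s. y \<le> x}"] card_mono[of "set t" "below (K x)"]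
      by (auto simp: below_def)
    moreover have "0 < card {y \<in> set s. y \<le> x}" using x by (subst card_gt_0_iff) auto
    ultimately show ?thesis using n \<open>z < n\<close> by (simp add: g_def)
  qed
  define s' where "s' = map g s"
  define R where "R = {1..n - 1} - psi_left s t"
  define t' where "t' = st_inv R (st t)"
  have s': "st_inv (psi_left s t) (st s) = s'"
    unfolding L s'_def using st_inv_st_image g d by auto
  have ds: "distinct s'" "set s' = psi_left s t"
    using d L g by (auto simp: s'_def distinct_map strict_mono_on_imp_inj_on)
  have sub: "psi_left s t \<subseteq> {1..n - 1}" using g_range unfolding L by fastforce
  have "card R = length t"
    using card_Diff_subset[OF _ sub] ds distinct_card[OF ds(1)] n
      finite_subset[OF sub] by (simp add: R_def s'_def)
  then have ot: "order_iso t t'" and R: "set t' = R"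
    using order_iso_st_inv_st[of t R] set_st_inv_st[of t R] d by (auto simp: t'_def R_def)
  have dt: "distinct t'" using order_iso_distinct[OF ot] d by simp
  have un: "set (s' @ t') = {1..<n}"
  proof -
    have "{1..<n} = {1..n - 1}" using \<open>z < n\<close> by auto
    then show ?thesis using sub ds R by (auto simp: R_def)
  qed
  have dst: "distinct (s' @ t')" using ds dt R by (auto simp: R_def)
  have os: "order_iso s s'" unfolding s'_def by (rule order_iso_map[OF g])
  have "cut_before (s' ! i) t' (K (s ! i))" if i: "i < length s" for i
  proof -
    let ?x = "s ! i"
    have x: "?x \<in> set s" using i by simp
    note k = K[OF x]
    have kl: "K ?x < length t" using k by (simp add: cut_at_def)
    have si: "s' ! i = g ?x" using i by (simp add: s'_def)
    have lt: "length t' = length t" using ot by (simp add: order_iso_def)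
    have lr: "\<forall>j<K ?x. t' ! K ?x < t' ! j"
      using k order_iso_nth[OF ot kl] by (auto simp: cut_at_def)
    \<comment> \<open>The least letter of t before position K. Inserting n handles K = 0, where that
      prefix is empty and the lifted letter must exceed all of t.\<close>
    define a where "a = Min (insert n (set (take (K ?x) t)))"
    have a: "y < a \<longleftrightarrow> (\<forall>j<K ?x. y < t ! j)" if "y \<in> set t" for y
    proof -
      have "y < n" using that st by auto
      moreover have "(\<forall>z\<in>set (take (K ?x) t). y < z) \<longleftrightarrow> (\<forall>j<K ?x. y < t ! j)"
        using kl by (fastforce simp: in_set_conv_nth)
      ultimately show ?thesis by (simp add: a_def)
    qed
    \<comment> \<open>As s' and t' fill {1..<n}, \<open>g ?x\<close> is the number of letters up to
      it. The share of s' equals that of s, so the share of t' must be the second summand in the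
      definition of g.\<close>
    have "card {y \<in> set t'. y < g ?x} = card {y \<in> set t. y < a}"
    proof -
      have "{y \<in> set t. y < a} = below (K ?x)" using a by (auto simp: below_def)
      moreover have "g ?x = card {y \<in> set s'. y \<le> g ?x} + card {y \<in> set t'. y < g ?x}"
      proof -
        have "{1..g ?x} = {y \<in> set (s' @ t'). y \<le> g ?x}" using g_range[OF x] unfolding un by auto
        moreover have "g ?x \<in> set s'" using i by (simp add: s'_def)
        then have "y \<le> g ?x \<longleftrightarrow> y < g ?x" if "y \<in> set t'" for y
          using dst that by (metis disjoint_iff distinct_append le_less)
        ultimately have "{1..g ?x} = {y \<in> set s'. y \<le> g ?x} \<union> {y \<in> set t'. y < g ?x}"
          by auto
        moreover have "{y \<in> set s'. y \<le> g ?x} \<inter> {y \<in> set t'. y < g ?x} = {}" using dst by auto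
        ultimately show ?thesis
          using card_Un_disjoint[of "{y \<in> set s'. y \<le> g ?x}" "{y \<in> set t'. y < g ?x}"]
            card_atLeastAtMost[of 1 "g ?x"] by simp
      qed
      moreover have "card {y \<in> set s'. y \<le> g ?x} = card {y \<in> set s. y \<le> ?x}"
        using order_iso_card_le[OF os _ i] d si by simp
      ultimately show ?thesis by (simp add: g_def)
    qed
    then have "t' ! q < g ?x \<longleftrightarrow> t ! q < a" if "q < length t" for q
      using order_iso_set_card_less[OF ot _ that, of a "g ?x"] d by simp
    then show ?thesis
      unfolding cut_before_def all_set_conv_all_nth si
      using kl lt lr a order_iso_nth[OF ot] by simp
  qed
  then have "shifted s t s' t'"
    unfolding shifted_def using os ot K by (metis nth_mem)
  moreover have "psi (s @ n # t) = s' @ n # t'"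
    unfolding psi_def Let_def left_part_append[OF n' ns] right_part_append[OF n' ns] n'[symmetric]
    by (simp only: s' R_def[symmetric] t'_def[symmetric] append_Cons append_Nil)
  ultimately show ?thesis using dst un by blast
qed

section \<open>Statistics of words\<close>

lemma card_less_add_split:
  "card {j. j < a + b \<and> P j} = card {j. j < a \<and> P j} + card {j. j < b \<and> P (a + j)}" for a b :: nat
proof -
  have "{j. j < a + b \<and> P j} = {j. j < a \<and> P j} \<union> (+) a ` {j. j < b \<and> P (a + j)}"
  proof (intro set_eqI)
    fix j
    show "j \<in> {j. j < a + b \<and> P j} \<longleftrightarrow>
        j \<in> {j. j < a \<and> P j} \<union> (+) a ` {j. j < b \<and> P (a + j)}"
    proof (cases "j < a")
      case False
      then obtain k where "j = a + k" by (metis le_iff_add not_less)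
      then show ?thesis by auto
    qed auto
  qed
  moreover have "{j. j < a \<and> P j} \<inter> (+) a ` {j. j < b \<and> P (a + j)} = {}" by auto
  ultimately show ?thesis
    by (simp add: card_Un_disjoint card_image)
qed

lemma lmax_append:
  "lmax (s @ t) = lmax s + card {j. j < length t \<and> (\<forall>x\<in>set s. x < t ! j) \<and> (\<forall>i<j. t ! i < t ! j)}"
proof -
  have "(\<forall>i<length s + j. (s @ t) ! i < t ! j) \<longleftrightarrow>
      (\<forall>x\<in>set s. x < t ! j) \<and> (\<forall>i<j. t ! i < t ! j)" for j
  proof
    assume h: "\<forall>i<length s + j. (s @ t) ! i < t ! j"
    show "(\<forall>x\<in>set s. x < t ! j) \<and> (\<forall>i<j. t ! i < t ! j)"
    proof (intro conjI ballI allI impI)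
      fix x assume "x \<in> set s"
      then obtain i where "i < length s" "x = s ! i" by (auto simp: in_set_conv_nth)
      then show "x < t ! j" using h[rule_format, of i] by (simp add: nth_append)
    next
      fix i assume "i < j"
      then show "t ! i < t ! j" using h[rule_format, of "length s + i"] by simp
    qed
  qed (auto simp: nth_append)
  moreover have "{j. j < length s \<and> (\<forall>i<j. (s @ t) ! i < (s @ t) ! j)} =
      {j. j < length s \<and> (\<forall>i<j. s ! i < s ! j)}"
    by (auto simp: nth_append)
  ultimately show ?thesis
    unfolding lmax_def lmax_positions_def length_append card_less_add_split by simp
qed

lemma lmin_append:
  "lmin (s @ t) = lmin s + card {j. j < length t \<and> (\<forall>x\<in>set s. t ! j < x) \<and> (\<forall>i<j. t ! j < t ! i)}"
proof -
  have "(\<forall>i<length s + j. t ! j < (s @ t) ! i) \<longleftrightarrow>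
      (\<forall>x\<in>set s. t ! j < x) \<and> (\<forall>i<j. t ! j < t ! i)" for j
  proof
    assume h: "\<forall>i<length s + j. t ! j < (s @ t) ! i"
    show "(\<forall>x\<in>set s. t ! j < x) \<and> (\<forall>i<j. t ! j < t ! i)"
    proof (intro conjI ballI allI impI)
      fix x assume "x \<in> set s"
      then obtain i where "i < length s" "x = s ! i" by (auto simp: in_set_conv_nth)
      then show "t ! j < x" using h[rule_format, of i] by (simp add: nth_append)
    next
      fix i assume "i < j"
      then show "t ! j < t ! i" using h[rule_format, of "length s + i"] by simp
    qed
  qed (auto simp: nth_append)
  moreover have "{j. j < length s \<and> (\<forall>i<j. (s @ t) ! j < (s @ t) ! i)} =
      {j. j < length s \<and> (\<forall>i<j. s ! j < s ! i)}"
    by (auto simp: nth_append)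
  ultimately show ?thesis
    unfolding lmin_def length_append card_less_add_split by simp
qed

lemma rmax_append:
  "rmax (s @ t) = rmax t + card {j. j < length s \<and> (\<forall>y\<in>set t. y < s ! j) \<and>
     (\<forall>k. j < k \<and> k < length s \<longrightarrow> s ! k < s ! j)}"
proof -
  have "(\<forall>k. j < k \<and> k < length s + length t \<longrightarrow> (s @ t) ! k < (s @ t) ! j) \<longleftrightarrow>
      (\<forall>y\<in>set t. y < s ! j) \<and> (\<forall>k. j < k \<and> k < length s \<longrightarrow> s ! k < s ! j)"
    if j: "j < length s" for j
  proof
    assume h: "\<forall>k. j < k \<and> k < length s + length t \<longrightarrow> (s @ t) ! k < (s @ t) ! j"
    show "(\<forall>y\<in>set t. y < s ! j) \<and> (\<forall>k. j < k \<and> k < length s \<longrightarrow> s ! k < s ! j)"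
    proof (intro conjI ballI allI impI)
      fix y assume "y \<in> set t"
      then obtain i where "i < length t" "y = t ! i" by (auto simp: in_set_conv_nth)
      then show "y < s ! j" using h[rule_format, of "length s + i"] j by (simp add: nth_append)
    next
      fix k assume "j < k \<and> k < length s"
      then show "s ! k < s ! j" using h[rule_format, of k] j by (simp add: nth_append)
    qed
  qed (use j in \<open>auto simp: nth_append\<close>)
  then have "{j. j < length s \<and> (\<forall>k. j < k \<and> k < length s + length t \<longrightarrow> (s @ t) ! k < (s @ t) ! j)} =
    {j. j < length s \<and> (\<forall>y\<in>set t. y < s ! j) \<and> (\<forall>k. j < k \<and> k < length s \<longrightarrow> s ! k < s ! j)}"
    by blast
  moreover have "(\<forall>k. length s + j < k \<and> k < length s + length t \<longrightarrow> (s @ t) ! k < (s @ t) ! (length s + j))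
      \<longleftrightarrow> (\<forall>k. j < k \<and> k < length t \<longrightarrow> t ! k < t ! j)" for j
  proof
    assume h: "\<forall>k. length s + j < k \<and> k < length s + length t \<longrightarrow> (s @ t) ! k < (s @ t) ! (length s + j)"
    show "\<forall>k. j < k \<and> k < length t \<longrightarrow> t ! k < t ! j"
    proof (intro allI impI)
      fix k assume "j < k \<and> k < length t"
      then show "t ! k < t ! j" using h[rule_format, of "length s + k"] by simp
    qed
  next
    assume h: "\<forall>k. j < k \<and> k < length t \<longrightarrow> t ! k < t ! j"
    show "\<forall>k. length s + j < k \<and> k < length s + length t \<longrightarrow> (s @ t) ! k < (s @ t) ! (length s + j)"
    proof (intro allI impI)
      fix k assume k: "length s + j < k \<and> k < length s + length t"
      then obtain k' where "k = length s + k'" by (metis add_lessD1 le_iff_add less_imp_le)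
      then show "(s @ t) ! k < (s @ t) ! (length s + j)" using h k by simp
    qed
  qed
  ultimately show ?thesis
    unfolding rmax_def length_append card_less_add_split by simp
qed

lemma asc_Cons:
  "asc (x # w) = (if w \<noteq> [] \<and> x < hd w then 1 else 0) + asc w"
proof -
  \<comment> \<open>The extra bound on j gives the set the form required by
    \<open>card_less_add_split\<close>.\<close>
  have "asc v = card {j. j < length v \<and> (j + 1 < length v \<and> v ! j < v ! (j + 1))}" for v
    unfolding asc_def by (rule arg_cong[of _ _ card]) auto
  from this[of "x # w"] this[of w] have "asc (x # w) =
      card {j. j < 1 \<and> j + 1 < length (x # w) \<and> (x # w) ! j < (x # w) ! (j + 1)} + asc w"
    using card_less_add_split[of 1 "length w" "\<lambda>j. j + 1 < length (x # w) \<and> (x # w) ! j < (x # w) ! (j + 1)"]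
    by simp
  moreover have "{j. j < 1 \<and> j + 1 < length (x # w) \<and> (x # w) ! j < (x # w) ! (j + 1)} =
      (if w \<noteq> [] \<and> x < hd w then {0} else {})"
    by (cases w) auto
  ultimately show ?thesis by simp
qed

lemma asc_Nil: "asc [] = 0"
  by (simp add: asc_def)

lemma asc_append:
  "s \<noteq> [] \<Longrightarrow> t \<noteq> [] \<Longrightarrow> asc (s @ t) = asc s + asc t + (if last s < hd t then 1 else 0)"
proof (induction s rule: list_nonempty_induct)
  case (single x)
  then show ?case by (simp add: asc_Cons asc_Nil)
next
  case (cons x xs)
  then show ?case by (simp add: asc_Cons)
qed

text \<open>Treats \<open>ldr\<close> and \<open>lir\<close> together; for transitive R an initial
  run can be followed by comparing neighbours.\<close>

definition run_len :: "(nat \<Rightarrow> nat \<Rightarrow> bool) \<Rightarrow> nat list \<Rightarrow> nat" where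
  "run_len R w = Max {i. i \<le> length w \<and> sorted_wrt R (take i w)}"

lemma ldr_run_len: "ldr = run_len (>)" and lir_run_len: "lir = run_len (<)"
  by (simp_all add: fun_eq_iff ldr_def lir_def run_len_def)

lemma run_len_Nil: "run_len R [] = 0"
  by (simp add: run_len_def)

lemma run_len_Cons:
  assumes "transp R"
  shows "run_len R (x # w) = (if w \<noteq> [] \<and> R x (hd w) then Suc (run_len R w) else 1)"
proof -
  let ?S = "\<lambda>w. {i. i \<le> length w \<and> sorted_wrt R (take i w)}"
  have fin: "finite (?S w)" for w by (rule finite_subset[of _ "{..length w}"]) auto
  show ?thesis
  proof (cases "w \<noteq> [] \<and> R x (hd w)")
    case True
    then obtain y ys where w: "w = y # ys" "R x y" by (cases w) auto
    have iff: "sorted_wrt R (take (Suc i) (x # w)) \<longleftrightarrow> sorted_wrt R (take i w)" for i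
      using w assms by (cases i) (auto dest: transpD)
    have "?S (x # w) = insert 0 (Suc ` ?S w)"
    proof (intro set_eqI)
      fix i
      show "i \<in> ?S (x # w) \<longleftrightarrow> i \<in> insert 0 (Suc ` ?S w)"
        using iff by (cases i) (auto simp del: take_Suc_Cons)
    qed
    moreover have "Max (insert 0 (Suc ` ?S w)) = Suc (Max (?S w))"
    proof -
      have "0 \<in> ?S w" by simp
      then have ne: "?S w \<noteq> {}" by blast
      then show ?thesis
        using fin[of w] mono_Max_commute[of Suc "?S w"] by (simp add: mono_def)
    qed
    ultimately show ?thesis using True by (simp add: run_len_def)
  next
    case False
    have "?S (x # w) = {0, 1}"
    proof (intro set_eqI)
      fix i
      show "i \<in> ?S (x # w) \<longleftrightarrow> i \<in> {0, 1}"
        using False by (cases i; cases "i - 1"; cases w) auto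
    qed
    then show ?thesis using False by (auto simp: run_len_def)
  qed
qed

lemma transp_nat: "transp ((<) :: nat \<Rightarrow> nat \<Rightarrow> bool)" "transp ((>) :: nat \<Rightarrow> nat \<Rightarrow> bool)"
  by (auto intro: transpI)

lemma run_len_append:
  assumes R: "transp R"
  shows "s \<noteq> [] \<Longrightarrow> run_len R (s @ t) =
    (if sorted_wrt R s then length s + (if t \<noteq> [] \<and> R (last s) (hd t) then run_len R t else 0)
     else run_len R s)"
proof (induction s rule: list_nonempty_induct)
  case (single x)
  then show ?case by (simp add: run_len_Cons[OF R])
next
  case (cons x xs)
  have "sorted_wrt R (x # xs) \<longleftrightarrow> R x (hd xs) \<and> sorted_wrt R xs"
    using cons(1) R by (cases xs) (auto dest: transpD)
  then show ?case using cons by (auto simp: run_len_Cons[OF R])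
qed

lemma run_len_le_length: "run_len R w \<le> length w"
  and sorted_take_run_len: "sorted_wrt R (take (run_len R w) w)"
proof -
  let ?S = "{i. i \<le> length w \<and> sorted_wrt R (take i w)}"
  have fin: "finite ?S" by (rule finite_subset[of _ "{..length w}"]) auto
  have "0 \<in> ?S" by simp
  then have "Max ?S \<in> ?S" using fin Max_in by blast
  then show "run_len R w \<le> length w" "sorted_wrt R (take (run_len R w) w)"
    by (auto simp: run_len_def)
qed

lemma run_len_pos: "transp R \<Longrightarrow> w \<noteq> [] \<Longrightarrow> 0 < run_len R w"
  by (cases w) (auto simp: run_len_Cons)

lemma run_len_sorted: "transp R \<Longrightarrow> sorted_wrt R w \<Longrightarrow> run_len R w = length w"
  using run_len_append[of R w "[]"] run_len_Nil by (cases "w = []") auto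

text \<open>Every letter of the initial increasing run is a left-to-right maximum.\<close>

lemma lir_le_lmax: "lir w \<le> lmax w"
proof -
  have "{..<lir w} \<subseteq> lmax_positions w"
  proof
    fix j assume j: "j \<in> {..<lir w}"
    have le: "lir w \<le> length w" unfolding lir_run_len by (rule run_len_le_length)
    have "w ! i < w ! j" if "i < j" for i
      using sorted_wrt_nth_less[OF sorted_take_run_len[of "(<)" w] that] j le that
      by (simp add: lir_run_len)
    then show "j \<in> lmax_positions w" using j le by (auto simp: lmax_positions_def)
  qed
  then have "card {..<lir w} \<le> card (lmax_positions w)"
    by (intro card_mono) (auto simp: lmax_positions_def)
  then show ?thesis by (simp add: lmax_def)
qed

lemma order_iso_asc: "order_iso u v \<Longrightarrow> asc u = asc v"
  unfolding asc_def order_iso_def by (intro arg_cong[of _ _ card]) auto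

lemma order_iso_lmax: "order_iso u v \<Longrightarrow> lmax u = lmax v"
  unfolding lmax_def lmax_positions_def order_iso_def by (intro arg_cong[of _ _ card]) auto

lemma order_iso_lmin: "order_iso u v \<Longrightarrow> lmin u = lmin v"
  unfolding lmin_def order_iso_def by (intro arg_cong[of _ _ card]) auto

lemma order_iso_rmax: "order_iso u v \<Longrightarrow> rmax u = rmax v"
  unfolding rmax_def order_iso_def by (intro arg_cong[of _ _ card]) auto

lemma order_iso_sorted_less:
  assumes "order_iso u v"
  shows "sorted_wrt (<) u \<longleftrightarrow> sorted_wrt (<) v"
proof -
  have "u ! i < u ! j \<longleftrightarrow> v ! i < v ! j" if "i < j" "j < length u" for i j
    using that order_iso_nth[OF assms, of i j] by simp
  then show ?thesis using order_iso_length[OF assms] by (simp add: sorted_wrt_iff_nth_less)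
qed

lemma order_iso_take: "order_iso u v \<Longrightarrow> order_iso (take i u) (take i v)"
  unfolding order_iso_def by simp

lemma order_iso_lir: "order_iso u v \<Longrightarrow> lir u = lir v"
  unfolding lir_def by (simp add: order_iso_sorted_less[OF order_iso_take] order_iso_length)

lemma order_iso_sorted_greater:
  assumes "order_iso u v"
  shows "sorted_wrt (>) u \<longleftrightarrow> sorted_wrt (>) v"
proof -
  have "u ! j < u ! i \<longleftrightarrow> v ! j < v ! i" if "i < j" "j < length u" for i j
    using that order_iso_nth[OF assms, of j i] by simp
  then show ?thesis using order_iso_length[OF assms] by (simp add: sorted_wrt_iff_nth_less)
qed

lemma order_iso_ldr: "order_iso u v \<Longrightarrow> ldr u = ldr v"
  unfolding ldr_def by (simp add: order_iso_sorted_greater[OF order_iso_take] order_iso_length)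

section \<open>Components\<close>

definition indecomposable :: "nat list \<Rightarrow> bool" where
  "indecomposable w \<longleftrightarrow> w \<noteq> [] \<and> (\<forall>\<gamma> \<delta>. w = \<gamma> @ \<delta> \<and> \<gamma> \<prec> \<delta> \<longrightarrow> \<gamma> = [] \<or> \<delta> = [])"

text \<open>A component that begins or ends strictly inside u would split u, and one that extends u
  would itself split after u. So it is u or lies in v.\<close>

lemma component_append:
  assumes u: "indecomposable u" and uv: "u \<prec> v"
  shows "component (u @ v) \<tau> \<longleftrightarrow> \<tau> = u \<or> component v \<tau>"
proof
  assume c: "component (u @ v) \<tau>"
  then obtain \<alpha> \<beta> where e: "u @ v = \<alpha> @ \<tau> @ \<beta>" "\<alpha> \<prec> \<tau>" "\<tau> \<prec> \<beta>" "\<tau> \<noteq> []"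
    by (auto simp: component_def)
  have ind: "\<And>\<gamma> \<delta>. \<tau> = \<gamma> @ \<delta> \<Longrightarrow> \<gamma> \<prec> \<delta> \<Longrightarrow> \<gamma> = [] \<or> \<delta> = []"
    using c by (auto simp: component_def)
  show "\<tau> = u \<or> component v \<tau>"
  proof (cases "\<alpha> = []")
    case True
    then obtain w where w: "u = \<tau> @ w \<and> w @ v = \<beta> \<or> u @ w = \<tau> \<and> v = w @ \<beta>"
      using e(1) by (auto simp: append_eq_append_conv2)
    then show ?thesis
    proof
      assume w: "u = \<tau> @ w \<and> w @ v = \<beta>"
      then have "\<tau> \<prec> w" using e(3) by (auto simp: prec_def)
      then show ?thesis using u w e(4) by (auto simp: indecomposable_def)
    next
      assume w: "u @ w = \<tau> \<and> v = w @ \<beta>"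
      then have "u \<prec> w" using uv by (auto simp: prec_def)
      then show ?thesis using ind[of u w] u w by (auto simp: indecomposable_def)
    qed
  next
    case False
    obtain w where w: "u = \<alpha> @ w \<and> w @ v = \<tau> @ \<beta> \<or> u @ w = \<alpha> \<and> v = w @ \<tau> @ \<beta>"
      using e(1) by (auto simp: append_eq_append_conv2)
    then show ?thesis
    proof
      assume w: "u = \<alpha> @ w \<and> w @ v = \<tau> @ \<beta>"
      \<comment> \<open>Transitivity of \<prec> may fail across an empty word, so the nonempty
        \<tau> is used.\<close>
      have "\<alpha> \<prec> \<tau> @ \<beta>"
        using e by (cases \<tau>) (fastforce simp: prec_def)+
      then have "\<alpha> \<prec> w @ v" using w by simp
      then have "\<alpha> \<prec> w" by (simp add: prec_def)
      then have "w = []" using u w False unfolding indecomposable_def by blast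
      then have "u = \<alpha>" "v = [] @ \<tau> @ \<beta>" using w by auto
      moreover have "[] \<prec> \<tau>" by (simp add: prec_def)
      ultimately show ?thesis using e(3,4) ind unfolding component_def by blast
    next
      assume w: "u @ w = \<alpha> \<and> v = w @ \<tau> @ \<beta>"
      then have "w \<prec> \<tau>" using e(2) by (auto simp: prec_def)
      then show ?thesis using w e(3,4) ind unfolding component_def by blast
    qed
  qed
next
  assume "\<tau> = u \<or> component v \<tau>"
  then show "component (u @ v) \<tau>"
  proof
    assume "\<tau> = u"
    moreover have "[] \<prec> u" by (simp add: prec_def)
    ultimately show ?thesis
      using u uv unfolding component_def indecomposable_def by (metis append_Nil)
  next
    assume c: "component v \<tau>"
    then obtain \<alpha> \<beta> where e: "v = \<alpha> @ \<tau> @ \<beta>" "\<alpha> \<prec> \<tau>" "\<tau> \<prec> \<beta>"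
      by (auto simp: component_def)
    then have "u @ \<alpha> \<prec> \<tau>" "u @ v = (u @ \<alpha>) @ \<tau> @ \<beta>" using uv by (auto simp: prec_def)
    then show ?thesis using c e(3) unfolding component_def by blast
  qed
qed

lemma component_subset: "component v \<tau> \<Longrightarrow> set \<tau> \<subseteq> set v \<and> \<tau> \<noteq> []"
  by (auto simp: component_def)

lemma finite_components: "finite {\<tau>. component v \<tau>}"
proof -
  have "{\<tau>. component v \<tau>} \<subseteq> {\<tau>. set \<tau> \<subseteq> set v \<and> length \<tau> \<le> length v}"
    by (auto simp: component_def)
  then show ?thesis using finite_lists_length_le[of "set v"] finite_subset by blast
qed

lemma comp_stat_Nil: "comp_stat [] = 0"
  by (simp add: comp_stat_def component_def)

lemma comp_stat_append:
  assumes "indecomposable u" "u \<prec> v"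
  shows "comp_stat (u @ v) = Suc (comp_stat v)"
proof -
  have "{\<tau>. component (u @ v) \<tau>} = insert u {\<tau>. component v \<tau>}"
    using component_append[OF assms] by auto
  moreover have "\<not> component v u"
    using assms component_subset[of v u] by (cases u) (auto simp: prec_def indecomposable_def)
  ultimately show ?thesis using finite_components[of v] by (simp add: comp_stat_def)
qed

lemma comp_stat_indecomposable: "indecomposable u \<Longrightarrow> comp_stat u = 1"
  using comp_stat_append[of u "[]"] by (simp add: prec_def comp_stat_Nil)

lemma component_map_add:
  "component (map (\<lambda>x. x + c) v) \<tau> \<longleftrightarrow> (\<exists>\<tau>'. \<tau> = map (\<lambda>x. x + c) \<tau>' \<and> component v \<tau>')"
proof -
  let ?h = "map (\<lambda>x :: nat. x + c)"
  have h: "?h a \<prec> ?h b \<longleftrightarrow> a \<prec> b" for a b by (simp add: prec_def)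
  have ind: "(\<forall>\<gamma> \<delta>. ?h \<tau>' = \<gamma> @ \<delta> \<and> \<gamma> \<prec> \<delta> \<longrightarrow> \<gamma> = [] \<or> \<delta> = []) \<longleftrightarrow>
      (\<forall>\<gamma> \<delta>. \<tau>' = \<gamma> @ \<delta> \<and> \<gamma> \<prec> \<delta> \<longrightarrow> \<gamma> = [] \<or> \<delta> = [])" for \<tau>'
    using h unfolding map_eq_append_conv by (metis map_append map_is_Nil_conv)
  show ?thesis
  proof
    assume c: "component (?h v) \<tau>"
    then obtain \<alpha> \<beta> where e: "?h v = \<alpha> @ \<tau> @ \<beta>" "\<alpha> \<prec> \<tau>" "\<tau> \<prec> \<beta>"
      by (auto simp: component_def)
    then obtain a t b where a: "v = a @ t @ b" "\<alpha> = ?h a" "\<tau> = ?h t" "\<beta> = ?h b"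
      by (auto simp: map_eq_append_conv append_eq_map_conv)
    have "\<forall>\<gamma> \<delta>. ?h t = \<gamma> @ \<delta> \<and> \<gamma> \<prec> \<delta> \<longrightarrow> \<gamma> = [] \<or> \<delta> = []" "t \<noteq> []"
      using c a(3) by (simp_all add: component_def)
    then have "\<forall>\<gamma> \<delta>. t = \<gamma> @ \<delta> \<and> \<gamma> \<prec> \<delta> \<longrightarrow> \<gamma> = [] \<or> \<delta> = []" using ind by simp
    moreover have "a \<prec> t" "t \<prec> b" using e a h by simp_all
    ultimately have "component v t" using a(1) \<open>t \<noteq> []\<close> unfolding component_def by blast
    then show "\<exists>\<tau>'. \<tau> = ?h \<tau>' \<and> component v \<tau>'" using a by blast
  next
    assume "\<exists>\<tau>'. \<tau> = ?h \<tau>' \<and> component v \<tau>'"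
    then obtain t where t: "\<tau> = ?h t" "component v t" by blast
    then obtain \<alpha> \<beta> where e: "v = \<alpha> @ t @ \<beta>" "\<alpha> \<prec> t" "t \<prec> \<beta>"
      by (auto simp: component_def)
    have "\<forall>\<gamma> \<delta>. t = \<gamma> @ \<delta> \<and> \<gamma> \<prec> \<delta> \<longrightarrow> \<gamma> = [] \<or> \<delta> = []" "\<tau> \<noteq> []"
      using t by (simp_all add: component_def)
    then have "\<forall>\<gamma> \<delta>. \<tau> = \<gamma> @ \<delta> \<and> \<gamma> \<prec> \<delta> \<longrightarrow> \<gamma> = [] \<or> \<delta> = []" using ind t(1) by simp
    moreover have "?h v = ?h \<alpha> @ \<tau> @ ?h \<beta>" "?h \<alpha> \<prec> \<tau>" "\<tau> \<prec> ?h \<beta>"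
      using t e h by simp_all
    ultimately show "component (?h v) \<tau>" using \<open>\<tau> \<noteq> []\<close> unfolding component_def by blast
  qed
qed

lemma comp_stat_map_add: "comp_stat (map (\<lambda>x. x + c) v) = comp_stat v"
proof -
  have "{\<tau>. component (map (\<lambda>x. x + c) v) \<tau>} = map (\<lambda>x. x + c) ` {\<tau>. component v \<tau>}"
    using component_map_add by auto
  moreover have "inj_on (map (\<lambda>x :: nat. x + c)) A" for A
    by (rule inj_on_subset[OF inj_mapI]) (auto simp: inj_def)
  ultimately show ?thesis unfolding comp_stat_def by (simp add: card_image)
qed

section \<open>Inserting a new largest letter\<close>

lemma avoiders_length: "\<pi> \<in> avoiders n \<Longrightarrow> length \<pi> = n"
  unfolding avoiders_iff using distinct_card by fastforce

lemma sorted_list_of_set_nth_card: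
  fixes S :: "nat set"
  assumes "finite S" "k < card S"
  shows "card {q \<in> S. q < sorted_list_of_set S ! k} = k"
proof -
  let ?l = "sorted_list_of_set S"
  have l: "sorted_wrt (<) ?l" "set ?l = S" "length ?l = card S" using assms by auto
  then have "?l ! j < ?l ! k \<longleftrightarrow> j < k" if "j < card S" for j
    using sorted_wrt_nth_less[of "(<)" ?l j k] sorted_wrt_nth_less[of "(<)" ?l k j] that assms
    by (metis nat_neq_iff order.asym)
  then have "card {j. j < length ?l \<and> ?l ! j < ?l ! k} = card {j. j < k}"
    using l assms(2) by (intro arg_cong[of _ _ card]) auto
  then show ?thesis using card_positions[of ?l "\<lambda>y. y < ?l ! k"] l by simp
qed

lemma finite_lmax_positions: "finite (lmax_positions w)"
  unfolding lmax_positions_def by simp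

lemma lmax_positions_less:
  assumes "p \<le> length w"
  shows "{q \<in> lmax_positions w. q < p} = lmax_positions (take p w)"
  using assms by (auto simp: lmax_positions_def)

lemma length_in_lmax_positions:
  "t \<noteq> [] \<Longrightarrow> length s \<in> lmax_positions (s @ t) \<longleftrightarrow> (\<forall>x\<in>set s. x < hd t)"
  by (auto simp: lmax_positions_def nth_append hd_conv_nth all_set_conv_all_nth)

text \<open>The i-th left-to-right maximum has i - 1 others before it. This trades the index i for a
  factorization of the word.\<close>

lemma lmax_split:
  assumes "1 \<le> i" "i \<le> lmax \<pi>"
  obtains s t where "\<pi> = s @ t" "t \<noteq> []" "\<forall>x\<in>set s. x < hd t" "i = Suc (lmax s)"
proof -
  let ?l = "sorted_list_of_set (lmax_positions \<pi>)"
  define p where "p = ?l ! (i - 1)"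
  have i: "i - 1 < card (lmax_positions \<pi>)" using assms by (simp add: lmax_def)
  then have "p \<in> set ?l" unfolding p_def by (intro nth_mem) (simp add: finite_lmax_positions)
  then have p: "p \<in> lmax_positions \<pi>" using finite_lmax_positions by simp
  then have pl: "p < length \<pi>" by (simp add: lmax_positions_def)
  have "lmax (take p \<pi>) = i - 1"
    using sorted_list_of_set_nth_card[OF finite_lmax_positions i] lmax_positions_less[of p \<pi>] pl
    by (simp add: p_def lmax_def)
  moreover have "\<forall>x\<in>set (take p \<pi>). x < hd (drop p \<pi>)"
    using length_in_lmax_positions[of "drop p \<pi>" "take p \<pi>"] p pl by simp
  ultimately show thesis using that[of "take p \<pi>" "drop p \<pi>"] pl assms(1) by simp
qed

lemma insert_max_split:
  assumes "t \<noteq> []" "\<forall>x\<in>set s. x < hd t"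
  shows "insert_max (Suc (lmax s)) (s @ t) = s @ Suc (length (s @ t)) # t"
proof -
  let ?L = "lmax_positions (s @ t)"
  let ?l = "sorted_list_of_set ?L"
  have s: "length s \<in> ?L" using length_in_lmax_positions assms by blast
  then obtain k where k: "k < card ?L" "?l ! k = length s"
    using finite_lmax_positions by (metis in_set_conv_nth length_sorted_list_of_set set_sorted_list_of_set)
  then have "k = lmax s"
    using sorted_list_of_set_nth_card[OF finite_lmax_positions k(1)] lmax_positions_less[of "length s" "s @ t"]
    by (simp add: lmax_def)
  then show ?thesis using k(2) assms(1) by (simp add: insert_max_def)
qed

lemma insert_max_1: "insert_max 1 \<pi> = Suc (length \<pi>) # \<pi>"
  using insert_max_split[of \<pi> "[]"] by (cases "\<pi> = []") (auto simp: insert_max_def lmax_def lmax_positions_def)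

lemma lmax_pos: "w \<noteq> [] \<Longrightarrow> 0 < lmax w"
proof -
  assume "w \<noteq> []"
  then have "0 \<in> lmax_positions w" by (simp add: lmax_positions_def)
  then show ?thesis unfolding lmax_def using finite_lmax_positions card_gt_0_iff by blast
qed

lemma Suc_lmax_le:
  assumes "t \<noteq> []" "\<forall>x\<in>set s. x < hd t"
  shows "Suc (lmax s) \<le> lmax (s @ t)"
proof -
  have "0 \<in> {j. j < length t \<and> (\<forall>x\<in>set s. x < t ! j) \<and> (\<forall>i<j. t ! i < t ! j)}"
    using assms by (simp add: hd_conv_nth)
  then have "0 < card {j. j < length t \<and> (\<forall>x\<in>set s. x < t ! j) \<and> (\<forall>i<j. t ! i < t ! j)}"
    by (subst card_gt_0_iff) auto
  then show ?thesis unfolding lmax_append by simp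
qed

lemma max_Cons_stats:
  assumes m: "\<forall>y\<in>set w. y < m"
  shows "asc (m # w) = asc w" "lmax (m # w) = 1" "lmin (m # w) = Suc (lmin w)"
    "rmax (m # w) = Suc (rmax w)" "ldr (m # w) = Suc (ldr w)" "lir (m # w) = 1"
proof -
  have nth: "w ! j < m" if "j < length w" for j using m that by simp
  show "asc (m # w) = asc w" using m by (cases w) (auto simp: asc_Cons)
  show "lmax (m # w) = 1"
  proof -
    have "lmax_positions [m] = {0}" by (auto simp: lmax_positions_def)
    then have "lmax [m] = 1" by (simp add: lmax_def)
    moreover have "{j. j < length w \<and> (\<forall>x\<in>set [m]. x < w ! j) \<and> (\<forall>i<j. w ! i < w ! j)} = {}"
      using nth by (auto dest: order.asym)
    ultimately show ?thesis using lmax_append[of "[m]" w] by simp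
  qed
  show "lmin (m # w) = Suc (lmin w)"
  proof -
    have "{j. j < length [m] \<and> (\<forall>i<j. [m] ! j < [m] ! i)} = {0}" by auto
    then have "lmin [m] = 1" unfolding lmin_def by simp
    moreover have "{j. j < length w \<and> (\<forall>x\<in>set [m]. w ! j < x) \<and> (\<forall>i<j. w ! j < w ! i)} =
        {j. j < length w \<and> (\<forall>i<j. w ! j < w ! i)}" using nth by auto
    ultimately show ?thesis using lmin_append[of "[m]" w] by (simp add: lmin_def)
  qed
  show "rmax (m # w) = Suc (rmax w)"
  proof -
    have "{j. j < length [m] \<and> (\<forall>y\<in>set w. y < [m] ! j) \<and>
        (\<forall>k. j < k \<and> k < length [m] \<longrightarrow> [m] ! k < [m] ! j)} = {0}" using m by auto
    then show ?thesis using rmax_append[of "[m]" w] by simp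
  qed
  show "ldr (m # w) = Suc (ldr w)"
    unfolding ldr_run_len using m by (cases w) (auto simp: run_len_Cons[OF transp_nat(2)] run_len_Nil)
  show "lir (m # w) = 1"
    unfolding lir_run_len using m by (cases w) (auto simp: run_len_Cons[OF transp_nat(1)])
qed

lemma indecomposable_max_Cons:
  assumes "\<forall>y\<in>set w. y < m"
  shows "indecomposable (m # w)"
  unfolding indecomposable_def
proof (intro conjI allI impI)
  fix \<gamma> \<delta> assume h: "m # w = \<gamma> @ \<delta> \<and> \<gamma> \<prec> \<delta>"
  show "\<gamma> = [] \<or> \<delta> = []"
  proof (rule ccontr)
    assume n: "\<not> (\<gamma> = [] \<or> \<delta> = [])"
    then obtain g d \<gamma>' \<delta>' where "\<gamma> = g # \<gamma>'" "\<delta> = d # \<delta>'" by (meson neq_Nil_conv)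
    then show False using h assms by (auto simp: prec_def)
  qed
qed simp

lemma insert_max_avoiders:
  assumes d: "distinct (s @ t)" "set (s @ t) = {1..m}" and av: "avoiding (s @ Suc m # t)"
  shows "s @ Suc m # t \<in> avoiders (Suc m)"
proof -
  have "Suc m \<notin> set (s @ t)" unfolding d(2) by simp
  moreover have "set (s @ Suc m # t) = {1..Suc m}" using d(2) by (auto simp: atLeastAtMostSuc_conv)
  ultimately show ?thesis unfolding avoiders_iff using d(1) av by auto
qed

text \<open>The case i > 1 of \<open>phi\<close>: the new letter goes in front of
  \<open>hd t\<close>, which is a left-to-right maximum but not the first one.\<close>

locale inner_max =
  fixes s t :: "nat list" and m :: nat
  assumes avoider: "s @ t \<in> avoiders m" and s: "s \<noteq> []" and t: "t \<noteq> []"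
    and less_hd: "\<forall>x\<in>set s. x < hd t"
begin

lemma distinct: "distinct (s @ t)" and set: "set (s @ t) = {1..<Suc m}"
  and avoiding: "avoiding (s @ t)"
  using avoider unfolding avoiders_iff by auto

lemma compatible: "compatible s t"
  using avoiding_append_compatible avoiding distinct t less_hd by blast

lemma less_nth: "i < length s \<Longrightarrow> s ! i < hd t"
  using less_hd by simp

lemma psi_image:
  obtains s' t' where "psi (s @ Suc m # t) = s' @ Suc m # t'" "shifted s t s' t'"
    "distinct (s' @ t')" "set (s' @ t') = {1..<Suc m}"
  using psi_shifted[OF distinct set compatible, of "hd t"] t less_hd by auto

text \<open>The results in this context concern any image under \<open>shifted\<close> with letters
  {1..<Suc m}, so \<open>psi\<close> itself no longer appears.\<close>

context
  fixes s' t'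
  assumes sh: "shifted s t s' t'" and d': "distinct (s' @ t')" and set': "set (s' @ t') = {1..<Suc m}"
begin

lemma iso: "order_iso s s'" "order_iso t t'"
  using sh by (auto simp: shifted_def)

lemma nonempty: "s' \<noteq> []" "t' \<noteq> []"
  using s t iso by (auto simp: order_iso_def)

lemma bound: "x \<in> set s' \<Longrightarrow> x < Suc m" "y \<in> set t' \<Longrightarrow> y < Suc m"
  using set' by auto

lemma image_avoider: "s' @ Suc m # t' \<in> avoiders (Suc m)"
proof (rule insert_max_avoiders)
  show "set (s' @ t') = {1..m}" using set' by auto
  have "avoiding s'" "avoiding t'"
    using avoiding_order_iso iso avoiding_appendD avoiding by blast+
  moreover have "compatible s' t'"
    using shifted_compatible[OF sh distinct d' compatible t] .
  moreover have "distinct (s' @ Suc m # t')" using d' bound by auto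
  ultimately show "avoiding (s' @ Suc m # t')"
    using avoiding_split_iff[of s' "Suc m" t'] bound by auto
qed (fact d')

text \<open>A letter z of t' lies below all of s'. The first part of a splitting contains
  \<open>hd s'\<close>, so z cannot be in the second part; the first part then contains
  \<open>Suc m\<close>, which exceeds everything after it.\<close>

lemma image_indecomposable: "indecomposable (s' @ Suc m # t')"
  unfolding indecomposable_def
proof (intro conjI allI impI)
  obtain z where z: "z \<in> set t'" "\<forall>x\<in>set s'. z < x"
    using shifted_min[OF sh _ t] distinct by auto
  fix \<gamma> \<delta> assume h: "s' @ Suc m # t' = \<gamma> @ \<delta> \<and> \<gamma> \<prec> \<delta>"
  show "\<gamma> = [] \<or> \<delta> = []"
  proof (rule ccontr)
    assume n: "\<not> (\<gamma> = [] \<or> \<delta> = [])"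
    have "hd (s' @ Suc m # t') = hd (\<gamma> @ \<delta>)" using h by simp
    then have hd: "hd s' = hd \<gamma>" using n nonempty by simp
    have g: "hd \<gamma> \<in> set \<gamma>" "z < hd \<gamma>" using n z nonempty hd by auto (metis hd hd_in_set)
    then have z': "z \<notin> set \<delta>" using h by (auto simp: prec_def dest: order.asym)
    obtain w where "s' = \<gamma> @ w \<and> w @ Suc m # t' = \<delta> \<or> s' @ w = \<gamma> \<and> Suc m # t' = w @ \<delta>"
      using h by (auto simp: append_eq_append_conv2)
    then have "s' @ w = \<gamma>" "Suc m # t' = w @ \<delta>" using z z' by auto
    moreover then have "w \<noteq> []" using z z' by auto
    ultimately have "Suc m \<in> set \<gamma>" "set \<delta> \<subseteq> set t'" by (auto simp: Cons_eq_append_conv)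
    moreover have "last \<delta> \<in> set \<delta>" using n by simp
    ultimately show False using h bound(2)[of "last \<delta>"] by (auto simp: prec_def dest: order.asym)
  qed
qed simp

text \<open>The ascent from \<open>last s\<close> to \<open>hd t\<close> becomes an ascent to
  \<open>Suc m\<close>, and the step from there into t' is a descent.\<close>

lemma image_asc: "asc (s' @ Suc m # t') = asc (s @ t)"
proof -
  have "last s' \<in> set s'" "last s \<in> set s" using nonempty s by auto
  then have "last s' < Suc m" "last s < hd t" using bound less_hd by auto
  then have "asc (s' @ Suc m # t') = asc s' + asc (Suc m # t') + 1" "asc (s @ t) = asc s + asc t + 1"
    using asc_append nonempty s t by simp_all
  moreover have "asc (Suc m # t') = asc t'" using max_Cons_stats(1) bound by blast
  ultimately show ?thesis using order_iso_asc iso by simp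
qed

lemma image_lmax: "lmax (s' @ Suc m # t') = Suc (lmax s)"
proof -
  let ?w = "Suc m # t'"
  have "?w ! 0 = Suc m" by simp
  have "j = 0" if "j < length ?w" "\<forall>i<j. ?w ! i < ?w ! j" for j
  proof (rule ccontr)
    assume "j \<noteq> 0"
    then obtain k where k: "j = Suc k" by (cases j) auto
    have "t' ! k < Suc m" using that(1) k bound(2) by simp
    then show False using that(2)[rule_format, of 0] k by simp
  qed
  then have "{j. j < length ?w \<and> (\<forall>x\<in>set s'. x < ?w ! j) \<and> (\<forall>i<j. ?w ! i < ?w ! j)} = {0}"
    using bound(1) by force
  then show ?thesis unfolding lmax_append using order_iso_lmax[OF iso(1)] by simp
qed

lemma image_rmax: "rmax (s' @ Suc m # t') = Suc (rmax (s @ t))"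
proof -
  have "\<not> (\<forall>y\<in>set t. y < s ! j)" if "j < length s" for j
    using less_nth[OF that] t by (intro notI) (auto dest!: bspec[of _ _ "hd t"])
  then have "{j. j < length s \<and> (\<forall>y\<in>set t. y < s ! j) \<and>
      (\<forall>k. j < k \<and> k < length s \<longrightarrow> s ! k < s ! j)} = {}"
    by blast
  then have "rmax (s @ t) = rmax t" unfolding rmax_append by simp
  moreover have "{j. j < length s' \<and> (\<forall>y\<in>set (Suc m # t'). y < s' ! j) \<and>
      (\<forall>k. j < k \<and> k < length s' \<longrightarrow> s' ! k < s' ! j)} = {}"
  proof -
    have "\<not> Suc m < s' ! j" if "j < length s'" for j
      using bound(1)[OF nth_mem[OF that]] by simp
    then show ?thesis by auto
  qed
  then have "rmax (s' @ Suc m # t') = rmax (Suc m # t')" unfolding rmax_append by simp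
  moreover have "rmax (Suc m # t') = Suc (rmax t')" using max_Cons_stats(4) bound by blast
  ultimately show ?thesis using order_iso_rmax[OF iso(2)] by simp
qed

lemma image_ldr: "ldr (s' @ Suc m # t') = ldr (s @ t)"
proof -
  have *: "ldr (u @ v) = ldr u" if "u \<noteq> []" "last u < hd v" for u v
    using that run_len_append[OF transp_nat(2), of u v] run_len_sorted[OF transp_nat(2), of u]
    by (auto simp: ldr_run_len dest: order.asym)
  have "last s' \<in> set s'" "last s \<in> set s" using nonempty s by auto
  then have "last s' < Suc m" "last s < hd t" using bound less_hd by auto
  then show ?thesis
    using *[of s' "Suc m # t'"] *[of s t] nonempty s order_iso_ldr[OF iso(1)] by simp
qed

text \<open>If s is not increasing, both runs end inside s and have length at most
  \<open>lmax s\<close>. If s is increasing, then \<open>lmax s\<close> = \<open>length s\<close>,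
  and the run of the image stops at \<open>Suc m\<close>.\<close>

lemma image_lir: "lir (s' @ Suc m # t') = min (Suc (lmax s)) (lir (s @ t))"
proof -
  have "last s' \<in> set s'" "last s \<in> set s" using nonempty s by auto
  then have l: "last s' < Suc m" "last s < hd t" using bound less_hd by auto
  have le: "lir s \<le> lmax s" by (rule lir_le_lmax)
  have ll: "lmax s \<le> length s"
  proof -
    have "lmax_positions s \<subseteq> {..<length s}" by (auto simp: lmax_positions_def)
    then have "card (lmax_positions s) \<le> card {..<length s}" by (intro card_mono) auto
    then show ?thesis by (simp add: lmax_def)
  qed
  have 1: "lir (s' @ Suc m # t') = (if sorted_wrt (<) s then Suc (length s) else lir s)"
    using run_len_append[OF transp_nat(1) nonempty(1), of "Suc m # t'"] l(1) max_Cons_stats(6)[of t' "Suc m"]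
      bound(2) order_iso_sorted_less[OF iso(1)] order_iso_lir[OF iso(1)] order_iso_length[OF iso(1)]
    by (auto simp: lir_run_len)
  have 2: "lir (s @ t) = (if sorted_wrt (<) s then length s + lir t else lir s)"
    using run_len_append[OF transp_nat(1) s, of t] l(2) t by (auto simp: lir_run_len)
  have 3: "0 < lir t" using run_len_pos[OF transp_nat(1) t] by (simp add: lir_run_len)
  show ?thesis
  proof (cases "sorted_wrt (<) s")
    case True
    then have "lir s = length s" using run_len_sorted[OF transp_nat(1)] by (simp add: lir_run_len)
    then show ?thesis using 1 2 3 le ll True by simp
  next
    case False
    then show ?thesis using 1 2 le by simp
  qed
qed

text \<open>Let M be the positions of the left-to-right minima of t and K the cut of the least
  letter of s. Those with j > K remain left-to-right minima in \<open>s @ t\<close>, those with j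
  \<ge> K in the image, so the image gains just K. The letter \<open>Suc m\<close> contributes
  nothing because s' precedes it.\<close>

lemma image_lmin: "lmin (s' @ Suc m # t') = Suc (lmin (s @ t))"
proof -
  define M where "M = {j. j < length t \<and> (\<forall>i<j. t ! j < t ! i)}"
  obtain i0 where i0: "i0 < length s" "s ! i0 = Min (set s)"
    using s by (metis Min_in List.finite_set in_set_conv_nth set_empty)
  have min: "s ! i0 \<le> s ! i" if "i < length s" for i using that by (simp add: i0(2))
  have min': "s' ! i0 \<le> s' ! i" if "i < length s'" for i
    using min[of i] that order_iso_nth[OF iso(1), of i i0] order_iso_length[OF iso(1)] i0(1)
    by (simp add: not_less[symmetric])
  have lt: "length t' = length t" and ls: "length s' = length s" using iso by (auto simp: order_iso_def)
  obtain K where K: "cut_at (s ! i0) t K" "cut_before (s' ! i0) t' K"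
    using shiftedD[OF sh i0(1)] by blast
  have KM: "K \<in> M" using K(1) by (auto simp: M_def cut_at_def)
  have lM: "t ! j < t ! K \<longleftrightarrow> K < j" "(\<forall>l<K. t ! j < t ! l) \<longleftrightarrow> K \<le> j" if "j \<in> M" for j
  proof -
    show "t ! j < t ! K \<longleftrightarrow> K < j"
      using that KM by (auto simp: M_def) (metis linorder_neqE_nat order.asym order.irrefl)
    show "(\<forall>l<K. t ! j < t ! l) \<longleftrightarrow> K \<le> j"
      using that by (auto simp: M_def) (metis not_less order.irrefl)
  qed
  have all: "(\<forall>x\<in>set s. y < x) \<longleftrightarrow> y < s ! i0" for y
    using min i0(1) by (metis in_set_conv_nth nth_mem order.strict_trans2)
  have all': "(\<forall>x\<in>set s'. y < x) \<longleftrightarrow> y < s' ! i0" for y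
    using min' i0(1) ls by (metis in_set_conv_nth nth_mem order.strict_trans2)
  have "{j. j < length t \<and> (\<forall>x\<in>set s. t ! j < x) \<and> (\<forall>i<j. t ! j < t ! i)} = {j \<in> M. K < j}"
    unfolding all using cut_at_nth[OF K(1)] lM(1) by (auto simp: M_def)
  then have 1: "lmin (s @ t) = lmin s + card {j \<in> M. K < j}" unfolding lmin_append by simp
  let ?w = "Suc m # t'"
  let ?P = "\<lambda>j. (\<forall>x\<in>set s'. ?w ! j < x) \<and> (\<forall>i<j. ?w ! j < ?w ! i)"
  have "\<not> ?P 0"
    using bound(1)[of "hd s'"] nonempty by (auto intro!: bexI[of _ "hd s'"])
  moreover have P: "?P (Suc j) \<longleftrightarrow> j \<in> M \<and> K \<le> j" if "j < length t" for j
  proof -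
    have "(\<forall>i<Suc j. t' ! j < ?w ! i) \<longleftrightarrow> (\<forall>i<j. t' ! j < t' ! i)"
      using bound(2)[of "t' ! j"] that lt by (auto simp: less_Suc_eq_0_disj nth_Cons')
    also have "\<dots> \<longleftrightarrow> j \<in> M" using order_iso_nth[OF iso(2)] that by (auto simp: M_def)
    finally show ?thesis
      using all'[of "t' ! j"] cut_before_nth[OF K(2) iso(2) that] lM(2) by auto
  qed
  have "{j. j < length t \<and> ?P (Suc j)} = {j. j < length t \<and> j \<in> M \<and> K \<le> j}"
  proof (rule Collect_cong)
    show "j < length t \<and> ?P (Suc j) \<longleftrightarrow> j < length t \<and> j \<in> M \<and> K \<le> j" for j
      using P[of j] by blast
  qed
  then have "{j. j < length t \<and> ?P (Suc j)} = insert K {j \<in> M. K < j}"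
    using KM by (auto simp: M_def)
  moreover have "card {j. j < length ?w \<and> ?P j} = card {j. j < 1 \<and> ?P j} + card {j. j < length t \<and> ?P (Suc j)}"
    using card_less_add_split[of 1 "length t" ?P] lt by simp
  moreover have "finite {j \<in> M. K < j}" by (simp add: M_def)
  moreover have "\<not> ?P j" if "j < 1" for j
  proof -
    have "j = 0" using that by simp
    show ?thesis unfolding \<open>j = 0\<close> by fact
  qed
  then have "{j. j < 1 \<and> ?P j} = {}" by blast
  ultimately have "card {j. j < length ?w \<and> ?P j} = Suc (card {j \<in> M. K < j})" by simp
  then show ?thesis
    unfolding 1 lmin_append[of s' ?w] using order_iso_lmin[OF iso(1)] by simp
qed

end

end

section \<open>The map phi\<close>

text \<open>The alternative with \<pi> = [] admits i = 1 for the empty word, which has no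
  left-to-right maximum; it is the counterpart of \<open>lam 1 bullet\<close>.\<close>

lemma phi_cases:
  assumes "\<pi> \<in> avoiders m" "1 \<le> i" "i \<le> lmax \<pi> \<or> \<pi> = [] \<and> i = 1"
  obtains "i = 1" "phi i \<pi> = Suc m # \<pi>" "\<forall>y\<in>set \<pi>. y < Suc m"
  | s t s' t' where "inner_max s t m" "\<pi> = s @ t" "i = Suc (lmax s)" "i \<noteq> 1"
    "phi i \<pi> = s' @ Suc m # t'" "shifted s t s' t'" "distinct (s' @ t')" "set (s' @ t') = {1..<Suc m}"
proof (cases "i = 1")
  case True
  then show ?thesis using that(1) assms(1) avoiders_length[OF assms(1)] insert_max_1
    by (auto simp: phi_def avoiders_iff)
next
  case False
  then obtain s t where st: "\<pi> = s @ t" "t \<noteq> []" "\<forall>x\<in>set s. x < hd t" "i = Suc (lmax s)"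
    using assms lmax_split by metis
  have "s \<noteq> []" using False st(4) by (auto simp: lmax_def lmax_positions_def)
  then have im: "inner_max s t m" using st assms(1) by unfold_locales auto
  obtain s' t' where "psi (s @ Suc m # t) = s' @ Suc m # t'" "shifted s t s' t'"
    "distinct (s' @ t')" "set (s' @ t') = {1..<Suc m}"
    using inner_max.psi_image[OF im] by blast
  moreover have "phi i \<pi> = psi (s @ Suc m # t)"
    using False insert_max_split[OF st(2,3)] avoiders_length[OF assms(1)] st by (simp add: phi_def)
  ultimately show ?thesis using that(2)[OF im st(1,4) False] by simp
qed

lemma
  assumes "\<pi> \<in> avoiders m" "1 \<le> i" "i \<le> lmax \<pi> \<or> \<pi> = [] \<and> i = 1"
  shows phi_avoiders: "phi i \<pi> \<in> avoiders (Suc m)"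
    and phi_indecomposable: "indecomposable (phi i \<pi>)"
    and phi_asc: "asc (phi i \<pi>) = asc \<pi>"
    and phi_lmax: "lmax (phi i \<pi>) = i"
    and phi_lmin: "lmin (phi i \<pi>) = Suc (lmin \<pi>)"
    and phi_rmax: "rmax (phi i \<pi>) = Suc (rmax \<pi>)"
    and phi_ldr: "ldr (phi i \<pi>) = (if i = 1 then 1 else 0) + ldr \<pi>"
    and phi_lir: "lir (phi i \<pi>) = (if \<pi> = [] then 1 else min i (lir \<pi>))"
proof -
  have "phi i \<pi> \<in> avoiders (Suc m) \<and> indecomposable (phi i \<pi>) \<and> asc (phi i \<pi>) = asc \<pi> \<and>
    lmax (phi i \<pi>) = i \<and> lmin (phi i \<pi>) = Suc (lmin \<pi>) \<and> rmax (phi i \<pi>) = Suc (rmax \<pi>) \<and>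
    ldr (phi i \<pi>) = (if i = 1 then 1 else 0) + ldr \<pi> \<and>
    lir (phi i \<pi>) = (if \<pi> = [] then 1 else min i (lir \<pi>))"
    using assms
  proof (cases rule: phi_cases)
    case 1
    have "Suc m # \<pi> \<in> avoiders (Suc m)"
      using insert_max_avoiders[of "[]" \<pi> m] assms(1) avoiding_Cons_max[OF 1(3)]
      by (simp add: avoiders_iff)
    moreover have "lir \<pi> \<noteq> 0" if "\<pi> \<noteq> []"
      using run_len_pos[OF transp_nat(1) that] by (simp add: lir_run_len)
    ultimately show ?thesis
      using 1 max_Cons_stats[OF 1(3)] indecomposable_max_Cons[OF 1(3)] by auto
  next
    case (2 s t s' t')
    interpret inner_max s t m by (fact 2(1))
    note a = 2(6-8)
    show ?thesis
      using image_avoider[OF a] image_indecomposable[OF a] image_asc[OF a] image_lmax[OF a]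
        image_lmin[OF a] image_rmax[OF a] image_ldr[OF a] image_lir[OF a] 2 s by simp
  qed
  then show "phi i \<pi> \<in> avoiders (Suc m)" "indecomposable (phi i \<pi>)" "asc (phi i \<pi>) = asc \<pi>"
    "lmax (phi i \<pi>) = i" "lmin (phi i \<pi>) = Suc (lmin \<pi>)" "rmax (phi i \<pi>) = Suc (rmax \<pi>)"
    "ldr (phi i \<pi>) = (if i = 1 then 1 else 0) + ldr \<pi>"
    "lir (phi i \<pi>) = (if \<pi> = [] then 1 else min i (lir \<pi>))"
    by blast+
qed

text \<open>The index is recovered as \<open>lmax\<close> of the image, the two halves from the
  position of \<open>Suc m\<close>, and the source word from
  \<open>shifted_injective\<close>.\<close>

lemma phi_inj:
  assumes 1: "\<pi> \<in> avoiders m" "1 \<le> i" "i \<le> lmax \<pi> \<or> \<pi> = [] \<and> i = 1"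
    and 2: "\<rho> \<in> avoiders m" "1 \<le> j" "j \<le> lmax \<rho> \<or> \<rho> = [] \<and> j = 1"
    and eq: "phi i \<pi> = phi j \<rho>"
  shows "i = j" "\<pi> = \<rho>"
proof -
  show ij: "i = j" using phi_lmax[OF 1] phi_lmax[OF 2] eq by simp
  from 1 show "\<pi> = \<rho>"
  proof (cases rule: phi_cases)
    case a: 1
    from 2 show ?thesis
      by (cases rule: phi_cases) (use a ij eq in auto)
  next
    case a: (2 s t s' t')
    from 2 show ?thesis
    proof (cases rule: phi_cases)
      case 1
      then show ?thesis using a ij by simp
    next
      case b: (2 u v u' v')
      have "Suc m \<notin> set s'" "Suc m \<notin> set u'" "Suc m \<notin> set t'" "Suc m \<notin> set v'" using a(8) b(8) by auto
      then have "s' = u'" "t' = v'"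
        using a(5) b(5) eq by (auto simp: append_eq_append_conv2 Cons_eq_append_conv append_eq_Cons_conv)
      then have "order_iso \<pi> \<rho>"
        using shifted_injective[OF a(6)] a(2,7) b(2,6) 1(1) 2(1) by (simp add: avoiders_iff)
      then show ?thesis using order_iso_eq 1(1) 2(1) by (auto simp: avoiders_iff)
    qed
  qed
qed

lemma phi_surj:
  assumes \<rho>: "\<rho> \<in> avoiders (Suc m)" and ind: "indecomposable \<rho>"
  shows "\<exists>i \<pi>. \<pi> \<in> avoiders m \<and> 1 \<le> i \<and> (i \<le> lmax \<pi> \<or> \<pi> = [] \<and> i = 1) \<and> phi i \<pi> = \<rho>"
proof -
  have r: "distinct \<rho>" "set \<rho> = {1..Suc m}" "avoiding \<rho>" using \<rho> by (auto simp: avoiders_iff)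
  have "Suc m \<in> set \<rho>" unfolding r(2) by simp
  then obtain s t where st: "\<rho> = s @ Suc m # t" by (meson split_list)
  have d: "distinct (s @ t)" using r(1) st by simp
  have set: "set (s @ t) = {1..<Suc m}"
  proof -
    have "Suc m \<notin> set (s @ t)" using r(1) unfolding st by simp
    then have "set (s @ t) = set \<rho> - {Suc m}" unfolding st by simp
    moreover have "{1..Suc m} - {Suc m} = {1..<Suc m}" by auto
    ultimately show ?thesis unfolding r(2) by (simp only:)
  qed
  have bound: "\<forall>x\<in>set (s @ t). x < Suc m" unfolding set by simp
  have av: "avoiding s" "avoiding t" "compatible s t"
    using avoiding_split_iff[of s "Suc m" t] r st bound by auto
  have len: "length (s @ t) = m" using d set distinct_card[OF d] by simp
  show ?thesis
  proof (cases "s = []")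
    case True
    have "set t = {1..m}" using True set unfolding atLeastLessThanSuc_atLeastAtMost by simp
    then have "t \<in> avoiders m" using d av(2) unfolding avoiders_iff by simp
    moreover have "phi 1 t = \<rho>" using True st len insert_max_1[of t] by (simp add: phi_def)
    moreover have "1 \<le> lmax t \<or> t = [] \<and> (1::nat) = 1" using lmax_pos[of t] by auto
    ultimately show ?thesis by blast
  next
    case s: False
    have "\<exists>z\<in>set t. \<forall>x\<in>set s. z < x"
    proof (rule ccontr)
      assume "\<not> (\<exists>z\<in>set t. \<forall>x\<in>set s. z < x)"
      then have ex: "\<exists>x\<in>set s. x < z" if "z \<in> set t" for z
        using that d by (metis disjoint_iff distinct_append nat_neq_iff)
      \<comment> \<open>The letters of s below all of t would form a prefix B of s: a later one
        would give an inversion of s separated by a letter of t. B is nonempty, as it contains the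
        least letter of s, and it splits off from the whole word.\<close>
      define low where "low x \<longleftrightarrow> (\<forall>y\<in>set t. x < y)" for x
      define B where "B = takeWhile low s"
      define C where "C = dropWhile low s"
      have s_BC: "s = B @ C" by (simp add: B_def C_def)
      have B: "\<forall>x\<in>set B. low x" by (auto simp: B_def dest: set_takeWhileD)
      have C: "\<not> low x" if x: "x \<in> set C" for x
      proof
        assume lx: "low x"
        have c: "C \<noteq> []" using x by auto
        then have c0: "C \<noteq> []" "\<not> low (hd C)" using hd_dropWhile[of low s] unfolding C_def by blast+
        obtain k where k: "k < length C" "x = C ! k" using x by (auto simp: in_set_conv_nth)
        have "k \<noteq> 0" using lx c0 k by (cases k) (auto simp: hd_conv_nth)
        obtain y where y: "y \<in> set t" "\<not> hd C < y" using c0 by (auto simp: low_def)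
        have "hd C \<in> set s" using c0 s_BC by simp
        then have "y < hd C" using y d by (metis disjoint_iff distinct_append nat_neq_iff)
        moreover have "x < y" using lx y by (simp add: low_def)
        moreover have "s ! length B = hd C" "s ! (length B + k) = x" "length B + k < length s"
          using s_BC c0 k by (simp_all add: hd_conv_nth nth_append)
        ultimately show False
          using av(3) y(1) \<open>k \<noteq> 0\<close> unfolding compatible_def unsplit_def
          by (metis less_add_same_cancel1 neq0_conv)
      qed
      have "B \<prec> C @ Suc m # t"
        unfolding prec_def
      proof (intro ballI)
        fix x y assume x: "x \<in> set B" and y: "y \<in> set (C @ Suc m # t)"
        have "x < Suc m" using x s_BC bound by auto
        moreover have "x < y" if yC: "y \<in> set C"
        proof -
          obtain z where "z \<in> set t" "\<not> y < z" using C[OF yC] by (auto simp: low_def)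
          then show ?thesis using B x by (auto simp: low_def not_less intro: order.strict_trans2)
        qed
        ultimately show "x < y" using y B x by (auto simp: low_def)
      qed
      moreover have "B \<noteq> []"
      proof -
        have "Min (set s) \<in> set s" using s by simp
        moreover have "low (Min (set s))"
          unfolding low_def using ex by (meson List.finite_set Min_le order.strict_trans1)
        ultimately show ?thesis using C s_BC by auto
      qed
      ultimately show False using ind st s_BC unfolding indecomposable_def
        by (metis append.assoc append_is_Nil_conv list.distinct(1))
    qed
    then obtain z where z: "z \<in> set t" "\<forall>x\<in>set s. z < x" by blast
    then have "\<forall>x\<in>set s. \<exists>K. cut_before x t K"
      using compatible_iff_cut_before[OF d z] av(3) by blast
    then obtain u v where uv: "shifted u v s t" "distinct (u @ v)" "set (u @ v) = {1..length (s @ t)}"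
      using shifted_surj[OF d] by blast
    have o: "order_iso u s" "order_iso v t" using uv(1) by (auto simp: shifted_def)
    have ne: "u \<noteq> []" "v \<noteq> []" using o s z by (auto simp: order_iso_def)
    have hd: "\<forall>x\<in>set u. x < hd v" using shifted_less_hd[OF uv(1,2)] by blast
    have "avoiding (u @ v)"
    proof (rule avoiding_appendI)
      show "avoiding u" "avoiding v"
        using avoiding_order_iso o order_iso_sym av by blast+
      show "compatible u v" using compatible_shifted[OF uv(1,2) d av(3) ne(2)] .
    qed (use uv ne hd in auto)
    then have im: "inner_max u v m"
      using uv len ne hd by unfold_locales (auto simp: avoiders_iff)
    then obtain s' t' where p: "psi (u @ Suc m # v) = s' @ Suc m # t'" "shifted u v s' t'"
      "distinct (s' @ t')" "set (s' @ t') = {1..<Suc m}"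
      using inner_max.psi_image by blast
    \<comment> \<open>Both are shifts of the same pair; having the same letters, they
      coincide.\<close>
    have "order_iso (s' @ t') (s @ t)"
      using shifted_functional[OF p(2) uv(1)] uv(2) p(3) d by simp
    then have "s' @ t' = s @ t" using order_iso_eq p(3,4) set by metis
    moreover have "length s' = length s"
      using p(2) o by (simp add: shifted_def order_iso_def)
    ultimately have "s' = s" "t' = t" by auto
    moreover have "lmax u \<noteq> 0" using lmax_pos[OF ne(1)] by simp
    then have "phi (Suc (lmax u)) (u @ v) = psi (u @ Suc m # v)"
      using insert_max_split[OF ne(2) hd] uv(3) len distinct_card[OF uv(2)] by (simp add: phi_def)
    ultimately have "phi (Suc (lmax u)) (u @ v) = \<rho>" using p(1) st by simp
    moreover have "u @ v \<in> avoiders m" using im by (simp add: inner_max_def)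
    moreover have "Suc (lmax u) \<le> lmax (u @ v)" using Suc_lmax_le[OF ne(2) hd] .
    ultimately show ?thesis by (metis le_add1 plus_1_eq_Suc)
  qed
qed

section \<open>Direct sums\<close>

lemma perm_oplus_avoiders:
  assumes u: "u \<in> avoiders a" and v: "v \<in> avoiders b"
  shows "perm_oplus u v \<in> avoiders (a + b)"
proof (cases "v = []")
  case True
  then show ?thesis using u avoiders_length[OF v] by (simp add: perm_oplus_def)
next
  case False
  let ?v = "map (\<lambda>x. x + a) v"
  have l: "length u = a" using avoiders_length[OF u] .
  have u': "distinct u" "set u = {1..a}" "avoiding u" and v': "distinct v" "set v = {1..b}" "avoiding v"
    using u v by (auto simp: avoiders_iff)
  have ov: "order_iso v ?v" by (rule order_iso_map) (simp add: strict_mono_on_def)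
  have set: "set ?v = {a + 1..a + b}"
    using v'(2) image_add_atLeastAtMost'[of a 1 b] by (simp add: add.commute)
  have gt: "x < y" if "x \<in> set u" "y \<in> set ?v" for x y
    using that unfolding u'(2) set by auto
  have "set u \<inter> set ?v = {}" using gt by (metis disjoint_iff order.irrefl)
  then have d: "distinct (u @ ?v)"
    using u'(1) order_iso_distinct[OF ov v'(1)] by (simp del: set_map)
  have "compatible u ?v"
    unfolding compatible_def unsplit_def
  proof (intro conjI allI ballI impI)
    show "\<not> z < u ! i" if "z \<in> set ?v" "i < j" "j < length u" for i j z
      using gt[of "u ! i" z] that by auto
    \<comment> \<open>With the full prefix both sides are false: no letter of the right word is
      below x, and none is below itself.\<close>
    show "\<exists>k. \<forall>y\<in>set ?v. y < x \<longleftrightarrow> (\<forall>z\<in>set (take k ?v). y < z)" if "x \<in> set u" for x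
      using gt[OF that] by (intro exI[of _ "length ?v"]) (auto simp del: set_map dest: order.asym)
  qed
  moreover have "avoiding ?v" using avoiding_order_iso ov v' by blast
  moreover have "\<forall>x\<in>set u. x < hd ?v" using gt False by (metis hd_in_set map_is_Nil_conv)
  ultimately have "avoiding (u @ ?v)"
    using avoiding_appendI[of u ?v] u' d False by simp
  moreover have "set (u @ ?v) = {1..a + b}"
    unfolding set_append u'(2) set by auto
  ultimately show ?thesis using d l by (simp add: avoiders_iff perm_oplus_def del: set_append distinct_append)
qed

text \<open>The letters of u form a downward closed subset of {1..n}, hence {1..length u};
  subtracting \<open>length u\<close> from v undoes the sum.\<close>

lemma avoiders_decompose:
  assumes w: "u @ v \<in> avoiders n" and uv: "u \<prec> v"
  obtains v' where "u \<in> avoiders (length u)" "v' \<in> avoiders (length v)" "perm_oplus u v' = u @ v"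
proof -
  let ?a = "length u"
  have d: "distinct (u @ v)" "set (u @ v) = {1..n}" "avoiding (u @ v)" using w by (auto simp: avoiders_iff)
  have n: "n = length u + length v" using avoiders_length[OF w] by simp
  have du: "distinct u" "distinct v" using d(1) by auto
  have su: "set u = {1..?a}"
  proof -
    have "x \<le> ?a" if x: "x \<in> set u" for x
    proof -
      have "{1..x} \<subseteq> set u"
      proof
        fix y assume y: "y \<in> {1..x}"
        have "x \<in> set (u @ v)" using x by simp
        then have "x \<le> n" unfolding d(2) by simp
        then have "y \<in> set (u @ v)" unfolding d(2) using y by simp
        then show "y \<in> set u" using uv x y by (fastforce simp: prec_def)
      qed
      then have "card {1..x} \<le> card (set u)" by (intro card_mono) auto
      then show ?thesis using distinct_card[OF du(1)] by simp
    qed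
    moreover have "1 \<le> x" if "x \<in> set u" for x
      using d(2) that by auto
    ultimately have "set u \<subseteq> {1..?a}" by auto
    then show ?thesis using distinct_card[OF du(1)] by (intro card_subset_eq) auto
  qed
  have sv: "set v = {?a + 1..n}"
  proof -
    have "set v = set (u @ v) - set u" using d(1) by auto
    moreover have "{1..n} - {1..?a} = {?a + 1..n}" by auto
    ultimately show ?thesis unfolding d(2) su by (simp only:)
  qed
  define v' where "v' = map (\<lambda>x. x - ?a) v"
  have v: "v = map (\<lambda>x. x + ?a) v'"
    using sv by (auto simp: v'_def o_def intro!: map_idI[symmetric])
  have o: "order_iso v v'"
    unfolding v'_def using sv by (intro order_iso_map) (auto simp: strict_mono_on_def)
  have "set v' = {1..length v}"
  proof -
    have "set v' = (\<lambda>x. x - ?a) ` {?a + 1..?a + length v}" using sv n by (simp add: v'_def)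
    also have "\<dots> = {1..length v}"
      by (auto simp: image_iff intro!: bexI[of _ "_ + ?a"])
    finally show ?thesis .
  qed
  moreover have "avoiding u" "avoiding v'"
    using avoiding_appendD d(3) avoiding_order_iso[OF o] by blast+
  ultimately have "u \<in> avoiders ?a" "v' \<in> avoiders (length v)"
    using du su order_iso_distinct[OF o] by (simp_all add: avoiders_iff)
  then show thesis using that[of v'] v by (simp add: perm_oplus_def)
qed

text \<open>One of u, u' is a prefix of the other, and a proper prefix would split the longer
  one.\<close>

lemma indecomposable_append_inject:
  assumes "indecomposable u" "indecomposable u'" "u \<prec> v" "u' \<prec> v'" "u @ v = u' @ v'"
  shows "u = u'"
proof -
  have *: "w = []" if "indecomposable x" "x = y @ w" "w @ z = z'" "y \<prec> z'" "y \<noteq> []" for w x y z z'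
  proof -
    have "y \<prec> w" using that by (auto simp: prec_def)
    then show ?thesis using that unfolding indecomposable_def by blast
  qed
  obtain w where "u = u' @ w \<and> w @ v = v' \<or> u @ w = u' \<and> v = w @ v'"
    using assms(5) by (auto simp: append_eq_append_conv2)
  moreover have "u \<noteq> []" "u' \<noteq> []" using assms(1,2) unfolding indecomposable_def by blast+
  ultimately show ?thesis
    using *[of u u' w v v'] *[of u' u w v' v] assms(1-4) by (metis append_Nil2)
qed

text \<open>Summands are split off one component at a time, as \<open>f_map\<close> does with the
  first root subtree.\<close>

locale direct_sum =
  fixes u v :: "nat list" and a b :: nat
  assumes u: "u \<in> avoiders a" and v: "v \<in> avoiders b"
    and ind: "indecomposable u" and v_ne: "v \<noteq> []"
begin

abbreviation "v' \<equiv> map (\<lambda>x. x + length u) v"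

lemma oplus: "perm_oplus u v = u @ v'"
  by (simp add: perm_oplus_def)

lemma less: "x \<in> set u \<Longrightarrow> y \<in> set v' \<Longrightarrow> x < y"
  using u v avoiders_length[OF u] unfolding avoiders_iff by auto

lemma prec: "u \<prec> v'"
  using less by (simp add: prec_def)

lemma iso: "order_iso v v'"
  by (rule order_iso_map) (simp add: strict_mono_on_def)

lemma u_ne: "u \<noteq> []"
  using ind by (simp add: indecomposable_def)

lemma last_hd: "last u < hd v'"
  using less[of "last u" "hd v'"] u_ne v_ne hd_in_set[of v'] last_in_set[of u] by blast

lemma nth_less: "i < length u \<Longrightarrow> j < length v' \<Longrightarrow> u ! i < v' ! j"
  using less nth_mem by blast

lemma comp_oplus: "comp_stat (perm_oplus u v) = Suc (comp_stat v)"
  unfolding oplus comp_stat_append[OF ind prec] comp_stat_map_add ..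

lemma asc_oplus: "asc (perm_oplus u v) = asc u + asc v + 1"
  unfolding oplus using asc_append[OF u_ne, of v'] v_ne last_hd order_iso_asc[OF iso] by simp

lemma lmax_oplus: "lmax (perm_oplus u v) = lmax u + lmax v"
proof -
  have "{j. j < length v' \<and> (\<forall>x\<in>set u. x < v' ! j) \<and> (\<forall>i<j. v' ! i < v' ! j)} = lmax_positions v'"
    using less by (auto simp: lmax_positions_def simp del: set_map nth_map length_map)
  then show ?thesis
    unfolding oplus lmax_append order_iso_lmax[OF iso] by (simp only: lmax_def)
qed

lemma lmin_oplus: "lmin (perm_oplus u v) = lmin u"
proof -
  have "\<not> (\<forall>x\<in>set u. v' ! j < x)" if "j < length v'" for j
    using nth_less[OF _ that, of 0] u_ne by (metis length_greater_0_conv nth_mem order.asym)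
  then have "{j. j < length v' \<and> (\<forall>x\<in>set u. v' ! j < x) \<and> (\<forall>i<j. v' ! j < v' ! i)} = {}" by blast
  then show ?thesis unfolding oplus lmin_append by (simp only: card.empty add_0_right)
qed

lemma rmax_oplus: "rmax (perm_oplus u v) = rmax v"
proof -
  have "\<not> (\<forall>y\<in>set v'. y < u ! j)" if "j < length u" for j
    using nth_less[OF that, of 0] v_ne
    by (metis length_greater_0_conv list.map_disc_iff nth_mem order.asym)
  then have "{j. j < length u \<and> (\<forall>y\<in>set v'. y < u ! j) \<and>
      (\<forall>k. j < k \<and> k < length u \<longrightarrow> u ! k < u ! j)} = {}" by blast
  then show ?thesis
    unfolding oplus rmax_append order_iso_rmax[OF iso] by (simp only: card.empty add_0_right)
qed

lemma ldr_oplus: "ldr (perm_oplus u v) = ldr u"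
  unfolding oplus
  using run_len_append[OF transp_nat(2) u_ne, of v'] run_len_sorted[OF transp_nat(2), of u] last_hd
  by (auto simp: ldr_run_len simp del: hd_map)

lemma sorted_indecomposable: "sorted_wrt (<) u \<Longrightarrow> length u = 1"
proof (rule ccontr)
  assume s: "sorted_wrt (<) u" and "length u \<noteq> 1"
  then obtain x y w where "u = [x] @ y # w"
    using u_ne by (cases u; cases "tl u") auto
  moreover from this s have "[x] \<prec> y # w" by (auto simp: prec_def)
  ultimately show False using ind unfolding indecomposable_def by blast
qed

text \<open>An increasing indecomposable word is a single letter; only then does the initial run
  continue into v.\<close>

lemma lir_oplus: "lir (perm_oplus u v) = (if length u = 1 then Suc (lir v) else lir u)"
proof -
  have "sorted_wrt (<) u" if "length u = 1" using that by (cases u) auto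
  then show ?thesis
    unfolding oplus order_iso_lir[OF iso]
    using run_len_append[OF transp_nat(1) u_ne, of v'] last_hd v_ne sorted_indecomposable
    by (auto simp: lir_run_len simp del: hd_map)
qed

end

section \<open>Trees\<close>

lemma nodes_pos: "0 < nodes t"
  by (cases t) simp

lemma tree_stats_label:
  "leaves (Node a ts) = leaves (Node b ts)" "lpath (Node a ts) = lpath (Node b ts)"
  "rpath (Node a ts) = rpath (Node b ts)" "lsub (Node a ts) = lsub (Node b ts)"
  by (cases ts; simp)+

lemma beta10_children: "beta10_tree t \<Longrightarrow> t \<noteq> bullet \<Longrightarrow> children t \<noteq> []"
  by (auto simp: beta10_tree_def)

lemma beta10_label_pos:
  assumes "beta10_tree t"
  shows "1 \<le> label t"
proof (cases "t = bullet")
  case False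
  then obtain s ss where "children t = s # ss" using beta10_children assms by (meson neq_Nil_conv)
  moreover have "label t = sum_list (map label (children t))" "\<forall>s\<in>set (children t). valid_nonroot s"
    using assms False by (auto simp: beta10_tree_def)
  ultimately show ?thesis using label_pos[of s] by simp
qed (simp add: bullet_def)

lemma lam_stats:
  "sub (lam i u) = 1" "leaves (lam i u) = leaves u" "root_stat (lam i u) = i"
  "lpath (lam i u) = Suc (lpath u)" "rpath (lam i u) = Suc (rpath u)"
  "lsub (lam i u) = (if i = 1 then 1 else 0) + lsub u" "nodes (lam i u) = Suc (nodes u)"
proof -
  obtain a ts where u: "u = Node a ts" by (cases u)
  show "sub (lam i u) = 1" "leaves (lam i u) = leaves u" "root_stat (lam i u) = i"
    "lpath (lam i u) = Suc (lpath u)" "rpath (lam i u) = Suc (rpath u)"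
    "lsub (lam i u) = (if i = 1 then 1 else 0) + lsub u" "nodes (lam i u) = Suc (nodes u)"
    using tree_stats_label[of i ts a] unfolding u
    by (simp_all add: lam_def sub_def root_stat_def bullet_def del: leaves.simps(1) add: leaves.simps(1)[of i "[_]"])
qed

lemma tree_oplus_stats:
  assumes "children u \<noteq> []" "children v \<noteq> []"
  shows "sub (tree_oplus u v) = sub u + sub v" "leaves (tree_oplus u v) = leaves u + leaves v"
    "root_stat (tree_oplus u v) = label u + label v" "lpath (tree_oplus u v) = lpath u"
    "rpath (tree_oplus u v) = rpath v" "lsub (tree_oplus u v) = lsub u"
    "Suc (nodes (tree_oplus u v)) = nodes u + nodes v"
proof -
  obtain a s ss where u: "u = Node a (s # ss)"
    using assms(1) by (cases u; cases "children u") auto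
  obtain b ts where v: "v = Node b ts" "ts \<noteq> []"
    using assms(2) by (cases v) auto
  show "sub (tree_oplus u v) = sub u + sub v" "leaves (tree_oplus u v) = leaves u + leaves v"
    "root_stat (tree_oplus u v) = label u + label v" "lpath (tree_oplus u v) = lpath u"
    "rpath (tree_oplus u v) = rpath v" "lsub (tree_oplus u v) = lsub u"
    "Suc (nodes (tree_oplus u v)) = nodes u + nodes v"
    unfolding u v(1) using v(2)
    by (auto simp: tree_oplus_def sub_def root_stat_def bullet_def)
qed

section \<open>The statistic \<open>stem\<close> on \<open>lam\<close> and on sums\<close>

lemma stem_bullet: "stem bullet = 0"
  by (simp add: stem.simps bullet_def)

lemma stem_lam_bullet: "stem (lam 1 bullet) = 1"
  by (simp add: stem.simps lam_def bullet_def)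

lemma stem_pos: "children t \<noteq> [] \<Longrightarrow> 0 < stem t"
  by (subst stem.simps) simp

text \<open>Peeling \<open>lam i u\<close>, alone or as first summand, peels \<open>u\<close> and lowers \<open>i\<close> until
  \<open>i = 1\<close> blocks.\<close>

lemma stem_lam_step:
  assumes u: "beta10_tree u" "u \<noteq> bullet" and i: "1 < i" "i \<le> label u" and nb: "\<not> blocked u"
  shows "stem u = Suc (stem (peel u))" "\<not> blocked (lam i u)" "peel (lam i u) = lam (i - 1) (peel u)"
    "beta10_tree (peel u)" "peel u \<noteq> bullet" "i - 1 \<le> label (peel u)"
proof -
  obtain a s ss where t: "u = Node a (s # ss)"
    using beta10_children[OF u] by (cases u; cases "children u") auto
  show "stem u = Suc (stem (peel u))" using nb t by (subst stem.simps) simp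
  show "\<not> blocked (lam i u)" using nb t i by (simp add: lam_def)
  show "peel (lam i u) = lam (i - 1) (peel u)" using t by (simp add: lam_def)
  show "beta10_tree (peel u)" "peel u \<noteq> bullet" using peel_beta10_tree u nb by blast+
  show "i - 1 \<le> label (peel u)" using t i by simp
qed

text \<open>If u is blocked by its root, then label u = 1 forces i = 1; otherwise the blocking node
  is kept.\<close>

lemma blocked_lam:
  assumes "beta10_tree u" "u \<noteq> bullet" "1 \<le> i" "i \<le> label u" "blocked u"
  shows "blocked (lam i u)"
proof -
  obtain a s ss where t: "u = Node a (s # ss)"
    using beta10_children assms by (cases u; cases "children u") auto
  then show ?thesis using assms by (auto simp: lam_def)
qed

lemma stem_lam:
  assumes "beta10_tree u" "u \<noteq> bullet" "1 \<le> i" "i \<le> label u"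
  shows "stem (lam i u) = min i (stem u)"
  using assms
proof (induction i arbitrary: u)
  case (Suc k)
  have c: "children (lam i u) \<noteq> []" for i by (simp add: lam_def)
  have ne: "children u \<noteq> []" using beta10_children Suc.prems by blast
  show ?case
  \<comment> \<open>In the first case both sides equal 1, either through i = 1 or through
    \<open>stem u\<close> = 1.\<close>
  proof (cases "k = 0 \<or> blocked u")
    case True
    then have "blocked (lam (Suc k) u)"
      using blocked_lam Suc.prems by (auto simp: lam_def)
    then have "stem (lam (Suc k) u) = 1" using c by (subst stem.simps) simp
    moreover have "stem u = 1" if "blocked u" using that ne by (subst stem.simps) simp
    ultimately show ?thesis using True stem_pos[OF ne] by auto
  next
    case False
    then have step: "1 < Suc k" "\<not> blocked u" by auto
    note st = stem_lam_step[OF Suc.prems(1,2) step(1) Suc.prems(4) step(2)]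
    have "stem (lam (Suc k) u) = Suc (stem (peel (lam (Suc k) u)))"
      using st(2) c by (subst stem.simps) simp
    also have "\<dots> = Suc (min k (stem (peel u)))" using st Suc.IH[of "peel u"] False by simp
    finally show ?thesis using st(1) by simp
  qed
qed simp

text \<open>The root of the sum has label i + \<open>label v\<close> > 1 and never blocks, but its
  first child has label i and blocks as soon as \<open>lam i u\<close> is blocked by i = 1. As u is
  not \<open>bullet\<close>, peeling stops before it reaches v.\<close>

lemma stem_oplus_lam:
  assumes "beta10_tree u" "u \<noteq> bullet" "1 \<le> i" "i \<le> label u" and v: "beta10_tree v" "v \<noteq> bullet"
  shows "stem (tree_oplus (lam i u) v) = stem (lam i u)"
  using assms(1-4)
proof (induction i arbitrary: u)
  case (Suc k)
  let ?t = "\<lambda>i u. tree_oplus (lam i u) v"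
  have c: "children (lam i u) \<noteq> []" "children (?t i u) \<noteq> []" for i u
    by (simp_all add: lam_def tree_oplus_def)
  have lv: "1 \<le> label v" using beta10_label_pos v by blast
  have b: "blocked (?t (Suc k) u) \<longleftrightarrow> blocked (lam (Suc k) u)"
    using lv Suc.prems beta10_children[of u] by (cases "children u") (auto simp: lam_def tree_oplus_def)
  show ?case
  proof (cases "k = 0 \<or> blocked u")
    case True
    then have "blocked (lam (Suc k) u)"
      using blocked_lam Suc.prems by (auto simp: lam_def)
    then show ?thesis using c b by (simp add: stem.simps)
  next
    case False
    then have step: "1 < Suc k" "\<not> blocked u" by auto
    note st = stem_lam_step[OF Suc.prems(1,2) step(1) Suc.prems(4) step(2)]
    obtain a s ss where u: "u = Node a (s # ss)"
      using beta10_children[OF Suc.prems(1,2)] by (cases u; cases "children u") auto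
    have "peel (?t (Suc k) u) = ?t k (peel u)"
      using u False by (simp add: lam_def tree_oplus_def)
    then have "stem (?t (Suc k) u) = Suc (stem (?t k (peel u)))"
      using st(2) b c by (subst stem.simps) simp
    also have "\<dots> = Suc (stem (peel (lam (Suc k) u)))"
      using st Suc.IH[of "peel u"] False by simp
    also have "\<dots> = stem (lam (Suc k) u)"
      using st(2) c by (subst (2) stem.simps) simp
    finally show ?thesis .
  qed
qed simp

text \<open>The first leaf is a child of the root with label 1; peeling it restores the root label
  of v and leaves v.\<close>

lemma stem_oplus_lam_bullet:
  assumes "beta10_tree v" "v \<noteq> bullet"
  shows "stem (tree_oplus (lam 1 bullet) v) = Suc (stem v)"
proof -
  have "peel (tree_oplus (lam 1 bullet) v) = v" "\<not> blocked (tree_oplus (lam 1 bullet) v)"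
    "children (tree_oplus (lam 1 bullet) v) \<noteq> []"
    using beta10_label_pos[OF assms(1)] by (cases v; simp add: lam_def tree_oplus_def bullet_def)+
  then show ?thesis by (subst stem.simps) simp
qed

text \<open>Sums are given with a first summand having one root subtree, to match words with an
  indecomposable first summand.\<close>

lemma beta10_tree_cases_lam:
  assumes "beta10_tree t"
  obtains "t = bullet"
  | i u where "beta10_tree u" "1 \<le> i" "i \<le> label u" "t = lam i u"
  | i u v where "beta10_tree u" "1 \<le> i" "i \<le> label u" "beta10_tree v" "v \<noteq> bullet"
      "t = tree_oplus (lam i u) v"
proof (cases "t = bullet")
  case False
  then have c: "children t \<noteq> []" and l: "label t = sum_list (map label (children t))"
    and ch: "\<forall>s \<in> set (children t). valid_nonroot s"
    using assms by (auto simp: beta10_tree_def)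
  obtain a s ss where t: "t = Node a (s # ss)"
    using c by (cases t; cases "children t") auto
  obtain i us where s: "s = Node i us" by (cases s)
  define u where "u = root_node us"
  have "beta10_tree u"
    unfolding u_def by (rule beta10_tree_root_node) (use ch t s in \<open>auto split: if_splits\<close>)
  then have u: "beta10_tree u" "1 \<le> i" "i \<le> label u"
    using ch t s by (auto simp: u_def root_node_def bullet_def split: if_splits)
  have cu: "children u = us" by (auto simp: u_def root_node_def bullet_def)
  show thesis
  proof (cases "ss = []")
    case True
    then have "t = lam i u" using t s l cu by (simp add: lam_def)
    then show thesis using that(2) u by blast
  next
    case False
    have "beta10_tree (root_node ss)" "root_node ss \<noteq> bullet"
      using ch t False by (auto intro!: beta10_tree_root_node) (auto simp: root_node_def bullet_def)
    moreover have "t = tree_oplus (lam i u) (root_node ss)"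
      using t s l cu False by (simp add: lam_def tree_oplus_def root_node_def)
    ultimately show thesis using that(3) u by blast
  qed
qed (use that in blast)

lemma beta10_tree_lam:
  assumes "beta10_tree u" "1 \<le> i" "i \<le> label u"
  shows "beta10_tree (lam i u)"
proof (cases "u = bullet")
  case True
  then show ?thesis using assms by (simp add: beta10_tree_def lam_def bullet_def)
next
  case False
  then show ?thesis using assms by (auto simp: beta10_tree_def lam_def)
qed

lemma beta10_tree_oplus:
  assumes "beta10_tree u" "u \<noteq> bullet" "beta10_tree v" "v \<noteq> bullet"
  shows "beta10_tree (tree_oplus u v)"
  using assms by (auto simp: beta10_tree_def tree_oplus_def)

lemma lam_neq_bullet: "lam i u \<noteq> bullet"
  by (simp add: lam_def bullet_def)

lemma beta10_tree_induct [consumes 1, case_names bullet lam oplus]: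
  assumes "beta10_tree t" "P bullet"
    and lam: "\<And>i u. beta10_tree u \<Longrightarrow> 1 \<le> i \<Longrightarrow> i \<le> label u \<Longrightarrow> P u \<Longrightarrow> P (lam i u)"
    and oplus: "\<And>i u v. beta10_tree u \<Longrightarrow> 1 \<le> i \<Longrightarrow> i \<le> label u \<Longrightarrow> beta10_tree v \<Longrightarrow>
      v \<noteq> bullet \<Longrightarrow> P u \<Longrightarrow> P (lam i u) \<Longrightarrow> P v \<Longrightarrow> P (tree_oplus (lam i u) v)"
  shows "P t"
  using assms(1)
proof (induction "nodes t" arbitrary: t rule: less_induct)
  case less
  from less.prems show ?case
  proof (cases rule: beta10_tree_cases_lam)
    case 1
    then show ?thesis using assms(2) by simp
  next
    case (2 i u)
    then show ?thesis using less.hyps[of u] lam lam_stats(7)[of i u] by simp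
  next
    case (3 i u v)
    have "Suc (nodes t) = nodes (lam i u) + nodes v"
      unfolding 3(6) using 3 beta10_children[of v] by (intro tree_oplus_stats) (auto simp: lam_def)
    moreover have "1 < nodes v"
      using beta10_children[OF 3(4,5)] nodes_pos by (cases v; cases "children v") (auto simp: nodes_pos)
    ultimately have "nodes u < nodes t" "nodes v < nodes t"
      using lam_stats(7)[of i u] nodes_pos[of u] by simp_all
    then show ?thesis using 3 less.hyps lam oplus by metis
  qed
qed

section \<open>The bijection\<close>

text \<open>The clause on \<open>sub t = 1\<close> strengthens the induction: it supplies the
  indecomposable first summand that \<open>direct_sum\<close> requires.\<close>

lemma f_map_props:
  assumes "beta10_tree t"
  shows "f_map t \<in> avoiders (nodes t - 1) \<and>
    comp_stat (f_map t) = sub t \<and> 1 + asc (f_map t) = leaves t \<and> lmax (f_map t) = root_stat t \<and>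
    lmin (f_map t) = lpath t \<and> rmax (f_map t) = rpath t \<and> ldr (f_map t) = lsub t \<and>
    lir (f_map t) = stem t \<and> (sub t = 1 \<longrightarrow> indecomposable (f_map t))"
  using assms
proof (induction rule: beta10_tree_induct)
  case bullet
  have "[] \<in> avoiders 0" by (auto simp: avoiders_iff avoiding_def contains_3142_def contains_2_41_3_def)
  moreover have "lmax [] = 0" "lmin [] = 0" "rmax [] = 0" "ldr [] = 0" "lir [] = 0"
    by (simp_all add: lmax_def lmax_positions_def lmin_def rmax_def ldr_run_len lir_run_len run_len_Nil)
  ultimately show ?case
    using comp_stat_Nil asc_Nil stem_bullet unfolding f_map_bullet
    by (simp add: root_stat_def sub_def) (simp add: bullet_def)
next
  case (lam i u)
  define m where "m = nodes u - 1"
  have m: "f_map u \<in> avoiders m" "nodes (lam i u) - 1 = Suc m"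
    using lam.IH lam_stats(7)[of i u] nodes_pos[of u] by (auto simp: m_def)
  have b: "f_map u = [] \<longleftrightarrow> u = bullet"
  proof
    assume "f_map u = []"
    then have "sub u = 0" using lam.IH comp_stat_Nil by metis
    then show "u = bullet" using beta10_children[OF lam.hyps(1)] by (auto simp: sub_def)
  qed (simp add: f_map_bullet)
  have i: "i \<le> lmax (f_map u) \<or> f_map u = [] \<and> i = 1"
    using lam.hyps lam.IH b by (auto simp: root_stat_def bullet_def)
  note p = m(1) lam.hyps(2) i
  have "stem (lam i u) = (if u = bullet then 1 else min i (stem u))"
    using stem_lam[OF lam.hyps(1) _ lam.hyps(2,3)] stem_lam_bullet lam.hyps by (auto simp: bullet_def)
  then show ?case
    unfolding f_map_lam[OF lam.hyps(1)] m(2) lam_stats(1-6)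
    using phi_avoiders[OF p] phi_indecomposable[OF p] phi_asc[OF p] phi_lmax[OF p] phi_lmin[OF p]
      phi_rmax[OF p] phi_ldr[OF p] phi_lir[OF p] comp_stat_indecomposable lam.IH b by auto
next
  case (oplus i u v)
  let ?u = "lam i u"
  have tu: "beta10_tree ?u" "?u \<noteq> bullet" using beta10_tree_lam oplus.hyps lam_neq_bullet by auto
  have ch: "children ?u \<noteq> []" "children v \<noteq> []" using beta10_children tu oplus.hyps by auto
  have vne: "f_map v \<noteq> []"
    using oplus.IH(3) ch(2) comp_stat_Nil by (auto simp: sub_def)
  interpret direct_sum "f_map ?u" "f_map v" "nodes ?u - 1" "nodes v - 1"
    using oplus.IH vne lam_stats(1) by unfold_locales auto
  have n: "nodes (tree_oplus ?u v) - 1 = nodes ?u - 1 + (nodes v - 1)"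
    using tree_oplus_stats(7)[OF ch] nodes_pos[of ?u] nodes_pos[of v] by linarith
  have len: "length (f_map ?u) = nodes u"
    using avoiders_length[OF u] lam_stats(7) by simp
  \<comment> \<open>Matches the exceptional case of \<open>lir_oplus\<close>, a first summand of
    length 1, with that of \<open>stem\<close>, the summand \<open>lam 1 bullet\<close>.\<close>
  have "nodes u = 1 \<longleftrightarrow> u = bullet"
  proof
    assume n: "nodes u = 1"
    show "u = bullet"
    proof (rule ccontr)
      assume "u \<noteq> bullet"
      then have "children u \<noteq> []" using beta10_children oplus.hyps(1) by blast
      then obtain a s ss where "u = Node a (s # ss)" by (cases u; cases "children u") auto
      then show False using n nodes_pos[of s] by simp
    qed
  qed (simp add: bullet_def)
  then have "stem (tree_oplus ?u v) = (if nodes u = 1 then Suc (stem v) else stem ?u)"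
    using stem_oplus_lam[OF oplus.hyps(1) _ oplus.hyps(2-5)] stem_oplus_lam_bullet[OF oplus.hyps(4,5)]
      oplus.hyps by (auto simp: bullet_def)
  moreover have "sub v \<noteq> 0" using ch(2) by (simp add: sub_def)
  moreover have "root_stat ?u = label ?u" "root_stat v = label v"
    using tu(2) oplus.hyps(5) by (simp_all add: root_stat_def)
  moreover note perm_oplus_avoiders[OF u v] oplus.IH(2,3)
  ultimately show ?case
    unfolding f_map_oplus[OF tu oplus.hyps(4,5)] n tree_oplus_stats(1-6)[OF ch]
      comp_oplus asc_oplus lmax_oplus lmin_oplus rmax_oplus ldr_oplus lir_oplus len
    by (simp add: lam_stats(1))
qed

lemma f_map_avoiders: "beta10_tree t \<Longrightarrow> f_map t \<in> avoiders (nodes t - 1)"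
  using f_map_props by blast

lemma f_map_phi_premises:
  assumes "beta10_tree u" "1 \<le> i" "i \<le> label u"
  shows "i \<le> lmax (f_map u) \<or> f_map u = [] \<and> i = 1"
  using assms f_map_props[OF assms(1)] f_map_bullet by (auto simp: root_stat_def bullet_def)

text \<open>Since \<open>sub\<close> is the number of components of the image, equal images force
  equal shapes of the two trees. Then \<open>phi_inj\<close> cancels \<open>lam\<close>, and
  uniqueness of the first indecomposable summand cancels sums.\<close>

lemma f_map_inject:
  assumes "beta10_tree t" "beta10_tree t'" "f_map t = f_map t'"
  shows "t = t'"
  using assms
proof (induction arbitrary: t' rule: beta10_tree_induct)
  have sub: "sub x = sub y" if "beta10_tree x" "beta10_tree y" "f_map x = f_map y" for x y
    using that f_map_props by metis
  have sub2: "sub (tree_oplus (lam i u) v) \<ge> 2" if "beta10_tree v" "v \<noteq> bullet" for i u v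
    using beta10_children[OF that] by (cases "children v") (auto simp: sub_def tree_oplus_def lam_def)
  have oplus_tree: "beta10_tree (tree_oplus (lam i u) v)"
    if "beta10_tree u" "1 \<le> i" "i \<le> label u" "beta10_tree v" "v \<noteq> bullet" for i u v
    using beta10_tree_oplus beta10_tree_lam lam_neq_bullet that by blast
  {
    case bullet
    then have "sub t' = 0" using sub[of bullet t'] by (simp add: beta10_tree_def) (simp add: sub_def bullet_def)
    then show ?case using beta10_children bullet.prems by (force simp: sub_def)
  next
    case (lam i u)
    have tl: "beta10_tree (lam i u)" using beta10_tree_lam lam.hyps by blast
    have s: "sub t' = 1" using sub[OF tl lam.prems] lam_stats(1) by simp
    from lam.prems(1) show ?case
    proof (cases rule: beta10_tree_cases_lam)
      case 1
      then show ?thesis using s by (simp add: sub_def bullet_def)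
    next
      case (2 j w)
      \<comment> \<open>\<open>phi_inj\<close> compares words of one length, so the node counts are
        equated first.\<close>
      have "nodes u = nodes w"
        using avoiders_length[OF f_map_avoiders[OF tl]] avoiders_length[OF f_map_avoiders[OF lam.prems(1)]]
          lam.prems(2) 2(4) by (simp add: lam_stats(7))
      then have "f_map w \<in> avoiders (nodes u - 1)" using f_map_avoiders[OF 2(1)] by simp
      moreover have "phi i (f_map u) = phi j (f_map w)"
        using lam.prems(2) 2 lam.hyps by (simp add: f_map_lam)
      ultimately have "i = j" "f_map u = f_map w"
        using phi_inj[OF f_map_avoiders[OF lam.hyps(1)] lam.hyps(2) f_map_phi_premises[OF lam.hyps]]
          2(2) f_map_phi_premises[OF 2(1-3)] by blast+
      then show ?thesis using lam.IH 2 by blast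
    next
      case (3 j w v)
      then show ?thesis using s sub2[OF 3(4,5), of j w] by simp
    qed
  next
    case (oplus i u v)
    have to: "beta10_tree (tree_oplus (lam i u) v)" using oplus_tree oplus.hyps by blast
    have s: "2 \<le> sub t'" using sub[OF to oplus.prems] sub2[OF oplus.hyps(4,5), of i u] by simp
    have sum: "direct_sum (f_map (lam j w)) (f_map x) (nodes (lam j w) - 1) (nodes x - 1)"
      if "beta10_tree w" "1 \<le> j" "j \<le> label w" "beta10_tree x" "x \<noteq> bullet" for j w x
    proof -
      have "f_map x \<noteq> []"
        using f_map_props[OF that(4)] beta10_children[OF that(4,5)] comp_stat_Nil by (auto simp: sub_def)
      then show ?thesis
        using f_map_props[OF beta10_tree_lam[OF that(1-3)]] f_map_avoiders that lam_stats(1)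
        by unfold_locales auto
    qed
    from oplus.prems(1) show ?case
    proof (cases rule: beta10_tree_cases_lam)
      case 1
      then show ?thesis using s by (simp add: sub_def bullet_def)
    next
      case (2 j w)
      then show ?thesis using s lam_stats(1) by simp
    next
      case (3 j w x)
      note d = sum[OF oplus.hyps] and d' = sum[OF 3(1-5)]
      have l: "beta10_tree (lam i u)" "beta10_tree (lam j w)"
        using beta10_tree_lam oplus.hyps 3 by blast+
      have eq: "perm_oplus (f_map (lam i u)) (f_map v) = perm_oplus (f_map (lam j w)) (f_map x)"
        using oplus.prems(2) 3 oplus.hyps l lam_neq_bullet by (simp add: f_map_oplus)
      then have e1: "f_map (lam i u) = f_map (lam j w)"
        using indecomposable_append_inject[OF direct_sum.ind[OF d] direct_sum.ind[OF d']
            direct_sum.prec[OF d] direct_sum.prec[OF d']]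
        by (simp add: perm_oplus_def)
      then have "map (\<lambda>y. y + length (f_map (lam i u))) (f_map v) =
          map (\<lambda>y. y + length (f_map (lam i u))) (f_map x)"
        using eq by (simp add: perm_oplus_def)
      moreover have "inj (\<lambda>y :: nat. y + length (f_map (lam i u)))" by (simp add: inj_def)
      ultimately have "f_map v = f_map x" by (rule map_injective)
      then show ?thesis using oplus.IH(2)[OF l(2) e1] oplus.IH(3)[OF 3(4)] 3(6) by simp
    qed
  }
qed

lemma f_map_surj:
  "\<pi> \<in> avoiders n \<Longrightarrow> \<exists>t. beta10_tree t \<and> f_map t = \<pi>"
proof (induction n arbitrary: \<pi> rule: less_induct)
  case (less n)
  have len: "length \<pi> = n" using avoiders_length[OF less.prems] .
  \<comment> \<open>The splitting is arbitrary; \<open>f_map_oplus\<close> applies to any two trees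
    other than \<open>bullet\<close>.\<close>
  consider "\<pi> = []" | "indecomposable \<pi>" | \<gamma> \<delta> where "\<pi> = \<gamma> @ \<delta>" "\<gamma> \<prec> \<delta>" "\<gamma> \<noteq> []" "\<delta> \<noteq> []"
    unfolding indecomposable_def by blast
  then show ?case
  proof cases
    case 1
    then show ?thesis using f_map_bullet by (metis beta10_tree_def)
  next
    case 2
    then obtain m where m: "n = Suc m" using len by (cases n) (auto simp: indecomposable_def)
    then obtain i \<rho> where r: "\<rho> \<in> avoiders m" "1 \<le> i" "i \<le> lmax \<rho> \<or> \<rho> = [] \<and> i = 1" "phi i \<rho> = \<pi>"
      using phi_surj[of \<pi> m] less.prems 2 by auto
    obtain u where u: "beta10_tree u" "f_map u = \<rho>" using less.IH[of m \<rho>] m r(1) by auto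
    have "i \<le> label u"
      using r(3) f_map_props[OF u(1)] u(2) r(2) beta10_label_pos[OF u(1)]
      by (auto simp: root_stat_def split: if_splits)
    then show ?thesis using beta10_tree_lam[OF u(1) r(2)] f_map_lam[OF u(1), of i] r(4) u(2) by blast
  next
    case 3
    then obtain \<delta>' where d: "\<gamma> \<in> avoiders (length \<gamma>)" "\<delta>' \<in> avoiders (length \<delta>)" "perm_oplus \<gamma> \<delta>' = \<pi>"
      using avoiders_decompose[of \<gamma> \<delta> n] less.prems by auto
    have "length \<gamma> < n" "length \<delta> < n" using len 3 by auto
    then obtain u v where uv: "beta10_tree u" "f_map u = \<gamma>" "beta10_tree v" "f_map v = \<delta>'"
      using less.IH d by metis
    have "u \<noteq> bullet" "v \<noteq> bullet"
      using uv 3 f_map_bullet avoiders_length[OF d(2)] by auto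
    then show ?thesis using f_map_oplus beta10_tree_oplus uv d(3) by blast
  qed
qed

theorem theorem9:
  fixes n :: nat
  shows "bij_betw f_map {t. beta10_tree t \<and> nodes t = n + 1} (avoiders n) \<and>
    (\<forall>t. beta10_tree t \<and> nodes t = n + 1 \<longrightarrow>
      comp_stat (f_map t) = sub t \<and>
      1 + asc (f_map t) = leaves t \<and>
      lmax (f_map t) = root_stat t \<and>
      lmin (f_map t) = lpath t \<and>
      rmax (f_map t) = rpath t \<and>
      ldr (f_map t) = lsub t \<and>
      lir (f_map t) = stem t)"
proof (intro conjI)
  show "bij_betw f_map {t. beta10_tree t \<and> nodes t = n + 1} (avoiders n)"
    unfolding bij_betw_def
  proof (intro conjI equalityI subsetI)
    show "inj_on f_map {t. beta10_tree t \<and> nodes t = n + 1}"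
      using f_map_inject by (auto intro: inj_onI)
    show "\<pi> \<in> avoiders n" if "\<pi> \<in> f_map ` {t. beta10_tree t \<and> nodes t = n + 1}" for \<pi>
      using that f_map_avoiders by fastforce
    fix \<pi> assume p: "\<pi> \<in> avoiders n"
    then obtain t where t: "beta10_tree t" "f_map t = \<pi>" using f_map_surj by blast
    then have "nodes t = n + 1"
      using avoiders_length[OF p] avoiders_length[OF f_map_avoiders[OF t(1)]] nodes_pos[of t] by simp
    then show "\<pi> \<in> f_map ` {t. beta10_tree t \<and> nodes t = n + 1}" using t by blast
  qed
  show "\<forall>t. beta10_tree t \<and> nodes t = n + 1 \<longrightarrow>
      comp_stat (f_map t) = sub t \<and>
      1 + asc (f_map t) = leaves t \<and>
      lmax (f_map t) = root_stat t \<and>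
      lmin (f_map t) = lpath t \<and>
      rmax (f_map t) = rpath t \<and>
      ldr (f_map t) = lsub t \<and>
      lir (f_map t) = stem t"
    using f_map_props by blast
qed

end
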